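(* Let $d\ge2$, $m\in\mathbb N$, $\lambda=\lambda(2m)=2m(2m+d-2)$, let $B_1\subset\mathbb{R}^d$ be the unit ball, and let $\mathcal K$ be the set of functions on $\partial B_1$ which are non-negative on the equator $\{x_d=0\}\cap\partial B_1$. Let $\mathcal S_\lambda$ be the set of critical points of $\mathcal F_{th}^\lambda$ which are non-negative on $\{x_d=0\}\cap\partial B_1$. Then there are constants $C$ and $\delta$, depending only on the dimension $d$ and the homogeneity $2m$, such that $$f_\gamma\big(\mathcal F_{th}^\lambda(u)\big)\le C\,\|\nabla\mathcal F_{th}^\lambda(u)\|_{\mathcal K}\qquad\text{for every }u\in\mathcal K\cap H^2(\partial B_1)\text{ such that }\mathrm{dist}_2(u,\mathcal S_\lambda)\le\delta,$$ where $\gamma=\frac1d$. In particular, for every $E\ge1$, we have $$\big(\mathcal F_{th}^\lambda(u)\big)_+^{1-\gamma}\le C\,E^{\frac12-\gamma}\,\|\nabla\mathcal F_{th}^\lambda(u)\|_{\mathcal K}$$ for every $u\in H^2(\partial B_1)\cap\mathcal K$ such that $\mathrm{dist}_2(u,\mathcal S_\lambda)\le\delta$ and $\mathcal F_{th}^\lambda(u)\le E$.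
   Context: $\nabla$ and $\Delta$ are the gradient and Laplace–Beltrami operator on the unit sphere $\partial B_1$, and $$\mathcal F_{th}^\lambda(u)=\frac12\int_{\partial B_1}(|\nabla u|^2-\lambda u^2)\,d\mathcal H^{d-1},\qquad\nabla\mathcal F_{th}^\lambda(u)=-\Delta u-\lambda u\ \text{ for }u\in H^2(\partial B_1).$$ The sign condition on the equator in the definition of $\mathcal K$ is understood in the sense of traces, for functions in $H^1(\partial B_1)$. For $u\in\mathcal K\cap H^2(\partial B_1)$, $$\|\nabla\mathcal F_{th}^\lambda(u)\|_{\mathcal K}:=\sup\Big\{0,\ \sup_{v\in\mathcal K\setminus\{u\}}\frac{-\int_{\partial B_1}(v-u)(-\Delta u-\lambda u)\,d\mathcal H^{d-1}}{\|v-u\|_{L^2(\partial B_1)}}\Big\}.$$ The critical points of $\mathcal F_{th}^\lambda$ are the functions $\phi$ with $-\Delta\phi=\lambda\phi$ on $\partial B_1$; $\mathcal F_{th}^\lambda$ vanishes on $\mathcal S_\lambda$. $\mathrm{dist}_2(u,\mathcal S_\lambda)$ is the $L^2(\partial B_1)$ distance from $u$ to $\mathcal S_\lambda$. For $\gamma\in(0,\frac12]$, $f_\gamma:\mathbb{R}\to[0,\infty)$ is defined by $f_\gamma(t)=t^{1/2}$ if $t\ge1$, $f_\gamma(t)=t^{1-\gamma}$ if $0\le t\le1$, and $f_\gamma(t)=0$ if $t\le0$. *)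

theory Defs
  imports "HOL-Analysis.Analysis"
begin

section \<open>Hausdorff measure\<close>

text \<open>
  The size of a covering set is \<open>\<omega>\<^sub>s (diam U / 2)\<^sup>s\<close>, where \<open>\<omega>\<^sub>s\<close> is the volume of the
  \<open>s\<close>-dimensional unit ball. The empty set is treated separately so that, with \<open>0 ^ 0 = 1\<close>,
  the measure for \<open>s = 0\<close> is the counting measure.
\<close>

definition hausdorff_gauge :: "nat \<Rightarrow> 'a::metric_space set \<Rightarrow> ennreal" where
  "hausdorff_gauge s U =
     (if U = {} then 0 else ennreal (unit_ball_vol (real s) * (diameter U / 2) ^ s))"

definition hausdorff_content :: "nat \<Rightarrow> real \<Rightarrow> 'a::metric_space set \<Rightarrow> ennreal" where
  "hausdorff_content s \<epsilon> A =
     Inf {(\<Sum>i. hausdorff_gauge s (U i)) | U :: nat \<Rightarrow> 'a set.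
            A \<subseteq> (\<Union>i. U i) \<and> (\<forall>i. bounded (U i) \<and> diameter (U i) \<le> \<epsilon>)}"

definition hausdorff_outer :: "nat \<Rightarrow> 'a::metric_space set \<Rightarrow> ennreal" where
  "hausdorff_outer s A = (SUP \<epsilon>\<in>{0<..}. hausdorff_content s \<epsilon> A)"

text \<open>
  The outer measure is a metric outer measure, hence countably additive on the Borel sets by
  Caratheodory's criterion, so that \<^const>\<open>measure_of\<close> does return its restriction to them.
\<close>

definition hausdorff_measure :: "nat \<Rightarrow> 'a::metric_space measure" where
  "hausdorff_measure s = measure_of UNIV (sets borel) (hausdorff_outer s)"


section \<open>The unit sphere, its equators, and square integrable functions\<close>

text \<open>
  The ambient space is \<open>\<real>\<^sup>d = real ^ 'n\<close> with \<open>d = CARD('n)\<close>. Functions on the sphere are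
  represented by functions on the ambient space; their values off the sphere are irrelevant.
\<close>

definition sphere_measure :: "(real ^ 'n) measure" where
  "sphere_measure = restrict_space (hausdorff_measure (CARD('n) - 1)) (sphere 0 1)"

definition equator :: "'n \<Rightarrow> (real ^ 'n) set" where
  "equator k = {x \<in> sphere 0 1. x $ k = 0}"

definition equator_measure :: "'n \<Rightarrow> (real ^ 'n) measure" where
  "equator_measure k = restrict_space (hausdorff_measure (CARD('n) - 2)) (equator k)"

definition L2 :: "'a measure \<Rightarrow> ('a \<Rightarrow> real) set" where
  "L2 M = {f \<in> borel_measurable M. integrable M (\<lambda>x. (f x)\<^sup>2)}"

definition L2_norm :: "'a measure \<Rightarrow> ('a \<Rightarrow> real) \<Rightarrow> real" where
  "L2_norm M f = sqrt (\<integral>x. (f x)\<^sup>2 \<partial>M)"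


section \<open>Sobolev spaces on the sphere\<close>

definition C1_with_gradient :: "(real ^ 'n \<Rightarrow> real) \<Rightarrow> (real ^ 'n \<Rightarrow> real ^ 'n) \<Rightarrow> bool" where
  "C1_with_gradient \<phi> G \<longleftrightarrow> (\<forall>x. GDERIV \<phi> x :> G x) \<and> continuous_on UNIV G"

text \<open>
  For \<open>x\<close> on the sphere, the projection onto the tangent space at \<open>x\<close>. It maps the ambient
  gradient of a function at \<open>x\<close> to the gradient of its restriction to the sphere.
\<close>

definition tangential :: "real ^ 'n \<Rightarrow> real ^ 'n \<Rightarrow> real ^ 'n" where
  "tangential x v = v - (x \<bullet> v) *\<^sub>R x"

text \<open>
  The \<open>i\<close>-th component \<open>D\<^sub>i u\<close> of the tangential gradient, in the weak sense. The last term is the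
  curvature term of the divergence theorem on a hypersurface,
  \<open>\<integral> D\<^sub>i \<psi> = \<integral> H \<nu>\<^sub>i \<psi>\<close>, for the unit sphere, where \<open>\<nu> x = x\<close> and \<open>H = d - 1\<close>.
\<close>

definition weak_tderiv :: "'n \<Rightarrow> (real ^ 'n \<Rightarrow> real) \<Rightarrow> (real ^ 'n \<Rightarrow> real) \<Rightarrow> bool" where
  "weak_tderiv i u g \<longleftrightarrow>
     (\<forall>\<phi> G. C1_with_gradient \<phi> G \<longrightarrow>
        (\<integral>x. u x * (tangential x (G x) $ i) \<partial>sphere_measure) =
          - (\<integral>x. g x * \<phi> x \<partial>sphere_measure)
          + (real CARD('n) - 1) * (\<integral>x. u x * \<phi> x * (x $ i) \<partial>sphere_measure))"

definition H1 :: "(real ^ 'n \<Rightarrow> real) set" where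
  "H1 = {u \<in> L2 sphere_measure. \<forall>i. \<exists>g \<in> L2 sphere_measure. weak_tderiv i u g}"

definition tderiv :: "'n \<Rightarrow> (real ^ 'n \<Rightarrow> real) \<Rightarrow> (real ^ 'n \<Rightarrow> real)" where
  "tderiv i u = (SOME g. g \<in> L2 sphere_measure \<and> weak_tderiv i u g)"

definition H2 :: "(real ^ 'n \<Rightarrow> real) set" where
  "H2 = {u \<in> H1. \<forall>i. tderiv i u \<in> H1}"

definition tgrad :: "(real ^ 'n \<Rightarrow> real) \<Rightarrow> real ^ 'n \<Rightarrow> real ^ 'n" where
  "tgrad u x = (\<chi> i. tderiv i u x)"

definition laplace_beltrami :: "(real ^ 'n \<Rightarrow> real) \<Rightarrow> real ^ 'n \<Rightarrow> real" where
  "laplace_beltrami u x = (\<Sum>i\<in>UNIV. tderiv i (tderiv i u) x)"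

text \<open>
  The trace on the equator is the continuous extension, from \<open>C\<^sup>1\<close> functions to \<^const>\<open>H1\<close>, of
  the restriction map into \<open>L\<^sup>2\<close> of the equator.
\<close>

definition is_trace :: "'n \<Rightarrow> (real ^ 'n \<Rightarrow> real) \<Rightarrow> (real ^ 'n \<Rightarrow> real) \<Rightarrow> bool" where
  "is_trace k u T \<longleftrightarrow>
     T \<in> L2 (equator_measure k) \<and>
     (\<exists>\<phi> G. (\<forall>n. C1_with_gradient (\<phi> n) (G n)) \<and>
        (\<lambda>n. L2_norm sphere_measure (\<lambda>x. \<phi> n x - u x)) \<longlonglongrightarrow> 0 \<and>
        (\<lambda>n. L2_norm sphere_measure (\<lambda>x. norm (tangential x (G n x) - tgrad u x))) \<longlonglongrightarrow> 0 \<and>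
        (\<lambda>n. L2_norm (equator_measure k) (\<lambda>x. \<phi> n x - T x)) \<longlonglongrightarrow> 0)"

definition K_space :: "'n \<Rightarrow> (real ^ 'n \<Rightarrow> real) set" where
  "K_space k = {u \<in> H1. \<exists>T. is_trace k u T \<and> (AE x in equator_measure k. 0 \<le> T x)}"


section \<open>The energy, its critical points and its slope on the constraint set\<close>

definition F_th :: "real \<Rightarrow> (real ^ 'n \<Rightarrow> real) \<Rightarrow> real" where
  "F_th lam u = 1 / 2 * (\<integral>x. (norm (tgrad u x))\<^sup>2 - lam * (u x)\<^sup>2 \<partial>sphere_measure)"

definition grad_F_th :: "real \<Rightarrow> (real ^ 'n \<Rightarrow> real) \<Rightarrow> real ^ 'n \<Rightarrow> real" where
  "grad_F_th lam u x = - laplace_beltrami u x - lam * u x"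

definition critical_points :: "real \<Rightarrow> (real ^ 'n \<Rightarrow> real) set" where
  "critical_points lam = {\<phi> \<in> H2. AE x in sphere_measure. grad_F_th lam \<phi> x = 0}"

definition S_space :: "'n \<Rightarrow> real \<Rightarrow> (real ^ 'n \<Rightarrow> real) set" where
  "S_space k lam = critical_points lam \<inter> K_space k"

definition dist2 :: "(real ^ 'n \<Rightarrow> real) \<Rightarrow> (real ^ 'n \<Rightarrow> real) set \<Rightarrow> real" where
  "dist2 u A = (INF \<phi>\<in>A. L2_norm sphere_measure (\<lambda>x. u x - \<phi> x))"

text \<open>
  Functions are identified when they agree almost everywhere, so \<open>v \<noteq> u\<close> reads
  \<open>\<parallel>v - u\<parallel> \<noteq> 0\<close>. The supremum is a real number: by the Cauchy-Schwarz inequality the set is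
  bounded by the \<open>L\<^sup>2\<close> norm of \<^term>\<open>grad_F_th lam u\<close> when \<open>u\<close> is in \<^const>\<open>H2\<close>.
\<close>

definition grad_norm_K :: "'n \<Rightarrow> real \<Rightarrow> (real ^ 'n \<Rightarrow> real) \<Rightarrow> real" where
  "grad_norm_K k lam u =
     Sup (insert 0
       {- (\<integral>x. (v x - u x) * grad_F_th lam u x \<partial>sphere_measure)
            / L2_norm sphere_measure (\<lambda>x. v x - u x) | v.
          v \<in> K_space k \<and> L2_norm sphere_measure (\<lambda>x. v x - u x) \<noteq> 0})"

definition f_gam :: "real \<Rightarrow> real \<Rightarrow> real" where
  "f_gam \<gamma> t = (if 1 \<le> t then t powr (1 / 2) else if 0 \<le> t then t powr (1 - \<gamma>) else 0)"

end

theory Submission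
  imports Defs
begin

text \<open>
  Write \<open>g = - \<Delta>u - \<lambda>u\<close> for the gradient of the energy \<open>F\<close> at \<open>u\<close>, and \<open>\<sigma>\<close> for its slope on the
  constraint set. The inequality rests on two facts.

  The slope controls the full norm of the gradient: \<open>\<parallel>g\<parallel> \<le> 2\<sigma>\<close>. The constraint only concerns the trace
  on the equator, which is a null set of the sphere. Hence the \<open>C\<^sup>1\<close> functions that vanish on the
  equator are dense in \<open>L\<^sup>2\<close> (\<open>dense_vanishing_on_equator\<close>), and adding such a function \<open>w\<close> to \<open>u\<close>
  keeps its trace, thus keeps it in the constraint set (\<open>K_space_add\<close>). Since \<open>g\<close> is itself in
  \<open>L\<^sup>2\<close>, the choice \<open>w \<approx> - g\<close> is admissible and gives a difference quotient close to \<open>\<parallel>g\<parallel>\<close>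
  (\<open>grad_norm_K_ge\<close>).

  The gradient controls the energy: \<open>F(u) \<le> \<parallel>g\<parallel>\<^sup>2\<close>. The eigenvalues \<open>j(j + d - 2)\<close> of \<open>- \<Delta>\<close> and the
  number \<open>\<lambda>\<close> are integers, so each difference \<open>\<mu>\<^sub>j = j(j + d - 2) - \<lambda>\<close> satisfies \<open>\<mu>\<^sub>j \<le> 2\<mu>\<^sub>j\<^sup>2\<close>. With
  \<open>u\<^sub>j\<close> the component of \<open>u\<close> in the \<open>j\<close>-th eigenspace, formally
  \<open>2F(u) = \<integral> ug = \<Sum> \<mu>\<^sub>j \<parallel>u\<^sub>j\<parallel>\<^sup>2 \<le> 2 \<Sum> \<mu>\<^sub>j\<^sup>2 \<parallel>u\<^sub>j\<parallel>\<^sup>2 = 2\<parallel>g\<parallel>\<^sup>2\<close>. The first equality is an integration by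
  parts of \<open>u\<close> against itself, which is legitimate because having a trace includes being a limit of
  \<open>C\<^sup>1\<close> functions together with the gradients (\<open>F_th_eq\<close>); the inequality is proved by approximation with
  polynomials, for which the decomposition into eigenfunctions is finite (\<open>spectral_inequality\<close>).

  Together \<open>F(u) \<le> (2\<sigma>)\<^sup>2\<close>, and as \<open>1 - \<gamma> \<ge> 1/2\<close> both assertions follow by comparing powers
  (\<open>f_gam_le\<close>).

  The analysis on the sphere is derived from two properties of the Hausdorff measure: it is finite on
  the sphere, by a covering with grid cells, and it is invariant under isometries. Differentiating
  the integral of a \<open>C\<^sup>1\<close> function along a one-parameter group of rotations gives the divergence theorem
  (\<open>divergence_sphere\<close>). It shows that \<open>C\<^sup>1\<close> functions are weakly differentiable, that the equator is a
  null set, and that the Laplacian is symmetric on polynomials. The Laplacian maps polynomials of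
  degree at most \<open>n\<close> to such polynomials, and modulo lower degree it is multiplication by
  \<open>- n(n + d - 2)\<close> (\<open>slaplace_triangular\<close>); as these numbers are distinct, every polynomial is on the
  sphere a sum of eigenfunctions (\<open>eigenfunction_decomposition\<close>). Polynomials are dense by the
  Stone--Weierstrass theorem.
\<close>

section \<open>Square integrable functions\<close>

lemma L2_measurable [measurable_dest]: "f \<in> L2 M \<Longrightarrow> f \<in> borel_measurable M"
  by (simp add: L2_def)

lemma L2_integrable_mult:
  assumes "f \<in> L2 M" "g \<in> L2 M"
  shows "integrable M (\<lambda>x. f x * g x)"
proof (rule Bochner_Integration.integrable_bound)
  show "integrable M (\<lambda>x. (f x)\<^sup>2 + (g x)\<^sup>2)"
    using assms by (simp add: L2_def)
  have "\<bar>f x * g x\<bar> \<le> (f x)\<^sup>2 + (g x)\<^sup>2" for x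
    using sum_squares_bound[of "\<bar>f x\<bar>" "\<bar>g x\<bar>"] mult_nonneg_nonneg[of "\<bar>f x\<bar>" "\<bar>g x\<bar>"]
    unfolding abs_mult power2_abs by linarith
  then show "AE x in M. norm (f x * g x) \<le> norm ((f x)\<^sup>2 + (g x)\<^sup>2)"
    by auto
qed (use assms in \<open>auto simp: L2_def\<close>)

lemma L2_integrable_square: "f \<in> L2 M \<Longrightarrow> integrable M (\<lambda>x. (f x)\<^sup>2)"
  by (simp add: L2_def)

lemma L2_add:
  assumes "f \<in> L2 M" "g \<in> L2 M"
  shows "(\<lambda>x. f x + g x) \<in> L2 M"
proof -
  have "integrable M (\<lambda>x. (f x)\<^sup>2 + (g x)\<^sup>2 + 2 * (f x * g x))"
    using assms L2_integrable_mult[OF assms] by (intro Bochner_Integration.integrable_add) (auto simp: L2_def)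
  moreover have "(\<lambda>x. f x + g x) \<in> borel_measurable M"
    using assms by (auto simp: L2_def)
  ultimately show ?thesis
    by (simp add: L2_def power2_sum mult.assoc)
qed

lemma L2_cmult: "f \<in> L2 M \<Longrightarrow> (\<lambda>x. c * f x) \<in> L2 M"
  by (auto simp: L2_def power_mult_distrib)

lemma L2_uminus: "f \<in> L2 M \<Longrightarrow> (\<lambda>x. - f x) \<in> L2 M"
  by (simp add: L2_def)

lemma L2_diff: "f \<in> L2 M \<Longrightarrow> g \<in> L2 M \<Longrightarrow> (\<lambda>x. f x - g x) \<in> L2 M"
  using L2_add[of f M "\<lambda>x. - g x"] L2_uminus[of g M] by simp

lemma L2_zero: "(\<lambda>x. 0) \<in> L2 M"
  by (simp add: L2_def)

lemma L2_sum: "(\<And>i. i \<in> I \<Longrightarrow> f i \<in> L2 M) \<Longrightarrow> (\<lambda>x. \<Sum>i\<in>I. f i x) \<in> L2 M"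
  by (induction I rule: infinite_finite_induct) (auto intro: L2_add L2_zero)

lemma L2_bounded_mult:
  assumes f: "f \<in> L2 M" and [measurable]: "h \<in> borel_measurable M"
    and bound: "\<And>x. x \<in> space M \<Longrightarrow> \<bar>h x\<bar> \<le> B"
  shows "(\<lambda>x. f x * h x) \<in> L2 M"
proof -
  have [measurable]: "f \<in> borel_measurable M"
    using f by (rule L2_measurable)
  have "integrable M (\<lambda>x. (f x * h x)\<^sup>2)"
  proof (rule Bochner_Integration.integrable_bound)
    show "integrable M (\<lambda>x. B\<^sup>2 * (f x)\<^sup>2)"
      using f by (simp add: L2_def)
    show "AE x in M. norm ((f x * h x)\<^sup>2) \<le> norm (B\<^sup>2 * (f x)\<^sup>2)"
    proof (rule AE_I2)
      fix x assume "x \<in> space M"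
      then have "(h x)\<^sup>2 \<le> B\<^sup>2"
        using bound power_mono[of "\<bar>h x\<bar>" B 2] by auto
      then show "norm ((f x * h x)\<^sup>2) \<le> norm (B\<^sup>2 * (f x)\<^sup>2)"
        by (simp add: power_mult_distrib mult_left_mono mult.commute[of "B\<^sup>2"])
    qed
  qed simp
  then show ?thesis
    by (simp add: L2_def)
qed

lemma L2_bounded:
  assumes "finite_measure M" and "h \<in> borel_measurable M"
    and "\<And>x. x \<in> space M \<Longrightarrow> \<bar>h x\<bar> \<le> B"
  shows "h \<in> L2 M"
proof -
  have "(\<lambda>_. 1) \<in> L2 M"
    using finite_measure.integrable_const[OF assms(1), of "1::real"] by (simp add: L2_def)
  from L2_bounded_mult[OF this assms(2,3)] show ?thesis
    by simp
qed

lemma L2_norm_nonneg: "0 \<le> L2_norm M f"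
  by (simp add: L2_norm_def)

lemma L2_norm_square: "(L2_norm M f)\<^sup>2 = (\<integral>x. (f x)\<^sup>2 \<partial>M)"
  by (simp add: L2_norm_def)

text \<open>
  The integral of \<open>(s f + t g)\<^sup>2\<close> is a nonnegative quadratic form in \<open>(s, t)\<close>, so its discriminant
  has a sign.
\<close>

lemma L2_Cauchy_Schwarz:
  assumes f: "f \<in> L2 M" and g: "g \<in> L2 M"
  shows "\<bar>\<integral>x. f x * g x \<partial>M\<bar> \<le> L2_norm M f * L2_norm M g"
proof -
  define a b c where "a = (\<integral>x. (f x)\<^sup>2 \<partial>M)" and "b = (\<integral>x. f x * g x \<partial>M)" and "c = (\<integral>x. (g x)\<^sup>2 \<partial>M)"
  note ints = L2_integrable_mult[OF f g] L2_integrable_square[OF f] L2_integrable_square[OF g]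
  have quad: "0 \<le> s\<^sup>2 * a + 2 * s * t * b + t\<^sup>2 * c" for s t
  proof -
    have "0 \<le> (\<integral>x. (s * f x + t * g x)\<^sup>2 \<partial>M)"
      by simp
    also have "(\<lambda>x. (s * f x + t * g x)\<^sup>2) = (\<lambda>x. s\<^sup>2 * (f x)\<^sup>2 + 2 * s * t * (f x * g x) + t\<^sup>2 * (g x)\<^sup>2)"
      by (auto simp: power2_eq_square algebra_simps)
    also have "(\<integral>x. s\<^sup>2 * (f x)\<^sup>2 + 2 * s * t * (f x * g x) + t\<^sup>2 * (g x)\<^sup>2 \<partial>M) = s\<^sup>2 * a + 2 * s * t * b + t\<^sup>2 * c"
      using ints by (simp add: a_def b_def c_def)
    finally show ?thesis .
  qed
  have nonneg: "0 \<le> a" "0 \<le> c"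
    by (auto simp: a_def c_def)
  \<comment> \<open>for \<open>a = 0\<close> the quadratic form is affine in \<open>s\<close>, otherwise evaluate it at \<open>(- b, a)\<close>\<close>
  have "b\<^sup>2 \<le> a * c"
  proof (cases "a = 0")
    case True
    have "b = 0"
    proof (rule ccontr)
      assume "b \<noteq> 0"
      then show False
        using quad[of "- (c + 1) / (2 * b)" 1] True by (simp add: field_simps)
    qed
    then show ?thesis using True by simp
  next
    case False
    then have "0 < a" using nonneg by simp
    have "0 \<le> b\<^sup>2 * a - 2 * b * a * b + a\<^sup>2 * c"
      using quad[of "- b" a] by simp
    then have "0 \<le> a * (a * c - b\<^sup>2)"
      by (simp add: power2_eq_square algebra_simps)
    then show ?thesis
      using \<open>0 < a\<close> by (simp add: zero_le_mult_iff)
  qed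
  then have "\<bar>b\<bar> \<le> sqrt (a * c)"
    by (metis real_sqrt_abs real_sqrt_le_mono)
  then show ?thesis
    by (simp add: L2_norm_def a_def b_def c_def real_sqrt_mult)
qed

lemma L2_norm_triangle:
  assumes f: "f \<in> L2 M" and g: "g \<in> L2 M"
  shows "L2_norm M (\<lambda>x. f x + g x) \<le> L2_norm M f + L2_norm M g"
proof -
  note ints = L2_integrable_mult[OF f g] L2_integrable_square[OF f] L2_integrable_square[OF g]
  have "(\<integral>x. (f x + g x)\<^sup>2 \<partial>M) = (\<integral>x. (f x)\<^sup>2 + (g x)\<^sup>2 + 2 * (f x * g x) \<partial>M)"
    by (simp add: power2_sum mult.assoc)
  also have "\<dots> = (L2_norm M f)\<^sup>2 + (L2_norm M g)\<^sup>2 + 2 * (\<integral>x. f x * g x \<partial>M)"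
    using ints by (simp add: L2_norm_square)
  also have "\<dots> \<le> (L2_norm M f + L2_norm M g)\<^sup>2"
    using L2_Cauchy_Schwarz[OF f g] by (simp add: power2_sum)
  finally show ?thesis
    using L2_norm_nonneg[of M f] L2_norm_nonneg[of M g] by (simp add: L2_norm_def real_le_lsqrt)
qed

lemma L2_integral_tendsto:
  assumes "\<And>n. f n \<in> L2 M" "u \<in> L2 M" "h \<in> L2 M"
    and lim: "(\<lambda>n. L2_norm M (\<lambda>x. f n x - u x)) \<longlonglongrightarrow> 0"
  shows "(\<lambda>n. \<integral>x. f n x * h x \<partial>M) \<longlonglongrightarrow> (\<integral>x. u x * h x \<partial>M)"
proof -
  have "(\<lambda>n. (\<integral>x. f n x * h x \<partial>M) - (\<integral>x. u x * h x \<partial>M)) \<longlonglongrightarrow> 0"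
  proof (rule Lim_null_comparison)
    show "(\<lambda>n. L2_norm M (\<lambda>x. f n x - u x) * L2_norm M h) \<longlonglongrightarrow> 0"
      by (rule tendsto_mult_left_zero[OF lim])
    have "\<bar>(\<integral>x. f n x * h x \<partial>M) - (\<integral>x. u x * h x \<partial>M)\<bar> \<le> L2_norm M (\<lambda>x. f n x - u x) * L2_norm M h" for n
    proof -
      have "(\<integral>x. f n x * h x \<partial>M) - (\<integral>x. u x * h x \<partial>M) = (\<integral>x. (f n x - u x) * h x \<partial>M)"
        using assms by (subst Bochner_Integration.integral_diff[symmetric])
          (auto intro!: L2_integrable_mult simp: algebra_simps)
      then show ?thesis
        using L2_Cauchy_Schwarz[of "\<lambda>x. f n x - u x" M h] assms by (simp add: L2_diff)
    qed
    then show "\<forall>\<^sub>F n in sequentially. norm ((\<integral>x. f n x * h x \<partial>M) - (\<integral>x. u x * h x \<partial>M))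
        \<le> L2_norm M (\<lambda>x. f n x - u x) * L2_norm M h"
      by simp
  qed
  then show ?thesis
    by (rule LIM_zero_cancel)
qed

lemma L2_norm_cong_AE:
  assumes "AE x in M. f x = g x" "f \<in> borel_measurable M" "g \<in> borel_measurable M"
  shows "L2_norm M f = L2_norm M g"
  unfolding L2_norm_def using assms by (intro arg_cong[where f=sqrt] integral_cong_AE) auto

lemma L2_AE_zero_iff:
  assumes "f \<in> L2 M"
  shows "(\<integral>x. (f x)\<^sup>2 \<partial>M) = 0 \<longleftrightarrow> (AE x in M. f x = 0)"
  using integral_nonneg_eq_0_iff_AE[OF L2_integrable_square[OF assms]] by simp

section \<open>Dense subspaces of square integrable functions\<close>

definition L2_closure :: "'a measure \<Rightarrow> ('a \<Rightarrow> real) set \<Rightarrow> ('a \<Rightarrow> real) set" where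
  "L2_closure M V = {f \<in> L2 M. \<forall>e>0. \<exists>q\<in>V. L2_norm M (\<lambda>x. f x - q x) < e}"

lemma L2_closureD:
  assumes "f \<in> L2_closure M V" "0 < e"
  obtains q where "q \<in> V" "L2_norm M (\<lambda>x. f x - q x) < e"
  using assms by (auto simp: L2_closure_def)

lemma L2_closureI:
  assumes "f \<in> L2 M" "\<And>e. 0 < e \<Longrightarrow> \<exists>q\<in>V. L2_norm M (\<lambda>x. f x - q x) < e"
  shows "f \<in> L2_closure M V"
  using assms by (simp add: L2_closure_def)

lemma L2_closure_L2: "f \<in> L2_closure M V \<Longrightarrow> f \<in> L2 M"
  by (simp add: L2_closure_def)

lemma L2_closure_add:
  assumes V: "V \<subseteq> L2 M" "\<And>p q. p \<in> V \<Longrightarrow> q \<in> V \<Longrightarrow> (\<lambda>x. p x + q x) \<in> V"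
    and f: "f \<in> L2_closure M V" and g: "g \<in> L2_closure M V"
  shows "(\<lambda>x. f x + g x) \<in> L2_closure M V"
proof -
  have "\<exists>q\<in>V. L2_norm M (\<lambda>x. f x + g x - q x) < e" if "0 < e" for e
  proof -
    obtain p where p: "p \<in> V" "L2_norm M (\<lambda>x. f x - p x) < e / 2"
      using L2_closureD[OF f half_gt_zero[OF \<open>0 < e\<close>]] by blast
    obtain q where q: "q \<in> V" "L2_norm M (\<lambda>x. g x - q x) < e / 2"
      using L2_closureD[OF g half_gt_zero[OF \<open>0 < e\<close>]] by blast
    have "L2_norm M (\<lambda>x. (f x - p x) + (g x - q x)) \<le> L2_norm M (\<lambda>x. f x - p x) + L2_norm M (\<lambda>x. g x - q x)"
      using p(1) q(1) V(1) by (intro L2_norm_triangle L2_diff L2_closure_L2[OF f] L2_closure_L2[OF g]) auto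
    then have "L2_norm M (\<lambda>x. f x + g x - (p x + q x)) < e"
      using p q by (simp add: algebra_simps)
    then show ?thesis
      using V(2)[OF p(1) q(1)] by (intro bexI[of _ "\<lambda>x. p x + q x"]) auto
  qed
  then show ?thesis
    by (intro L2_closureI L2_add L2_closure_L2[OF f] L2_closure_L2[OF g])
qed

lemma L2_norm_cmult: "L2_norm M (\<lambda>x. c * f x) = \<bar>c\<bar> * L2_norm M f"
  by (simp add: L2_norm_def power_mult_distrib real_sqrt_mult)

lemma L2_norm_minus_commute: "L2_norm M (\<lambda>x. f x - g x) = L2_norm M (\<lambda>x. g x - f x)"
  by (simp add: L2_norm_def power2_commute)

lemma L2_closure_cmult:
  assumes V: "V \<subseteq> L2 M" "\<And>p c. p \<in> V \<Longrightarrow> (\<lambda>x. c * p x) \<in> V"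
    and f: "f \<in> L2_closure M V"
  shows "(\<lambda>x. c * f x) \<in> L2_closure M V"
proof -
  have "\<exists>q\<in>V. L2_norm M (\<lambda>x. c * f x - q x) < e" if "0 < e" for e
  proof -
    obtain p where p: "p \<in> V" "L2_norm M (\<lambda>x. f x - p x) < e / (\<bar>c\<bar> + 1)"
      using L2_closureD[OF f divide_pos_pos[OF \<open>0 < e\<close>, of "\<bar>c\<bar> + 1"]] by force
    have "L2_norm M (\<lambda>x. c * f x - c * p x) = \<bar>c\<bar> * L2_norm M (\<lambda>x. f x - p x)"
      by (simp flip: L2_norm_cmult right_diff_distrib)
    also have "\<dots> \<le> (\<bar>c\<bar> + 1) * L2_norm M (\<lambda>x. f x - p x)"
      by (intro mult_right_mono L2_norm_nonneg) simp
    also have "\<dots> < e"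
      using p(2) by (simp add: pos_less_divide_eq mult.commute add_nonneg_pos)
    finally show ?thesis
      using V(2)[OF p(1)] by (intro bexI[of _ "\<lambda>x. c * p x"]) auto
  qed
  then show ?thesis
    by (intro L2_closureI L2_cmult L2_closure_L2[OF f])
qed

lemma L2_closure_limit:
  assumes V: "V \<subseteq> L2 M" and f: "\<And>n. f n \<in> L2_closure M V" and u: "u \<in> L2 M"
    and lim: "(\<lambda>n. L2_norm M (\<lambda>x. f n x - u x)) \<longlonglongrightarrow> 0"
  shows "u \<in> L2_closure M V"
proof -
  have "\<exists>q\<in>V. L2_norm M (\<lambda>x. u x - q x) < e" if "0 < e" for e
  proof -
    obtain n where n: "L2_norm M (\<lambda>x. f n x - u x) < e / 2"
      using order_tendstoD(2)[OF lim half_gt_zero[OF \<open>0 < e\<close>]] by (auto dest: eventually_happens)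
    obtain q where q: "q \<in> V" "L2_norm M (\<lambda>x. f n x - q x) < e / 2"
      using L2_closureD[OF f[of n] half_gt_zero[OF \<open>0 < e\<close>]] by blast
    have "L2_norm M (\<lambda>x. (u x - f n x) + (f n x - q x)) \<le> L2_norm M (\<lambda>x. u x - f n x) + L2_norm M (\<lambda>x. f n x - q x)"
      using q(1) V by (intro L2_norm_triangle L2_diff u L2_closure_L2[OF f]) auto
    then have "L2_norm M (\<lambda>x. u x - q x) < e"
      using n q by (simp add: L2_norm_minus_commute[of M u])
    then show ?thesis using q by auto
  qed
  then show ?thesis by (intro L2_closureI u)
qed

text \<open>
  A square integrable majorant turns pointwise convergence into convergence in \<open>L\<^sup>2\<close>.
\<close>

lemma L2_closure_dominated_limit:
  assumes V: "V \<subseteq> L2 M" and f: "\<And>n. f n \<in> L2_closure M V"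
    and u: "u \<in> borel_measurable M" and g: "g \<in> L2 M"
    and lim: "AE x in M. (\<lambda>n. f n x) \<longlonglongrightarrow> u x"
    and bound: "\<And>n x. x \<in> space M \<Longrightarrow> \<bar>f n x\<bar> \<le> g x"
  shows "u \<in> L2_closure M V"
proof -
  have [measurable]: "\<And>n. f n \<in> borel_measurable M" "u \<in> borel_measurable M" "g \<in> borel_measurable M"
    by (fact L2_measurable[OF L2_closure_L2[OF f]] u L2_measurable[OF g])+
  have u_bound: "AE x in M. \<bar>u x\<bar> \<le> g x"
    using lim AE_space
  proof eventually_elim
    case (elim x)
    have "(\<lambda>n. \<bar>f n x\<bar>) \<longlonglongrightarrow> \<bar>u x\<bar>" using elim by (intro tendsto_rabs)
    then show ?case using bound[OF elim(2)] by (intro LIMSEQ_le_const2[where X = "\<lambda>n. \<bar>f n x\<bar>"]) blast+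
  qed
  have sq: "(a - b)\<^sup>2 \<le> 4 * c\<^sup>2" if "\<bar>a\<bar> \<le> c" "\<bar>b\<bar> \<le> c" for a b c :: real
  proof -
    have "\<bar>a - b\<bar>\<^sup>2 \<le> (2 * c)\<^sup>2" using that by (intro power_mono) auto
    then show ?thesis by (simp add: power_mult_distrib)
  qed
  have "u \<in> L2 M"
    unfolding L2_def
  proof (safe, rule u, rule Bochner_Integration.integrable_bound[OF L2_integrable_square[OF g]])
    show "AE x in M. norm ((u x)\<^sup>2) \<le> norm ((g x)\<^sup>2)"
      using u_bound proof eventually_elim
      case (elim x)
      then have "\<bar>u x\<bar>\<^sup>2 \<le> (g x)\<^sup>2"
        by (intro power_mono) simp_all
      then show ?case by simp
    qed
  qed simp
  have "(\<lambda>n. \<integral>x. (f n x - u x)\<^sup>2 \<partial>M) \<longlonglongrightarrow> (\<integral>x. 0 \<partial>M)"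
  proof (rule integral_dominated_convergence)
    show "integrable M (\<lambda>x. 4 * (g x)\<^sup>2)"
      using L2_integrable_square[OF g] by simp
    show "AE x in M. (\<lambda>n. (f n x - u x)\<^sup>2) \<longlonglongrightarrow> 0"
      using lim
    proof eventually_elim
      case (elim x)
      have "(\<lambda>n. (f n x - u x)\<^sup>2) \<longlonglongrightarrow> (u x - u x)\<^sup>2" using elim by (intro tendsto_intros)
      then show ?case by simp
    qed
    show "AE x in M. norm ((f n x - u x)\<^sup>2) \<le> 4 * (g x)\<^sup>2" for n
      using u_bound AE_space
    proof eventually_elim
      case (elim x)
      then show ?case using sq[OF bound[OF elim(2), of n] elim(1)] by simp
    qed
  qed simp_all
  then have "(\<lambda>n. sqrt (\<integral>x. (f n x - u x)\<^sup>2 \<partial>M)) \<longlonglongrightarrow> sqrt 0"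
    by (intro tendsto_real_sqrt) simp
  then have "(\<lambda>n. L2_norm M (\<lambda>x. f n x - u x)) \<longlonglongrightarrow> 0"
    by (simp add: L2_norm_def)
  then show ?thesis
    by (rule L2_closure_limit[OF V f \<open>u \<in> L2 M\<close>])
qed

lemma L2_closure_sum:
  assumes V: "V \<subseteq> L2 M" "(\<lambda>_. 0) \<in> V" "\<And>p q. p \<in> V \<Longrightarrow> q \<in> V \<Longrightarrow> (\<lambda>x. p x + q x) \<in> V"
    and f: "\<And>i. i \<in> I \<Longrightarrow> f i \<in> L2_closure M V"
  shows "(\<lambda>x. \<Sum>i\<in>I. f i x) \<in> L2_closure M V"
proof -
  have zero: "(\<lambda>_. 0) \<in> L2_closure M V"
    using V(2) by (intro L2_closureI L2_zero) (auto simp: L2_norm_def intro!: bexI[of _ "\<lambda>_. 0"])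
  show ?thesis
    using f
  proof (induction I rule: infinite_finite_induct)
    case (insert i I)
    then have "(\<lambda>x. f i x + (\<Sum>i\<in>I. f i x)) \<in> L2_closure M V"
      by (intro L2_closure_add[OF V(1) V(3)]) auto
    then show ?case using insert by simp
  qed (simp_all add: zero)
qed

lemma L2_closure_cong:
  assumes f: "f \<in> L2_closure M V" and eq: "\<And>x. x \<in> space M \<Longrightarrow> f x = g x"
  shows "g \<in> L2_closure M V"
proof (rule L2_closureI)
  have "f \<in> borel_measurable M \<longleftrightarrow> g \<in> borel_measurable M"
    using eq by (intro measurable_cong) auto
  moreover have "integrable M (\<lambda>x. (f x)\<^sup>2) \<longleftrightarrow> integrable M (\<lambda>x. (g x)\<^sup>2)"
    using eq by (intro Bochner_Integration.integrable_cong) auto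
  ultimately show "g \<in> L2 M"
    using L2_closure_L2[OF f] by (simp add: L2_def)
next
  fix e :: real assume "0 < e"
  then obtain q where q: "q \<in> V" "L2_norm M (\<lambda>x. f x - q x) < e"
    using L2_closureD[OF f] by blast
  have "L2_norm M (\<lambda>x. g x - q x) = L2_norm M (\<lambda>x. f x - q x)"
    using eq unfolding L2_norm_def by (intro arg_cong[where f=sqrt] Bochner_Integration.integral_cong) auto
  then show "\<exists>q\<in>V. L2_norm M (\<lambda>x. g x - q x) < e"
    using q by (intro bexI[of _ q]) simp_all
qed

text \<open>
  The closure contains the bounded continuous functions because the measure is finite. It
  contains the indicator of a closed set \<open>F\<close> as the limit of \<open>(1 / (1 + dist(x, F)))\<^sup>n\<close>, then those of
  all Borel sets by a monotone class argument, and finally every square integrable function as a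
  dominated limit of simple functions.
\<close>

lemma uniformly_dense_imp_L2_dense:
  fixes S :: "'a::euclidean_space set"
  assumes M: "finite_measure M" "space M = S" "sets M = sets (restrict_space borel S)"
    and V: "V \<subseteq> L2 M" "\<And>p q. p \<in> V \<Longrightarrow> q \<in> V \<Longrightarrow> (\<lambda>x. p x + q x) \<in> V"
      "\<And>p c. p \<in> V \<Longrightarrow> (\<lambda>x. c * p x) \<in> V" "(\<lambda>_. 0) \<in> V"
    and dense: "\<And>f e. continuous_on S f \<Longrightarrow> 0 < e \<Longrightarrow> \<exists>q\<in>V. \<forall>x\<in>S. \<bar>f x - q x\<bar> \<le> e"
  shows "L2_closure M V = L2 M"
proof -
  interpret finite_measure M by (rule M(1))
  note cl_sum = L2_closure_sum[OF V(1,4,2)]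
  note cl_lim = L2_closure_dominated_limit[OF V(1)]
  have borel: "f \<in> borel_measurable M" if "f \<in> borel_measurable borel" for f :: "'a \<Rightarrow> real"
    using that measurable_restrict_space1[of f borel borel S] M(3) measurable_cong_sets[OF M(3) refl] by blast
  have one: "(\<lambda>_. 1) \<in> L2 M"
    using integrable_const[of "1::real"] by (simp add: L2_def)
  have cont: "f \<in> L2_closure M V" if f: "continuous_on UNIV f" and bound: "\<And>x. \<bar>f x\<bar> \<le> 1" for f
  proof (rule L2_closureI)
    have [measurable]: "f \<in> borel_measurable M"
      using f by (intro borel borel_measurable_continuous_onI)
    show fL2: "f \<in> L2 M"
      using bound by (intro L2_bounded[OF M(1), of _ 1]) auto
    fix e :: real assume "0 < e"
    define m where "m = measure M (space M)"
    define e' where "e' = e / (sqrt m + 1)"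
    have "0 < e'"
      using \<open>0 < e\<close> by (simp add: e'_def m_def add_nonneg_pos)
    then obtain q where q: "q \<in> V" "\<And>x. x \<in> S \<Longrightarrow> \<bar>f x - q x\<bar> \<le> e'"
      using dense[OF continuous_on_subset[OF f]] by blast
    have fq: "(\<lambda>x. f x - q x) \<in> L2 M"
      using fL2 q(1) V(1) by (intro L2_diff) auto
    have "(\<integral>x. (f x - q x)\<^sup>2 \<partial>M) \<le> (\<integral>x. e'\<^sup>2 \<partial>M)"
    proof (rule integral_mono)
      show "integrable M (\<lambda>x. (f x - q x)\<^sup>2)"
        by (rule L2_integrable_square[OF fq])
      fix x assume "x \<in> space M"
      then have "\<bar>f x - q x\<bar>\<^sup>2 \<le> e'\<^sup>2"
        using q(2) M(2) by (intro power_mono) auto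
      then show "(f x - q x)\<^sup>2 \<le> e'\<^sup>2" by simp
    qed simp
    also have "(\<integral>x. e'\<^sup>2 \<partial>M) = m * e'\<^sup>2"
      by (simp add: m_def)
    finally have "L2_norm M (\<lambda>x. f x - q x) \<le> sqrt (m * e'\<^sup>2)"
      unfolding L2_norm_def by (rule real_sqrt_le_mono)
    also have "\<dots> = sqrt m * e'"
      using \<open>0 < e'\<close> by (simp add: real_sqrt_mult)
    also have "\<dots> < (sqrt m + 1) * e'"
      using \<open>0 < e'\<close> by simp
    also have "\<dots> = e"
      unfolding e'_def using add_nonneg_pos[of "sqrt m" 1] by (simp add: m_def)
    finally show "\<exists>q\<in>V. L2_norm M (\<lambda>x. f x - q x) < e"
      using q(1) by blast
  qed
  have closed: "indicator F \<in> L2_closure M V" if "closed F" for F :: "'a set"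
  proof (cases "F = {}")
    case True
    have "(\<lambda>_. 0) \<in> L2_closure M V"
      by (rule cont) auto
    then show ?thesis
      by (rule L2_closure_cong) (simp add: True)
  next
    case False
    have bnd: "0 \<le> 1 / (1 + infdist x F)" "1 / (1 + infdist x F) \<le> 1" for x
      by (auto simp: infdist_nonneg divide_le_eq_1 add_pos_nonneg)
    show ?thesis
    proof (rule cl_lim[where f = "\<lambda>n x. (1 / (1 + infdist x F)) ^ n" and g = "\<lambda>_. 1"])
      show "(\<lambda>x. (1 / (1 + infdist x F)) ^ n) \<in> L2_closure M V" for n
      proof (rule cont)
        have "1 + infdist x F \<noteq> 0" for x
          using infdist_nonneg[of x F] by linarith
        then show "continuous_on UNIV (\<lambda>x. (1 / (1 + infdist x F)) ^ n)"
          by (intro continuous_intros) auto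
        show "\<bar>(1 / (1 + infdist x F)) ^ n\<bar> \<le> 1" for x
          using bnd[of x] by (simp add: power_le_one del: zero_le_divide_iff divide_le_eq_1)
      qed
      show "indicat_real F \<in> borel_measurable M"
        using \<open>closed F\<close> by (simp add: borel)
      show "AE x in M. (\<lambda>n. (1 / (1 + infdist x F)) ^ n) \<longlonglongrightarrow> indicat_real F x"
      proof (rule AE_I2)
        fix x
        show "(\<lambda>n. (1 / (1 + infdist x F)) ^ n) \<longlonglongrightarrow> indicat_real F x"
        proof (cases "x \<in> F")
          case True
          then show ?thesis by simp
        next
          case F: False
          then have "0 < infdist x F"
            using infdist_pos_not_in_closed[OF \<open>closed F\<close> False] by blast
          then have "(\<lambda>n. (1 / (1 + infdist x F)) ^ n) \<longlonglongrightarrow> 0"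
            using bnd[of x] by (intro LIMSEQ_realpow_zero) auto
          then show ?thesis using F by simp
        qed
      qed
      show "\<bar>(1 / (1 + infdist x F)) ^ n\<bar> \<le> 1" for n x
        using bnd[of x] by (simp add: power_le_one del: zero_le_divide_iff divide_le_eq_1)
    qed (rule one)
  qed
  have ind: "indicator B \<in> L2_closure M V" if "B \<in> sets borel" for B :: "'a set"
  proof -
    have "Int_stable (Collect closed :: 'a set set)"
      by (auto simp: Int_stable_def)
    moreover have "Collect closed \<subseteq> Pow (UNIV :: 'a set)"
      by simp
    moreover have "B \<in> sigma_sets UNIV (Collect closed)"
      using that by (simp add: borel_eq_closed)
    ultimately show ?thesis
    proof (induction B rule: sigma_sets_induct_disjoint)
      case (basic A)
      then show ?case by (intro closed) simp
    next
      case empty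
      show ?case by (intro closed) simp
    next
      case (compl A)
      have "(\<lambda>x. indicator UNIV x + (-1) * indicator A x) \<in> L2_closure M V"
        by (intro L2_closure_add[OF V(1,2)] L2_closure_cmult[OF V(1,3)] closed compl) auto
      then show ?case
        by (rule L2_closure_cong) (auto simp: indicator_def)
    next
      case (union A)
      have A: "\<And>i. A i \<in> sets borel"
        using union by (auto simp: borel_eq_closed)
      show ?case
      proof (rule cl_lim[where f = "\<lambda>n x. \<Sum>i<n. indicator (A i) x" and g = "\<lambda>_. 1"])
        show "(\<lambda>x. \<Sum>i<n. indicator (A i) x) \<in> L2_closure M V" for n
          using union by (intro cl_sum) auto
        show "indicat_real (\<Union>i. A i) \<in> borel_measurable M"
          using A by (simp add: borel sets.countable_UN)
        have "(\<lambda>i. indicator (A i) x :: real) sums indicator (\<Union>i. A i) x" for x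
          using union(1) by (intro indicator_sums) (auto simp: disjoint_family_on_def)
        then show "AE x in M. (\<lambda>n. \<Sum>i<n. indicator (A i) x) \<longlonglongrightarrow> (indicator (\<Union>i. A i) x :: real)"
          by (simp add: sums_def)
        show "\<bar>\<Sum>i<n. indicator (A i) x :: real\<bar> \<le> 1" for n x
        proof -
          have "(\<Sum>i<n. indicator (A i) x :: real) = indicator (\<Union>i<n. A i) x"
            using union(1) by (subst indicator_UN_disjoint) (auto simp: disjoint_family_on_def)
          then show ?thesis by (simp add: indicator_def)
        qed
      qed (rule one)
    qed
  qed
  have "f \<in> L2_closure M V" if f: "f \<in> L2 M" for f
  proof -
    obtain F where F: "\<And>i. simple_function M (F i)" "\<And>x. x \<in> space M \<Longrightarrow> (\<lambda>i. F i x) \<longlonglongrightarrow> f x"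
      "\<And>i x. x \<in> space M \<Longrightarrow> \<bar>F i x\<bar> \<le> 2 * \<bar>f x\<bar>"
      using borel_measurable_implies_sequence_metric[OF L2_measurable[OF f], of 0] unfolding dist_0_norm dist_norm diff_zero real_norm_def
      by blast
    have simple: "F i \<in> L2_closure M V" for i
    proof -
      define X where "X = F i ` space M"
      have "finite X"
        using F(1)[of i] by (simp add: X_def simple_function_def)
      have "\<exists>B. B \<in> sets borel \<and> F i -` {y} \<inter> space M = S \<inter> B" if "y \<in> X" for y
      proof -
        have "F i -` {y} \<inter> space M \<in> sets M"
          using F(1)[of i] that by (auto simp: simple_function_def X_def)
        then show ?thesis
          unfolding M(3) sets_restrict_space by auto
      qed
      then obtain B where B: "\<And>y. y \<in> X \<Longrightarrow> B y \<in> sets borel" "\<And>y. y \<in> X \<Longrightarrow> F i -` {y} \<inter> space M = S \<inter> B y"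
        by metis
      have "(\<lambda>x. \<Sum>y\<in>X. y * indicator (B y) x) \<in> L2_closure M V"
        by (intro cl_sum L2_closure_cmult[OF V(1,3)] ind B(1))
      then show ?thesis
      proof (rule L2_closure_cong)
        fix x assume x: "x \<in> space M"
        have "(\<Sum>y\<in>X. y * indicator (B y) x) = (\<Sum>y\<in>X. if y = F i x then y else 0)"
        proof (rule sum.cong[OF refl])
          fix y assume "y \<in> X"
          have "x \<in> B y \<longleftrightarrow> F i x = y"
            using B(2)[OF \<open>y \<in> X\<close>] x M(2) by auto
          then show "y * indicator (B y) x = (if y = F i x then y else 0)"
            by (auto simp: indicator_def)
        qed
        also have "\<dots> = F i x"
          using \<open>finite X\<close> x by (simp add: X_def)
        finally show "(\<Sum>y\<in>X. y * indicator (B y) x) = F i x" .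
      qed
    qed
    have g: "(\<lambda>x. 2 * \<bar>f x\<bar>) \<in> L2 M"
      using f by (auto simp: L2_def power_mult_distrib)
    show ?thesis
      by (rule cl_lim[OF simple L2_measurable[OF f] g _ F(3)]) (auto intro: F(2))
  qed
  then show ?thesis
    using L2_closure_L2 by blast
qed

section \<open>Hausdorff measure on the sphere\<close>

lemma diameter_isometry:
  assumes "\<And>x y. dist (T x) (T y) = dist x y"
  shows "diameter (T ` U) = diameter U"
proof -
  have "(\<lambda>(x, y). dist x y) ` (T ` U \<times> T ` U) = (\<lambda>(x, y). dist x y) ` (U \<times> U)"
    using assms by (force simp: image_iff)
  then show ?thesis
    by (simp add: diameter_def)
qed

lemma bounded_isometry:
  assumes "\<And>x y. dist (T x) (T y) = dist x y" and "bounded U"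
  shows "bounded (T ` U)"
proof -
  obtain a e where "\<And>y. y \<in> U \<Longrightarrow> dist a y \<le> e"
    using assms(2) unfolding bounded_def by blast
  then show ?thesis
    unfolding bounded_def using assms(1) by (intro exI[of _ "T a"] exI[of _ e]) auto
qed

lemma hausdorff_outer_isometry_le:
  assumes "\<And>x y. dist (T x) (T y) = dist x y"
  shows "hausdorff_outer s (T ` A) \<le> hausdorff_outer s A"
  unfolding hausdorff_outer_def
proof (rule SUP_mono')
  fix \<epsilon> :: real
  show "hausdorff_content s \<epsilon> (T ` A) \<le> hausdorff_content s \<epsilon> A"
    unfolding hausdorff_content_def
  proof (rule Inf_mono)
    fix b assume "b \<in> {\<Sum>i. hausdorff_gauge s (U i) |U. A \<subseteq> (\<Union>i. U i) \<and> (\<forall>i. bounded (U i) \<and> diameter (U i) \<le> \<epsilon>)}"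
    then obtain U where U: "b = (\<Sum>i. hausdorff_gauge s (U i))" "A \<subseteq> (\<Union>i. U i)"
      "\<And>i. bounded (U i)" "\<And>i. diameter (U i) \<le> \<epsilon>"
      by blast
    have "hausdorff_gauge s (T ` U i) = hausdorff_gauge s (U i)" for i
      unfolding hausdorff_gauge_def diameter_isometry[OF assms] by simp
    then have "b = (\<Sum>i. hausdorff_gauge s (T ` U i))"
      by (simp add: U(1))
    moreover have "T ` A \<subseteq> (\<Union>i. T ` U i)"
      using U(2) by blast
    moreover have "bounded (T ` U i)" "diameter (T ` U i) \<le> \<epsilon>" for i
      using U(3,4) by (simp_all add: bounded_isometry[OF assms] diameter_isometry[OF assms])
    ultimately show "\<exists>a\<in>{\<Sum>i. hausdorff_gauge s (U i) |U. T ` A \<subseteq> (\<Union>i. U i) \<and> (\<forall>i. bounded (U i) \<and> diameter (U i) \<le> \<epsilon>)}. a \<le> b"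
      by (intro bexI[of _ b]) (auto intro!: exI[of _ "\<lambda>i. T ` U i"])
  qed
qed

lemma space_hausdorff_measure [simp]: "space (hausdorff_measure s) = UNIV"
  by (simp add: hausdorff_measure_def)

lemma sets_hausdorff_measure [simp, measurable_cong]: "sets (hausdorff_measure s) = sets borel"
  using sets.sigma_sets_eq[of borel] by (simp add: hausdorff_measure_def sets_measure_of_conv)

text \<open>
  The measure generated by a set function is this set function if the latter is countably
  additive, and the zero measure otherwise. Finiteness and invariance are clear for the zero measure,
  so that both reduce to properties of the outer measure.
\<close>

lemma emeasure_hausdorff_measure:
  "(\<forall>A\<in>sets (borel :: 'a measure). emeasure (hausdorff_measure s) A = hausdorff_outer s A) \<or>
   (\<forall>A :: 'a::metric_space set. emeasure (hausdorff_measure s) A = 0)"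
proof (cases "measure_space UNIV (sets borel) (hausdorff_outer s :: 'a set \<Rightarrow> ennreal)")
  case True
  then show ?thesis
    using sets.sigma_sets_eq[of "borel :: 'a measure"]
    by (intro disjI1) (simp add: hausdorff_measure_def emeasure_measure_of_conv)
next
  case False
  then show ?thesis
    using sets.sigma_sets_eq[of "borel :: 'a measure"]
    by (intro disjI2) (simp add: hausdorff_measure_def emeasure_measure_of_conv)
qed

lemma emeasure_hausdorff_measure_isometry:
  fixes T :: "'a::metric_space \<Rightarrow> 'a"
  assumes iso: "\<And>x y. dist (T x) (T y) = dist x y" and "bij T" and A: "A \<in> sets borel"
  shows "emeasure (hausdorff_measure s) (T -` A) = emeasure (hausdorff_measure s) A"
proof -
  have "continuous_on UNIV T"
    unfolding continuous_on_iff using iso by metis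
  then have "T -` A \<in> sets borel"
    using measurable_sets[OF borel_measurable_continuous_onI A] by simp
  moreover have "hausdorff_outer s (T -` A) = hausdorff_outer s A"
  proof (rule antisym)
    have inv: "dist (inv T x) (inv T y) = dist x y" for x y
      using iso[of "inv T x" "inv T y"] \<open>bij T\<close> by (simp add: bij_is_surj surj_f_inv_f)
    have "T -` A = inv T ` A"
      using \<open>bij T\<close> by (simp add: bij_vimage_eq_inv_image)
    then show "hausdorff_outer s (T -` A) \<le> hausdorff_outer s A"
      using hausdorff_outer_isometry_le[of "inv T", OF inv] by simp
    have "T ` (T -` A) = A"
      using \<open>bij T\<close> by (simp add: bij_is_surj surj_image_vimage_eq)
    then show "hausdorff_outer s A \<le> hausdorff_outer s (T -` A)"
      using hausdorff_outer_isometry_le[of T, OF iso, of s "T -` A"] by simp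
  qed
  ultimately show ?thesis
    using emeasure_hausdorff_measure[of s, where 'a = 'a] A by metis
qed

lemma hausdorff_content_finite_cover:
  assumes "finite I" "A \<subseteq> (\<Union>c\<in>I. U c)" "0 \<le> \<epsilon>"
    and U: "\<And>c. c \<in> I \<Longrightarrow> bounded (U c)" "\<And>c. c \<in> I \<Longrightarrow> diameter (U c) \<le> \<epsilon>"
      "\<And>c. c \<in> I \<Longrightarrow> hausdorff_gauge s (U c) \<le> b"
  shows "hausdorff_content s \<epsilon> A \<le> of_nat (card I) * b"
proof -
  obtain h where h: "bij_betw h {0..<card I} I"
    using ex_bij_betw_nat_finite[OF \<open>finite I\<close>] by blast
  have hI: "h n \<in> I" if "n < card I" for n
    using h that by (auto simp: bij_betw_def)
  define V where "V n = (if n < card I then U (h n) else {})" for n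
  have "A \<subseteq> (\<Union>n. V n)"
  proof
    fix x assume "x \<in> A"
    then obtain c where c: "c \<in> I" "x \<in> U c"
      using assms(2) by blast
    then obtain n where "n < card I" "c = h n"
      using h unfolding bij_betw_def by (metis atLeastLessThan_iff imageE)
    then show "x \<in> (\<Union>n. V n)"
      using c by (auto simp: V_def)
  qed
  moreover have "bounded (V n)" "diameter (V n) \<le> \<epsilon>" for n
    using U(1,2) hI assms(3) by (auto simp: V_def)
  ultimately have "hausdorff_content s \<epsilon> A \<le> (\<Sum>n. hausdorff_gauge s (V n))"
    unfolding hausdorff_content_def by (intro Inf_lower) blast
  also have "\<dots> = (\<Sum>n<card I. hausdorff_gauge s (V n))"
    by (rule suminf_finite) (auto simp: V_def hausdorff_gauge_def)
  also have "\<dots> \<le> (\<Sum>n<card I. b)"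
    using U(3) hI by (intro sum_mono) (simp add: V_def)
  finally show ?thesis
    by simp
qed

text \<open>
  Otherwise the sum of the absolute values of the coordinates, which bounds the norm, is below 1.
\<close>

lemma sphere_coordinate_large:
  fixes x :: "real ^ 'n"
  assumes "norm x = 1"
  shows "\<exists>i. 1 / real CARD('n) \<le> \<bar>x $ i\<bar>"
proof (rule ccontr)
  assume "\<not> ?thesis"
  then have "\<bar>x $ i\<bar> < 1 / real CARD('n)" for i
    by (simp add: not_le)
  then have "(\<Sum>i\<in>UNIV. \<bar>x $ i\<bar>) < (\<Sum>i\<in>(UNIV :: 'n set). 1 / real CARD('n))"
    by (intro sum_strict_mono) auto
  also have "\<dots> = 1"
    by simp
  finally show False
    using norm_le_l1_cart[of x] assms by simp
qed

text \<open>
  A cell prescribes all coordinates but the \<open>i\<close>-th one up to \<open>1 / N\<close>. The \<open>i\<close>-th coordinate is then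
  determined up to a multiple of \<open>1 / N\<close> by the equation of the sphere, since it has a fixed sign \<open>s\<close>
  and stays away from 0: \<open>x\<^sub>i\<^sup>2 - y\<^sub>i\<^sup>2\<close> is small and \<open>\<bar>x\<^sub>i + y\<^sub>i\<bar>\<close> is bounded below.
\<close>

lemma diameter_sphere_cell:
  fixes i :: "'n::finite" and U :: "(real ^ 'n) set"
  assumes s: "\<bar>s\<bar> = 1" and "0 < N"
    and U: "\<And>x. x \<in> U \<Longrightarrow> norm x = 1" "\<And>x. x \<in> U \<Longrightarrow> 1 / real CARD('n) \<le> s * x $ i"
    "\<And>x y j. x \<in> U \<Longrightarrow> y \<in> U \<Longrightarrow> j \<noteq> i \<Longrightarrow> \<bar>x $ j - y $ j\<bar> \<le> 1 / N"
  shows "diameter U \<le> real CARD('n) ^ 3 / N"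
proof (rule diameter_le)
  define d where "d = real CARD('n)"
  have d: "1 \<le> d"
    using zero_less_card_finite[where 'a='n] unfolding d_def by linarith
  show "U \<noteq> {} \<or> 0 \<le> real CARD('n) ^ 3 / N"
    using \<open>0 < N\<close> by simp
  fix x y assume x: "x \<in> U" and y: "y \<in> U"
  have bnd: "\<bar>x $ j\<bar> \<le> 1" "\<bar>y $ j\<bar> \<le> 1" for j
    using component_le_norm_cart[of x j] component_le_norm_cart[of y j] U(1) x y by auto
  have sq: "(\<Sum>j\<in>UNIV. (x $ j)\<^sup>2) = 1" "(\<Sum>j\<in>UNIV. (y $ j)\<^sup>2) = 1"
    using U(1)[OF x] U(1)[OF y] by (simp_all add: norm_vec_def L2_set_def)
  have eq: "(x $ i - y $ i) * (x $ i + y $ i) = (\<Sum>j\<in>UNIV - {i}. (y $ j - x $ j) * (y $ j + x $ j))"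
  proof -
    have "(x $ i)\<^sup>2 + (\<Sum>j\<in>UNIV - {i}. (x $ j)\<^sup>2) = (y $ i)\<^sup>2 + (\<Sum>j\<in>UNIV - {i}. (y $ j)\<^sup>2)"
      using sq by (simp add: sum.remove[where x = i])
    then show ?thesis
      by (simp add: power2_eq_square algebra_simps sum_subtractf)
  qed
  have sum_le: "\<bar>\<Sum>j\<in>UNIV - {i}. (y $ j - x $ j) * (y $ j + x $ j)\<bar> \<le> (\<Sum>j\<in>UNIV - {i}. 1 / N * 2)"
  proof (rule order_trans[OF sum_abs], rule sum_mono)
    fix j assume "j \<in> UNIV - {i}"
    then show "\<bar>(y $ j - x $ j) * (y $ j + x $ j)\<bar> \<le> 1 / N * 2"
      unfolding abs_mult using U(3)[OF y x, of j] bnd[of j] \<open>0 < N\<close> by (intro mult_mono) auto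
  qed
  have sum_eq: "(\<Sum>j\<in>UNIV - {i}. 1 / N * 2) = (d - 1) * 2 / N"
    by (simp add: d_def card_Diff_singleton of_nat_diff)
  have "2 / d \<le> \<bar>x $ i + y $ i\<bar>"
  proof -
    have "2 / d \<le> s * (x $ i + y $ i)"
      using U(2)[OF x] U(2)[OF y] by (simp add: d_def algebra_simps)
    also have "\<dots> \<le> \<bar>x $ i + y $ i\<bar>"
      using s by (metis abs_ge_self abs_mult mult_1)
    finally show ?thesis .
  qed
  then have "\<bar>x $ i - y $ i\<bar> * (2 / d) \<le> \<bar>x $ i - y $ i\<bar> * \<bar>x $ i + y $ i\<bar>"
    by (intro mult_left_mono) auto
  also have "\<dots> \<le> (d - 1) * 2 / N"
    using sum_le unfolding abs_mult[symmetric] eq sum_eq .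
  finally have "\<bar>x $ i - y $ i\<bar> * (2 / d) \<le> (d - 1) * 2 / N" .
  then have "\<bar>x $ i - y $ i\<bar> \<le> d * (d - 1) / N"
    using d \<open>0 < N\<close> by (simp add: field_simps)
  also have "\<dots> \<le> d\<^sup>2 / N"
    using d \<open>0 < N\<close> by (intro divide_right_mono) (auto simp: power2_eq_square)
  finally have i: "\<bar>x $ i - y $ i\<bar> \<le> d\<^sup>2 / N" .
  have "\<bar>(x - y) $ j\<bar> \<le> d\<^sup>2 / N" for j
  proof (cases "j = i")
    case False
    have "1 / N \<le> d\<^sup>2 / N"
      using d \<open>0 < N\<close> by (intro divide_right_mono) auto
    then show ?thesis
      using U(3)[OF x y False] by simp
  qed (use i in simp)
  then have "(\<Sum>j\<in>UNIV. \<bar>(x - y) $ j\<bar>) \<le> (\<Sum>j\<in>(UNIV :: 'n set). d\<^sup>2 / N)"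
    by (intro sum_mono)
  also have "\<dots> = d ^ 3 / N"
    by (simp add: d_def power2_eq_square power3_eq_cube)
  finally show "norm (x - y) \<le> real CARD('n) ^ 3 / N"
    using norm_le_l1_cart[of "x - y"] by (simp add: d_def)
qed

text \<open>
  The number of grid cells of mesh \<open>1 / N\<close> is of order \<open>N\<^sup>d\<^sup>-\<^sup>1\<close>, because one coordinate is left free,
  and each cell has a gauge of order \<open>N\<^sup>-\<^sup>(\<^sup>d\<^sup>-\<^sup>1\<^sup>)\<close>; the products stay bounded as \<open>N\<close> grows.
\<close>

lemma hausdorff_outer_sphere_finite:
  "hausdorff_outer (CARD('n::finite) - 1) (sphere 0 1 :: (real ^ 'n) set) < \<infinity>"
proof -
  define d where "d = CARD('n)"
  define w where "w = unit_ball_vol (real (d - 1))"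
  \<comment> \<open>the bound \<open>2d (3N)\<^sup>d\<^sup>-\<^sup>1\<close> on the number of cells times the gauge of a set of diameter \<open>d\<^sup>3 / N\<close>\<close>
  define B where "B = 2 * real d * (3 ^ (d - 1) * (w * (real d ^ 3 / 2) ^ (d - 1)))"
  have w: "0 \<le> w"
    by (simp add: w_def)
  have "hausdorff_content (d - 1) \<epsilon> (sphere 0 1 :: (real ^ 'n) set) \<le> ennreal B" if "0 < \<epsilon>" for \<epsilon>
  proof -
    obtain N :: nat where "real d ^ 3 / \<epsilon> < real N"
      using reals_Archimedean2 by blast
    moreover have "0 \<le> real d ^ 3 / \<epsilon>"
      using that by simp
    ultimately have "real d ^ 3 / \<epsilon> < real N" "0 < real N"
      by linarith+
    then have N: "real d ^ 3 / real N \<le> \<epsilon>" "0 < N"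
      using that by (simp_all add: field_simps)
    \<comment> \<open>the cell with a large \<open>i\<close>-th coordinate of sign \<open>s\<close> and the grid position \<open>c\<close> in the others\<close>
    define U where "U = (\<lambda>(i, s, c). {x :: real ^ 'n. norm x = 1 \<and> 1 / real CARD('n) \<le> s * x $ i \<and>
        (\<forall>j. j \<noteq> i \<longrightarrow> \<lfloor>real N * x $ j\<rfloor> = c j)})"
    define I where "I = (SIGMA i:(UNIV :: 'n set). {-1, 1 :: real} \<times> (UNIV - {i} \<rightarrow>\<^sub>E {- int N..int N}))"
    have "finite I"
      unfolding I_def by (intro finite_SigmaI finite_cartesian_product finite_PiE) auto
    have "card I = (\<Sum>i\<in>(UNIV :: 'n set). card ({-1, 1 :: real} \<times> (UNIV - {i} \<rightarrow>\<^sub>E {- int N..int N})))"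
      unfolding I_def by (subst card_SigmaI) (auto intro!: finite_cartesian_product finite_PiE)
    also have "\<dots> = (\<Sum>i\<in>(UNIV :: 'n set). 2 * (2 * N + 1) ^ (d - 1))"
    proof (rule sum.cong[OF refl])
      fix i :: 'n
      have "nat (2 * int N + 1) = 2 * N + 1"
        by linarith
      then show "card ({-1, 1 :: real} \<times> (UNIV - {i} \<rightarrow>\<^sub>E {- int N..int N})) = 2 * (2 * N + 1) ^ (d - 1)"
        by (simp add: card_cartesian_product card_PiE d_def card_Diff_singleton)
    qed
    finally have card: "card I = d * (2 * (2 * N + 1) ^ (d - 1))"
      by (simp add: d_def)
    have cover: "sphere 0 1 \<subseteq> (\<Union>c\<in>I. U c)"
    proof
      fix x :: "real ^ 'n" assume "x \<in> sphere 0 1"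
      then have x: "norm x = 1" by simp
      obtain i where i: "1 / real CARD('n) \<le> \<bar>x $ i\<bar>"
        using sphere_coordinate_large[OF x] by blast
      define c where "c = restrict (\<lambda>j. \<lfloor>real N * x $ j\<rfloor>) (UNIV - {i})"
      define s :: real where "s = (if 0 \<le> x $ i then 1 else -1)"
      have "\<lfloor>real N * x $ j\<rfloor> \<in> {- int N..int N}" for j
      proof -
        have "\<bar>x $ j\<bar> \<le> 1"
          using component_le_norm_cart[of x j] x by simp
        then have "\<bar>real N * x $ j\<bar> \<le> real N"
          by (simp add: abs_mult mult_left_le)
        then have "- real N \<le> real N * x $ j" "real N * x $ j \<le> real N"
          by linarith+
        then show ?thesis
          by (simp add: le_floor_iff floor_le_iff)
      qed
      then have "(i, s, c) \<in> I"
        by (auto simp: I_def c_def s_def)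
      moreover have "x \<in> U (i, s, c)"
        using x i by (auto simp: U_def c_def s_def split: if_splits)
      ultimately show "x \<in> (\<Union>c\<in>I. U c)"
        by blast
    qed
    have diam: "diameter (U p) \<le> real d ^ 3 / real N" if "p \<in> I" for p
    proof -
      obtain i s c where p: "p = (i, s, c)" by (rule prod_cases3)
      show ?thesis
        unfolding d_def
      proof (rule diameter_sphere_cell[where s = s and i = i])
        show "\<bar>s\<bar> = 1"
        proof -
          have "s = -1 \<or> s = 1"
            using that by (simp add: I_def p)
          then show ?thesis by auto
        qed
        fix x y :: "real ^ 'n" and j assume xy: "x \<in> U p" "y \<in> U p" "j \<noteq> i"
        then have "\<lfloor>real N * x $ j\<rfloor> = \<lfloor>real N * y $ j\<rfloor>"
          by (simp add: U_def p)
        then have "\<bar>real N * x $ j - real N * y $ j\<bar> \<le> 1"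
          by linarith
        then have "real N * \<bar>x $ j - y $ j\<bar> \<le> 1"
          by (simp add: abs_mult flip: right_diff_distrib)
        then show "\<bar>x $ j - y $ j\<bar> \<le> 1 / real N"
          using N(2) by (simp add: field_simps)
      qed (use N(2) in \<open>auto simp: U_def p\<close>)
    qed
    have bounded: "bounded (U p)" for p
      by (rule bounded_subset[of "sphere 0 1"]) (auto simp: U_def)
    have "hausdorff_content (d - 1) \<epsilon> (sphere 0 1 :: (real ^ 'n) set)
        \<le> of_nat (card I) * ennreal (w * (real d ^ 3 / real N / 2) ^ (d - 1))"
    proof (rule hausdorff_content_finite_cover[OF \<open>finite I\<close> cover])
      fix p assume p: "p \<in> I"
      show "diameter (U p) \<le> \<epsilon>"
        using diam[OF p] N(1) by simp
      have "(diameter (U p) / 2) ^ (d - 1) \<le> (real d ^ 3 / real N / 2) ^ (d - 1)"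
        using diam[OF p] diameter_ge_0[OF bounded] by (intro power_mono divide_right_mono) auto
      then show "hausdorff_gauge (d - 1) (U p) \<le> ennreal (w * (real d ^ 3 / real N / 2) ^ (d - 1))"
        unfolding hausdorff_gauge_def w_def[symmetric] using w by (auto intro!: ennreal_leI mult_left_mono)
    qed (use that bounded in auto)
    also have "\<dots> = ennreal (real (card I) * (w * (real d ^ 3 / real N / 2) ^ (d - 1)))"
      using w by (simp add: ennreal_mult' ennreal_of_nat_eq_real_of_nat)
    also have "\<dots> \<le> ennreal B"
    proof (rule ennreal_leI)
      have "real (card I) = 2 * real d * (2 * real N + 1) ^ (d - 1)"
        by (simp add: card add.commute)
      also have "\<dots> \<le> 2 * real d * (3 * real N) ^ (d - 1)"
        using N(2) by (intro mult_left_mono power_mono) auto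
      finally have "real (card I) * (w * (real d ^ 3 / real N / 2) ^ (d - 1))
          \<le> 2 * real d * (3 * real N) ^ (d - 1) * (w * (real d ^ 3 / real N / 2) ^ (d - 1))"
        using w by (intro mult_right_mono) auto
      also have "\<dots> = B"
        using N(2) by (simp add: B_def power_mult_distrib power_divide)
      finally show "real (card I) * (w * (real d ^ 3 / real N / 2) ^ (d - 1)) \<le> B" .
    qed
    finally show ?thesis .
  qed
  then have "hausdorff_outer (d - 1) (sphere 0 1 :: (real ^ 'n) set) \<le> ennreal B"
    unfolding hausdorff_outer_def by (intro SUP_least) auto
  then show ?thesis
    unfolding d_def by (simp add: order_le_less_trans)
qed

subsection \<open>The measure on the sphere\<close>

lemma space_sphere_measure [simp]: "space (sphere_measure :: (real ^ 'n) measure) = sphere 0 1"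
  by (simp add: sphere_measure_def space_restrict_space)

lemma sets_sphere_measure: "sets (sphere_measure :: (real ^ 'n) measure) = sets (restrict_space borel (sphere 0 1))"
  by (simp add: sphere_measure_def sets_restrict_space)

lemma finite_measure_sphere_measure: "finite_measure (sphere_measure :: (real ^ 'n) measure)"
proof (rule finite_measureI)
  have "emeasure (sphere_measure :: (real ^ 'n) measure) (sphere 0 1)
      = emeasure (hausdorff_measure (CARD('n) - 1)) (sphere 0 1 :: (real ^ 'n) set)"
    unfolding sphere_measure_def by (rule emeasure_restrict_space) (simp_all add: borel_closed)
  also have "\<dots> < \<infinity>"
    using emeasure_hausdorff_measure[of "CARD('n) - 1", where 'a = "real ^ 'n"]
  proof
    assume "\<forall>A\<in>sets (borel :: (real ^ 'n) measure). emeasure (hausdorff_measure (CARD('n) - 1)) A = hausdorff_outer (CARD('n) - 1) A"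
    then have "emeasure (hausdorff_measure (CARD('n) - 1)) (sphere 0 1 :: (real ^ 'n) set)
        = hausdorff_outer (CARD('n) - 1) (sphere 0 1 :: (real ^ 'n) set)"
      by simp
    then show ?thesis
      using hausdorff_outer_sphere_finite[where 'n = 'n] by (simp only:)
  qed simp
  finally show "emeasure (sphere_measure :: (real ^ 'n) measure) (space sphere_measure) \<noteq> \<infinity>"
    by simp
qed

lemma borel_measurable_sphere_measure:
  "f \<in> borel_measurable borel \<Longrightarrow> f \<in> borel_measurable (sphere_measure :: (real ^ 'n) measure)"
  using measurable_restrict_space1[of f borel borel "sphere 0 1"]
    measurable_cong_sets[OF sets_sphere_measure refl] by blast

lemma integral_sphere_measure_orthogonal:
  fixes f :: "real ^ 'n \<Rightarrow> real" and T :: "real ^ 'n \<Rightarrow> real ^ 'n"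
  assumes T: "orthogonal_transformation T" and f: "f \<in> borel_measurable borel"
  shows "(\<integral>x. f (T x) \<partial>sphere_measure) = (\<integral>x. f x \<partial>sphere_measure)"
proof -
  let ?M = "sphere_measure :: (real ^ 'n) measure"
  have iso: "dist (T x) (T y) = dist x y" for x y
  proof -
    have diff: "T (x - y) = T x - T y"
      by (rule linear_diff[OF orthogonal_transformation_linear[OF T]])
    have "norm (T (x - y)) = norm (x - y)"
      by (rule orthogonal_transformation_norm[OF T])
    then show ?thesis
      unfolding diff dist_norm .
  qed
  have "bij T"
    by (rule orthogonal_transformation_bij[OF T])
  have "continuous_on UNIV T"
    unfolding continuous_on_iff using iso by metis
  have meas: "T \<in> measurable ?M ?M"
  proof (subst measurable_cong_sets[OF sets_sphere_measure sets_sphere_measure], rule measurable_restrict_space3)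
    show "T \<in> borel_measurable borel"
      using \<open>continuous_on UNIV T\<close> by (rule borel_measurable_continuous_onI)
    show "T \<in> sphere 0 1 \<rightarrow> sphere 0 1"
      using orthogonal_transformation_norm[OF T] by simp
  qed
  have "distr ?M ?M T = ?M"
  proof (rule measure_eqI)
    fix A assume "A \<in> sets (distr ?M ?M T)"
    then have A: "A \<in> sets ?M" by simp
    then have "A \<in> sets borel" "A \<subseteq> sphere 0 1"
      unfolding sets_sphere_measure by (auto simp: sets_restrict_space)
    have "norm x = 1" if "T x \<in> A" for x
      using that \<open>A \<subseteq> sphere 0 1\<close> orthogonal_transformation_norm[OF T, of x] by auto
    then have vim: "T -` A \<inter> space ?M = T -` A"
      by auto
    then have "emeasure (distr ?M ?M T) A = emeasure ?M (T -` A)"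
      using emeasure_distr[OF meas A] by simp
    also have "\<dots> = emeasure (hausdorff_measure (CARD('n) - 1)) (T -` A)"
      unfolding sphere_measure_def using vim by (intro emeasure_restrict_space) auto
    also have "\<dots> = emeasure (hausdorff_measure (CARD('n) - 1)) A"
      by (rule emeasure_hausdorff_measure_isometry[OF iso \<open>bij T\<close> \<open>A \<in> sets borel\<close>])
    also have "\<dots> = emeasure ?M A"
      unfolding sphere_measure_def using \<open>A \<subseteq> sphere 0 1\<close> by (intro emeasure_restrict_space[symmetric]) auto
    finally show "emeasure (distr ?M ?M T) A = emeasure ?M A" .
  qed simp
  then show ?thesis
    using integral_distr[OF meas borel_measurable_sphere_measure[OF f]] by simp
qed

section \<open>The divergence theorem on the sphere\<close>

lemma continuous_L2_sphere:
  fixes f :: "real ^ 'n \<Rightarrow> real"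
  assumes "continuous_on UNIV f"
  shows "f \<in> L2 sphere_measure"
proof -
  have "compact (f ` sphere 0 1)"
    using assms by (intro compact_continuous_image continuous_on_subset[OF assms]) auto
  then obtain B where "\<And>y. y \<in> f ` sphere 0 1 \<Longrightarrow> norm y \<le> B"
    using compact_imp_bounded bounded_iff by metis
  then show ?thesis
    by (intro L2_bounded[OF finite_measure_sphere_measure, of _ B]
        borel_measurable_sphere_measure borel_measurable_continuous_onI[OF assms]) auto
qed

lemma L2_integrable:
  fixes f :: "real ^ 'n \<Rightarrow> real"
  assumes "f \<in> L2 sphere_measure"
  shows "integrable sphere_measure f"
  using L2_integrable_mult[OF assms continuous_L2_sphere[of "\<lambda>_. 1"]] by simp

lemma C1_continuous:
  assumes "C1_with_gradient \<phi> G"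
  shows "continuous_on UNIV \<phi>" "continuous_on UNIV G" "continuous_on UNIV (\<lambda>x. G x $ i)"
    "continuous_on UNIV (\<lambda>x. tangential x (G x) $ i)"
proof -
  show "continuous_on UNIV \<phi>"
    using assms unfolding C1_with_gradient_def gderiv_def
    by (intro continuous_at_imp_continuous_on ballI) (blast intro: has_derivative_continuous)
  show G: "continuous_on UNIV G"
    using assms unfolding C1_with_gradient_def by blast
  then show "continuous_on UNIV (\<lambda>x. G x $ i)"
    by (intro continuous_intros)
  show "continuous_on UNIV (\<lambda>x. tangential x (G x) $ i)"
    unfolding tangential_def using G by (intro continuous_intros)
qed

lemma C1_const: "C1_with_gradient (\<lambda>_. c) (\<lambda>_. 0)"
  by (simp add: C1_with_gradient_def GDERIV_const)

lemma C1_coordinate: "C1_with_gradient (\<lambda>x. x $ j) (\<lambda>_. axis j 1)"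
  unfolding C1_with_gradient_def gderiv_def
  by (auto simp: inner_axis intro!: bounded_linear_imp_has_derivative bounded_linear_vec_nth)

lemma C1_add:
  "C1_with_gradient \<phi> F \<Longrightarrow> C1_with_gradient \<psi> G \<Longrightarrow> C1_with_gradient (\<lambda>x. \<phi> x + \<psi> x) (\<lambda>x. F x + G x)"
  unfolding C1_with_gradient_def by (auto intro: GDERIV_add continuous_on_add)

lemma C1_mult:
  assumes \<phi>: "C1_with_gradient \<phi> F" and \<psi>: "C1_with_gradient \<psi> G"
  shows "C1_with_gradient (\<lambda>x. \<phi> x * \<psi> x) (\<lambda>x. \<phi> x *\<^sub>R G x + \<psi> x *\<^sub>R F x)"
proof -
  have "continuous_on UNIV (\<lambda>x. \<phi> x *\<^sub>R G x + \<psi> x *\<^sub>R F x)"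
    using C1_continuous(1,2)[OF \<phi>] C1_continuous(1,2)[OF \<psi>] by (intro continuous_intros)
  then show ?thesis
    using \<phi> \<psi> unfolding C1_with_gradient_def by (auto intro: GDERIV_mult)
qed

lemma C1_compose:
  fixes \<phi> :: "real ^ 'n \<Rightarrow> real"
  assumes \<phi>: "C1_with_gradient \<phi> F" and \<eta>: "\<And>t. (\<eta> has_real_derivative \<eta>' t) (at t)" "continuous_on UNIV \<eta>'"
  shows "C1_with_gradient (\<lambda>x. \<eta> (\<phi> x)) (\<lambda>x. \<eta>' (\<phi> x) *\<^sub>R F x)"
proof -
  have "continuous_on UNIV (\<lambda>x. \<eta>' (\<phi> x) *\<^sub>R F x)"
    using C1_continuous(1,2)[OF \<phi>] \<eta>(2)
    by (intro continuous_intros continuous_on_compose2[OF \<eta>(2)]) auto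
  then show ?thesis
    using \<phi> \<eta>(1) unfolding C1_with_gradient_def by (auto intro: GDERIV_DERIV_compose)
qed

definition plane_rotation :: "'n \<Rightarrow> 'n \<Rightarrow> real \<Rightarrow> real ^ 'n \<Rightarrow> real ^ 'n" where
  "plane_rotation i j t x = x + ((cos t - 1) * x $ i - sin t * x $ j) *\<^sub>R axis i 1
     + (sin t * x $ i + (cos t - 1) * x $ j) *\<^sub>R axis j 1"

lemma orthogonal_plane_rotation:
  fixes i j :: "'n::finite"
  assumes "i \<noteq> j"
  shows "orthogonal_transformation (plane_rotation i j t)"
  unfolding orthogonal_transformation_def
proof (intro conjI allI)
  show "linear (plane_rotation i j t)"
    by (rule linearI) (simp_all add: plane_rotation_def vec_eq_iff axis_def algebra_simps)
  fix x y :: "real ^ 'n"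
  define c where "c = cos t - 1"
  have c: "c * c + sin t * sin t = - 2 * c"
    using sin_cos_squared_add[of t] by (simp add: c_def power2_eq_square algebra_simps)
  define P where "P = x $ i * y $ i + x $ j * y $ j"
  have "plane_rotation i j t x \<bullet> plane_rotation i j t y = x \<bullet> y + 2 * c * P + (c * c + sin t * sin t) * P"
  proof -
    have axes: "axis i 1 $ i = (1 :: real)" "axis j 1 $ j = (1 :: real)" "axis i 1 $ j = (0 :: real)" "axis j 1 $ i = (0 :: real)"
      using assms by (simp_all add: axis_def)
    show ?thesis
      by (simp add: plane_rotation_def inner_add_left inner_add_right inner_axis inner_axis' axes
          c_def[symmetric] P_def algebra_simps)
  qed
  then show "plane_rotation i j t x \<bullet> plane_rotation i j t y = x \<bullet> y"
    unfolding c by simp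
qed

text \<open>
  The integral of \<open>\<phi> \<circ> R\<^sub>t\<close> does not depend on the angle \<open>t\<close> of the rotation \<open>R\<^sub>t\<close> in the plane of the
  coordinates \<open>i\<close> and \<open>j\<close>, and the integrand is the derivative of \<open>\<phi> \<circ> R\<^sub>t\<close> at \<open>t = 0\<close>.
\<close>

lemma integral_rotation_derivative:
  fixes \<phi> :: "real ^ 'n \<Rightarrow> real"
  assumes C1: "C1_with_gradient \<phi> G"
  shows "(\<integral>x. x $ i * G x $ j - x $ j * G x $ i \<partial>sphere_measure) = 0"
proof (cases "i = j")
  case False
  let ?R = "plane_rotation i j"
  define R' :: "real \<Rightarrow> real ^ 'n \<Rightarrow> real ^ 'n" where
    "R' t x = (- sin t * x $ i - cos t * x $ j) *\<^sub>R axis i 1 + (cos t * x $ i - sin t * x $ j) *\<^sub>R axis j 1" for t x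
  note T = orthogonal_plane_rotation[OF False]
  have deriv: "((\<lambda>t. \<phi> (?R t x)) has_real_derivative R' t x \<bullet> G (?R t x)) (at t)" for t x
  proof -
    have "((\<lambda>t. ?R t x) has_vector_derivative R' t x) (at t)"
      unfolding plane_rotation_def R'_def
      by (auto intro!: derivative_eq_intros simp: has_real_derivative_iff_has_vector_derivative[symmetric])
    moreover have "(\<phi> has_derivative (\<lambda>h. h \<bullet> G (?R t x))) (at (?R t x))"
      using C1 by (simp add: C1_with_gradient_def gderiv_def)
    ultimately have "((\<phi> \<circ> (\<lambda>t. ?R t x)) has_derivative (\<lambda>h. h \<bullet> G (?R t x)) \<circ> (\<lambda>s. s *\<^sub>R R' t x)) (at t)"
      unfolding has_vector_derivative_def by (intro diff_chain_at)
    then show ?thesis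
      by (simp add: has_field_derivative_def o_def mult_commute_abs)
  qed
  have "compact (G ` sphere 0 1)"
    by (intro compact_continuous_image continuous_on_subset[OF C1_continuous(2)[OF C1]]) auto
  then obtain B where B: "\<And>y. y \<in> sphere 0 1 \<Longrightarrow> norm (G y) \<le> B"
    using compact_imp_bounded bounded_iff by (metis imageI)
  have bound: "\<bar>R' t x \<bullet> G (?R t x)\<bar> \<le> 4 * B" if x: "x \<in> sphere 0 1" for t x
  proof -
    have "\<bar>x $ i\<bar> \<le> 1" "\<bar>x $ j\<bar> \<le> 1"
      using component_le_norm_cart[of x] x by (auto simp: dist_norm)
    then have trig: "\<bar>sin t * x $ i\<bar> \<le> 1" "\<bar>cos t * x $ j\<bar> \<le> 1" "\<bar>cos t * x $ i\<bar> \<le> 1" "\<bar>sin t * x $ j\<bar> \<le> 1"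
      unfolding abs_mult by (intro mult_le_one; simp)+
    have "norm (R' t x) \<le> \<bar>- sin t * x $ i - cos t * x $ j\<bar> + \<bar>cos t * x $ i - sin t * x $ j\<bar>"
      unfolding R'_def by (rule order_trans[OF norm_triangle_ineq]) simp
    also have "\<dots> \<le> 4"
      using trig by linarith
    finally have "norm (R' t x) * norm (G (?R t x)) \<le> 4 * B"
      using B[of "?R t x"] orthogonal_transformation_norm[OF T, of t x] x by (intro mult_mono) auto
    then show ?thesis
      using Cauchy_Schwarz_ineq2[of "R' t x" "G (?R t x)"] by linarith
  qed
  \<comment> \<open>difference quotients in the angle; they are uniformly bounded by the mean value theorem\<close>
  define s where "s n x = (\<phi> (?R (inverse (real (Suc n))) x) - \<phi> x) / inverse (real (Suc n))" for n x
  have R0: "?R 0 x = x" for x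
    by (simp add: plane_rotation_def)
  have contR: "continuous_on UNIV (?R t)" for t
    by (intro linear_continuous_on linear_conv_bounded_linear[THEN iffD1] orthogonal_transformation_linear T)
  have cont\<phi>: "continuous_on UNIV (\<lambda>x. \<phi> (?R t x))" for t
    by (rule continuous_on_compose2[OF C1_continuous(1)[OF C1] contR]) simp
  have int_s: "(\<integral>x. s n x \<partial>sphere_measure) = 0" for n
  proof -
    have "(\<integral>x. \<phi> (?R t x) \<partial>sphere_measure) = (\<integral>x. \<phi> x \<partial>sphere_measure)" for t
      by (intro integral_sphere_measure_orthogonal T borel_measurable_continuous_onI C1_continuous(1)[OF C1])
    then show ?thesis
      unfolding s_def
      using L2_integrable[OF continuous_L2_sphere[OF cont\<phi>]] L2_integrable[OF continuous_L2_sphere[OF C1_continuous(1)[OF C1]]]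
      by simp
  qed
  have contL: "continuous_on UNIV (\<lambda>x. x $ i * G x $ j - x $ j * G x $ i)"
    using C1_continuous(2)[OF C1] by (intro continuous_intros)
  have "(\<lambda>n. \<integral>x. s n x \<partial>sphere_measure) \<longlonglongrightarrow> (\<integral>x. x $ i * G x $ j - x $ j * G x $ i \<partial>sphere_measure)"
  proof (rule integral_dominated_convergence[where w = "\<lambda>_. 4 * B"])
    show "(\<lambda>x. x $ i * G x $ j - x $ j * G x $ i) \<in> borel_measurable sphere_measure"
      by (intro borel_measurable_sphere_measure borel_measurable_continuous_onI contL)
    show "s n \<in> borel_measurable sphere_measure" for n
      unfolding s_def using cont\<phi> C1_continuous(1)[OF C1]
      by (intro borel_measurable_sphere_measure borel_measurable_continuous_onI continuous_intros) auto
    show "integrable sphere_measure (\<lambda>_ :: real ^ 'n. 4 * B)"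
      by (intro finite_measure.integrable_const finite_measure_sphere_measure)
    show "AE x in sphere_measure. norm (s n x) \<le> 4 * B" for n
    proof (rule AE_I2)
      fix x :: "real ^ 'n" assume "x \<in> space sphere_measure"
      then have x: "x \<in> sphere 0 1" by simp
      have "norm (\<phi> (?R (inverse (real (Suc n))) x) - \<phi> (?R 0 x)) \<le> 4 * B * norm (inverse (real (Suc n)) - 0)"
        by (rule field_differentiable_bound[of UNIV _ "\<lambda>t. R' t x \<bullet> G (?R t x)"])
          (use deriv bound[OF x] in auto)
      then have "\<bar>\<phi> (?R (inverse (real (Suc n))) x) - \<phi> x\<bar> \<le> 4 * B * inverse (real (Suc n))"
        unfolding R0 by simp
      then show "norm (s n x) \<le> 4 * B"
        unfolding s_def real_norm_def abs_divide by (simp add: pos_divide_le_eq del: of_nat_Suc)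
    qed
    show "AE x in sphere_measure. (\<lambda>n. s n x) \<longlonglongrightarrow> x $ i * G x $ j - x $ j * G x $ i"
    proof (rule AE_I2)
      fix x :: "real ^ 'n"
      have "((\<lambda>t. (\<phi> (?R (0 + t) x) - \<phi> (?R 0 x)) / t) \<longlongrightarrow> R' 0 x \<bullet> G (?R 0 x)) (at 0)"
        using deriv[of x 0] unfolding DERIV_def .
      moreover have "filterlim (\<lambda>n. inverse (real (Suc n))) (at 0) sequentially"
        using LIMSEQ_inverse_real_of_nat by (auto simp: filterlim_at)
      ultimately have "(\<lambda>n. (\<phi> (?R (0 + inverse (real (Suc n))) x) - \<phi> (?R 0 x)) / inverse (real (Suc n)))
          \<longlonglongrightarrow> R' 0 x \<bullet> G (?R 0 x)"
        by (rule filterlim_compose)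
      moreover have "R' 0 x \<bullet> G (?R 0 x) = x $ i * G x $ j - x $ j * G x $ i"
        by (simp add: R0 R'_def inner_add_left inner_diff_left inner_axis')
      ultimately show "(\<lambda>n. s n x) \<longlonglongrightarrow> x $ i * G x $ j - x $ j * G x $ i"
        by (simp add: s_def R0)
    qed
  qed
  then show ?thesis
    unfolding int_s by (simp add: LIMSEQ_const_iff)
qed simp

lemma sum_squares_coordinates_sphere: "x \<in> sphere 0 1 \<Longrightarrow> (\<Sum>j\<in>UNIV. (x $ j)\<^sup>2) = 1" for x :: "real ^ 'n"
  by (simp add: norm_vec_def L2_set_def)

text \<open>
  On the sphere, \<open>D\<^sub>i = \<Sum>\<^sub>j x\<^sub>j L\<^sub>j\<^sub>i\<close> with the rotation fields \<open>L\<^sub>j\<^sub>i = x\<^sub>j \<partial>\<^sub>i - x\<^sub>i \<partial>\<^sub>j\<close>. Moving \<open>x\<^sub>j\<close> inside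
  the derivative costs \<open>\<phi> L\<^sub>j\<^sub>i x\<^sub>j = - x\<^sub>i \<phi>\<close> for each \<open>j \<noteq> i\<close>, which is the curvature term, and the remaining
  integrals of \<open>L\<^sub>j\<^sub>i(x\<^sub>j \<phi>)\<close> vanish.
\<close>

lemma divergence_sphere:
  fixes \<phi> :: "real ^ 'n \<Rightarrow> real"
  assumes C1: "C1_with_gradient \<phi> G"
  shows "(\<integral>x. tangential x (G x) $ i \<partial>sphere_measure) = (real CARD('n) - 1) * (\<integral>x. \<phi> x * x $ i \<partial>sphere_measure)"
proof -
  note cont = C1_continuous[OF C1]
  define \<Psi> where "\<Psi> j x = x $ j *\<^sub>R G x + \<phi> x *\<^sub>R axis j 1" for j x
  have "C1_with_gradient (\<lambda>x. x $ j * \<phi> x) (\<Psi> j)" for j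
    using C1_mult[OF C1_coordinate C1] unfolding \<Psi>_def .
  then have zero: "(\<integral>x. x $ j * \<Psi> j x $ i - x $ i * \<Psi> j x $ j \<partial>sphere_measure) = 0" for j
    by (rule integral_rotation_derivative)
  have "continuous_on UNIV (\<lambda>x. x $ j * \<Psi> j x $ i - x $ i * \<Psi> j x $ j)" for j
    unfolding \<Psi>_def using cont(1,2) by (intro continuous_intros)
  then have "(\<integral>x. (\<Sum>j\<in>UNIV. x $ j * \<Psi> j x $ i - x $ i * \<Psi> j x $ j) \<partial>sphere_measure) = 0"
    by (subst Bochner_Integration.integral_sum) (auto simp: zero intro!: L2_integrable continuous_L2_sphere)
  moreover have "(\<Sum>j\<in>UNIV. x $ j * \<Psi> j x $ i - x $ i * \<Psi> j x $ j)
      = tangential x (G x) $ i - (real CARD('n) - 1) * (\<phi> x * x $ i)" if x: "x \<in> sphere 0 1" for x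
  proof -
    have "(\<Sum>j\<in>UNIV. x $ j * \<Psi> j x $ i - x $ i * \<Psi> j x $ j)
        = (\<Sum>j\<in>UNIV. (x $ j)\<^sup>2 * G x $ i - x $ i * (x $ j * G x $ j) + (if j = i then \<phi> x * x $ i else 0) - \<phi> x * x $ i)"
      by (intro sum.cong) (auto simp: \<Psi>_def axis_def power2_eq_square algebra_simps)
    also have "\<dots> = (\<Sum>j\<in>UNIV. (x $ j)\<^sup>2) * G x $ i - x $ i * (x \<bullet> G x) + \<phi> x * x $ i - real CARD('n) * (\<phi> x * x $ i)"
      by (simp add: sum.distrib sum_subtractf sum_distrib_left sum_distrib_right inner_vec_def)
    also have "\<dots> = tangential x (G x) $ i - (real CARD('n) - 1) * (\<phi> x * x $ i)"
      unfolding sum_squares_coordinates_sphere[OF x] by (simp add: tangential_def algebra_simps)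
    finally show ?thesis .
  qed
  ultimately have "(\<integral>x. tangential x (G x) $ i - (real CARD('n) - 1) * (\<phi> x * x $ i) \<partial>sphere_measure) = 0"
    by (metis (no_types, lifting) Bochner_Integration.integral_cong space_sphere_measure)
  moreover have "integrable sphere_measure (\<lambda>x. tangential x (G x) $ i)"
    by (intro L2_integrable continuous_L2_sphere cont)
  moreover have "integrable sphere_measure (\<lambda>x. \<phi> x * x $ i)"
    using cont(1) by (intro L2_integrable continuous_L2_sphere continuous_intros)
  ultimately show ?thesis
    by simp
qed

text \<open>
  Apply the divergence theorem to \<open>\<epsilon> arctan(x\<^sub>k / \<epsilon>)\<close> with \<open>\<epsilon> \<rightarrow> 0\<close>: the function tends to 0
  uniformly, whereas its tangential derivative tends boundedly to the indicator of the equator.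
\<close>

lemma AE_not_equator: "AE x in (sphere_measure :: (real ^ 'n) measure). x $ k \<noteq> 0"
proof -
  let ?M = "sphere_measure :: (real ^ 'n) measure"
  interpret finite_measure ?M by (rule finite_measure_sphere_measure)
  define E where "E = {x :: real ^ 'n. x $ k = 0}"
  define c where "c n = real (Suc n)" for n
  have c: "0 < c n" for n
    by (simp add: c_def)
  have "closed E"
    unfolding E_def by (intro closed_Collect_eq continuous_intros)
  then have E: "E \<in> sets borel" by simp
  have coord: "\<bar>x $ k\<bar> \<le> 1" if "x \<in> sphere 0 1" for x :: "real ^ 'n"
    using component_le_norm_cart[of x k] that by simp
  have C1: "C1_with_gradient (\<lambda>x. arctan (c n * x $ k) / c n) (\<lambda>x. inverse (1 + (c n * x $ k)\<^sup>2) *\<^sub>R axis k 1)" for n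
  proof (rule C1_compose[OF C1_coordinate, of "\<lambda>t. arctan (c n * t) / c n" "\<lambda>t. inverse (1 + (c n * t)\<^sup>2)"])
    have "((\<lambda>t. arctan (c n * t) / c n) has_real_derivative (inverse (1 + (c n * t)\<^sup>2) * c n / c n)) (at t)" for t
      by (intro DERIV_cdivide DERIV_arctan[THEN DERIV_chain2]) (auto intro!: derivative_eq_intros)
    then show "((\<lambda>t. arctan (c n * t) / c n) has_real_derivative inverse (1 + (c n * t)\<^sup>2)) (at t)" for t
      using c[of n] by simp
    have "1 + (c n * t)\<^sup>2 \<noteq> 0" for t
      using zero_le_power2[of "c n * t"] by linarith
    then show "continuous_on UNIV (\<lambda>t. inverse (1 + (c n * t)\<^sup>2))"
      by (intro continuous_intros) auto
  qed
  have eq: "(\<integral>x. (1 - (x $ k)\<^sup>2) / (1 + (c n * x $ k)\<^sup>2) \<partial>?M)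
      = (real CARD('n) - 1) * (\<integral>x. arctan (c n * x $ k) / c n * x $ k \<partial>?M)" for n
    using divergence_sphere[OF C1[of n], of k]
    by (simp add: tangential_def inner_axis power2_eq_square divide_inverse algebra_simps)
  have "(\<lambda>n. \<integral>x. (1 - (x $ k)\<^sup>2) / (1 + (c n * x $ k)\<^sup>2) \<partial>?M) \<longlonglongrightarrow> (\<integral>x. indicator E x \<partial>?M)"
  proof (rule integral_dominated_convergence[where w = "\<lambda>_. 1"])
    show "indicat_real E \<in> borel_measurable ?M"
      by (intro borel_measurable_sphere_measure) (use E in simp)
    show "(\<lambda>x. (1 - (x $ k)\<^sup>2) / (1 + (c n * x $ k)\<^sup>2)) \<in> borel_measurable ?M" for n
      by (intro borel_measurable_sphere_measure) measurable
    show "AE x in ?M. (\<lambda>n. (1 - (x $ k)\<^sup>2) / (1 + (c n * x $ k)\<^sup>2)) \<longlonglongrightarrow> indicator E x"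
    proof (rule AE_I2)
      fix x :: "real ^ 'n"
      show "(\<lambda>n. (1 - (x $ k)\<^sup>2) / (1 + (c n * x $ k)\<^sup>2)) \<longlonglongrightarrow> indicator E x"
      proof (cases "x $ k = 0")
        case True
        then show ?thesis by (simp add: E_def)
      next
        case False
        have "filterlim (\<lambda>n. c n) at_top sequentially"
          unfolding c_def using filterlim_real_sequentially filterlim_sequentially_Suc by blast
        then have "filterlim (\<lambda>n. (x $ k)\<^sup>2 * (c n)\<^sup>2) at_top sequentially"
          using False by (intro filterlim_tendsto_pos_mult_at_top[OF tendsto_const] filterlim_pow_at_top) auto
        then have "filterlim (\<lambda>n. 1 + (c n * x $ k)\<^sup>2) at_top sequentially"
          by (intro filterlim_tendsto_add_at_top[OF tendsto_const]) (simp add: power_mult_distrib mult.commute)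
        then have "(\<lambda>n. (1 - (x $ k)\<^sup>2) / (1 + (c n * x $ k)\<^sup>2)) \<longlonglongrightarrow> 0"
          by (intro tendsto_divide_0[OF tendsto_const] filterlim_at_top_imp_at_infinity)
        then show ?thesis
          using False by (simp add: E_def)
      qed
    qed
    show "AE x in ?M. norm ((1 - (x $ k)\<^sup>2) / (1 + (c n * x $ k)\<^sup>2)) \<le> 1" for n
    proof (rule AE_I2)
      fix x :: "real ^ 'n" assume "x \<in> space ?M"
      then have "(x $ k)\<^sup>2 \<le> 1"
        using coord by (simp add: abs_square_le_1)
      moreover have "0 \<le> (c n * x $ k)\<^sup>2" "0 \<le> (x $ k)\<^sup>2"
        by simp_all
      ultimately have "0 \<le> 1 - (x $ k)\<^sup>2" "1 - (x $ k)\<^sup>2 \<le> 1 + (c n * x $ k)\<^sup>2" "0 < 1 + (c n * x $ k)\<^sup>2"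
        by linarith+
      then show "norm ((1 - (x $ k)\<^sup>2) / (1 + (c n * x $ k)\<^sup>2)) \<le> 1"
        by simp
    qed
  qed simp
  moreover have "(\<lambda>n. (real CARD('n) - 1) * (\<integral>x. arctan (c n * x $ k) / c n * x $ k \<partial>?M)) \<longlonglongrightarrow> (real CARD('n) - 1) * 0"
  proof (rule tendsto_mult[OF tendsto_const], rule Lim_null_comparison)
    show "\<forall>\<^sub>F n in sequentially. norm (\<integral>x. arctan (c n * x $ k) / c n * x $ k \<partial>?M) \<le> measure ?M (space ?M) * 2 * inverse (c n)"
    proof (rule always_eventually, rule allI)
      fix n
      have "(\<integral>x. norm (arctan (c n * x $ k) / c n * x $ k) \<partial>?M) \<le> (\<integral>x. 2 * inverse (c n) \<partial>?M)"
      proof (rule integral_mono)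
        have "continuous_on UNIV (\<lambda>x :: real ^ 'n. arctan (c n * x $ k) / c n * x $ k)"
          by (intro continuous_on_mult C1_continuous(1)[OF C1] C1_continuous(1)[OF C1_coordinate])
        then show "integrable ?M (\<lambda>x. norm (arctan (c n * x $ k) / c n * x $ k))"
          by (intro integrable_norm L2_integrable continuous_L2_sphere)
        fix x :: "real ^ 'n" assume "x \<in> space ?M"
        then have 1: "\<bar>x $ k\<bar> \<le> 1"
          using coord by simp
        have 2: "\<bar>arctan (c n * x $ k)\<bar> \<le> 2"
          using arctan_bounded[of "c n * x $ k"] pi_less_4 by linarith
        have "\<bar>arctan (c n * x $ k)\<bar> / c n * \<bar>x $ k\<bar> \<le> 2 / c n * 1"
          using 1 2 c[of n] by (intro mult_mono divide_right_mono) auto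
        then show "norm (arctan (c n * x $ k) / c n * x $ k) \<le> 2 * inverse (c n)"
          using c[of n] by (simp add: abs_mult divide_inverse)
      qed simp
      then show "norm (\<integral>x. arctan (c n * x $ k) / c n * x $ k \<partial>?M) \<le> measure ?M (space ?M) * 2 * inverse (c n)"
        by (intro order_trans[OF integral_norm_bound]) (simp add: mult.assoc)
    qed
    show "(\<lambda>n. measure ?M (space ?M) * 2 * inverse (c n)) \<longlonglongrightarrow> 0"
      unfolding c_def by (rule tendsto_mult_right_zero[OF LIMSEQ_inverse_real_of_nat])
  qed
  ultimately have "(\<integral>x. indicat_real E x \<partial>?M) = 0"
    unfolding eq using LIMSEQ_unique by fastforce
  moreover have "integrable ?M (indicat_real E)"
  proof (rule Bochner_Integration.integrable_bound[of ?M "\<lambda>_. 1 :: real"])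
    show "indicat_real E \<in> borel_measurable ?M"
      by (intro borel_measurable_sphere_measure) (use E in simp)
  qed (auto simp: indicator_def)
  ultimately have "AE x in ?M. indicat_real E x = 0"
    using integral_nonneg_eq_0_iff_AE[where M = ?M and f = "indicat_real E"] by simp
  then show ?thesis
    by eventually_elim (auto simp: E_def indicator_def split: if_splits)
qed

section \<open>Polynomials on the sphere\<close>

subsection \<open>Tangential derivatives of smooth functions\<close>

definition smooth :: "(real ^ 'n \<Rightarrow> real) \<Rightarrow> bool" where
  "smooth f \<longleftrightarrow> (\<exists>G. C1_with_gradient f G)"

text \<open>
  Differentiating in the direction of the projected coordinate vector gives the \<open>i\<close>-th component of the
  tangential gradient without reference to a chosen ambient gradient.
\<close>

definition sderiv :: "'n \<Rightarrow> (real ^ 'n \<Rightarrow> real) \<Rightarrow> real ^ 'n \<Rightarrow> real" where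
  "sderiv i f x = frechet_derivative f (at x) (tangential x (axis i 1))"

lemma sderiv_eq:
  assumes "C1_with_gradient f G"
  shows "sderiv i f x = tangential x (G x) $ i"
proof -
  have "(f has_derivative (\<lambda>h. h \<bullet> G x)) (at x)"
    using assms by (simp add: C1_with_gradient_def gderiv_def)
  then have "frechet_derivative f (at x) = (\<lambda>h. h \<bullet> G x)"
    by (rule frechet_derivative_at[symmetric])
  then show ?thesis
    by (simp add: sderiv_def tangential_def inner_diff_left inner_axis inner_axis')
qed

lemma smooth_gradient:
  assumes "smooth f"
  obtains G where "C1_with_gradient f G" "\<And>i x. sderiv i f x = tangential x (G x) $ i"
  using assms sderiv_eq unfolding smooth_def by metis

lemma smooth_const: "smooth (\<lambda>_. c)"
  unfolding smooth_def using C1_const by blast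

lemma smooth_coordinate: "smooth (\<lambda>x. x $ j)"
  unfolding smooth_def using C1_coordinate by blast

lemma smooth_add: "smooth f \<Longrightarrow> smooth g \<Longrightarrow> smooth (\<lambda>x. f x + g x)"
  unfolding smooth_def using C1_add by blast

lemma smooth_mult: "smooth f \<Longrightarrow> smooth g \<Longrightarrow> smooth (\<lambda>x. f x * g x)"
  unfolding smooth_def using C1_mult by blast

lemma smooth_continuous: "smooth f \<Longrightarrow> continuous_on UNIV f"
  unfolding smooth_def using C1_continuous(1) by blast

lemma sderiv_continuous: "smooth f \<Longrightarrow> continuous_on UNIV (sderiv i f)"
  using C1_continuous(4) by (metis (no_types, lifting) continuous_on_cong smooth_gradient)

lemma smooth_L2: "smooth f \<Longrightarrow> f \<in> L2 sphere_measure"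
  by (intro continuous_L2_sphere smooth_continuous)

lemma sderiv_L2: "smooth f \<Longrightarrow> sderiv i f \<in> L2 sphere_measure"
  by (intro continuous_L2_sphere sderiv_continuous)

lemma sderiv_const: "sderiv i (\<lambda>_. c) x = 0"
  by (simp add: sderiv_eq[OF C1_const] tangential_def)

lemma sderiv_coordinate: "sderiv i (\<lambda>x. x $ j) x = (if i = j then 1 else 0) - x $ i * x $ j"
  by (simp add: sderiv_eq[OF C1_coordinate] tangential_def inner_axis) (simp add: axis_def)

lemma sderiv_add:
  "smooth f \<Longrightarrow> smooth g \<Longrightarrow> sderiv i (\<lambda>x. f x + g x) x = sderiv i f x + sderiv i g x"
  by (elim smooth_gradient) (simp add: sderiv_eq[OF C1_add] tangential_def inner_add_right algebra_simps)

lemma sderiv_mult: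
  "smooth f \<Longrightarrow> smooth g \<Longrightarrow> sderiv i (\<lambda>x. f x * g x) x = f x * sderiv i g x + g x * sderiv i f x"
proof (elim smooth_gradient)
  fix F G
  assume F: "C1_with_gradient f F" "\<And>i x. sderiv i f x = tangential x (F x) $ i"
    and G: "C1_with_gradient g G" "\<And>i x. sderiv i g x = tangential x (G x) $ i"
  show ?thesis
    unfolding sderiv_eq[OF C1_mult[OF F(1) G(1)]] F(2) G(2)
    by (simp add: tangential_def inner_add_right algebra_simps)
qed

lemma sderiv_cmult: "smooth f \<Longrightarrow> sderiv i (\<lambda>x. c * f x) x = c * sderiv i f x"
  using sderiv_mult[OF smooth_const, of f i c x] by (simp add: sderiv_const)

text \<open>
  The tangential gradient is orthogonal to the position vector.
\<close>

lemma sderiv_radial: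
  fixes f :: "real ^ 'n \<Rightarrow> real"
  assumes "smooth f" "x \<in> sphere 0 1"
  shows "(\<Sum>i\<in>UNIV. x $ i * sderiv i f x) = 0"
proof -
  obtain G where "C1_with_gradient f G" and G: "\<And>i x. sderiv i f x = tangential x (G x) $ i"
    by (rule smooth_gradient[OF assms(1)]) (rule that)
  have "(\<Sum>i\<in>UNIV. x $ i * sderiv i f x) = (\<Sum>i\<in>UNIV. x $ i * G x $ i - (x $ i)\<^sup>2 * (x \<bullet> G x))"
    by (intro sum.cong) (simp_all add: G tangential_def power2_eq_square algebra_simps)
  also have "\<dots> = x \<bullet> G x - (\<Sum>i\<in>UNIV. (x $ i)\<^sup>2) * (x \<bullet> G x)"
    by (simp add: sum_subtractf sum_distrib_right inner_vec_def)
  finally show ?thesis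
    using sum_squares_coordinates_sphere[OF assms(2)] by simp
qed

definition slaplace :: "(real ^ 'n \<Rightarrow> real) \<Rightarrow> real ^ 'n \<Rightarrow> real" where
  "slaplace f x = (\<Sum>i\<in>UNIV. sderiv i (sderiv i f) x)"

subsection \<open>The filtration by degree\<close>

text \<open>
  Polynomials of degree less than \<open>n\<close>. The strict bound makes level 0 the zero function, so that
  lowering the degree by one has a meaning for constants too.
\<close>

inductive poly_below :: "nat \<Rightarrow> (real ^ 'n \<Rightarrow> real) \<Rightarrow> bool" where
  zero: "poly_below 0 (\<lambda>_. 0)"
| const: "poly_below (Suc n) (\<lambda>_. c)"
| coordinate: "poly_below n f \<Longrightarrow> poly_below (Suc n) (\<lambda>x. x $ j * f x)"
| add: "poly_below n f \<Longrightarrow> poly_below n g \<Longrightarrow> poly_below n (\<lambda>x. f x + g x)"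

lemma poly_below_cong: "poly_below n f \<Longrightarrow> (\<And>x. f x = g x) \<Longrightarrow> poly_below n g"
  by (metis ext)

lemma poly_below_Suc: "poly_below n f \<Longrightarrow> poly_below (Suc n) f"
  by (induction rule: poly_below.induct) (auto intro: poly_below.intros)

lemma poly_below_mono: "poly_below m f \<Longrightarrow> m \<le> n \<Longrightarrow> poly_below n f"
  by (rule dec_induct[of m n "\<lambda>n. poly_below n f"]) (auto intro: poly_below_Suc)

lemma poly_below_0: "poly_below 0 f \<Longrightarrow> f x = 0"
  by (induction "0 :: nat" f rule: poly_below.induct) auto

lemma poly_below_zero: "poly_below n (\<lambda>_. 0)"
  by (cases n) (auto intro: poly_below.intros)

lemma poly_below_cmult: "poly_below n f \<Longrightarrow> poly_below n (\<lambda>x. c * f x)"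
proof (induction rule: poly_below.induct)
  case (coordinate n f j)
  then show ?case
    by (intro poly_below_cong[OF poly_below.coordinate[OF coordinate.IH, of j]]) (simp add: algebra_simps)
next
  case (add n f g)
  then show ?case
    by (intro poly_below_cong[OF poly_below.add[OF add.IH]]) (simp add: algebra_simps)
qed (auto intro: poly_below.intros)

lemma poly_below_diff: "poly_below n f \<Longrightarrow> poly_below n g \<Longrightarrow> poly_below n (\<lambda>x. f x - g x)"
  using poly_below.add[OF _ poly_below_cmult[of n g "-1"], of f] by simp

lemma poly_below_sum: "(\<And>i. i \<in> I \<Longrightarrow> poly_below n (f i)) \<Longrightarrow> poly_below n (\<lambda>x. \<Sum>i\<in>I. f i x)"
  by (induction I rule: infinite_finite_induct) (auto intro: poly_below_zero poly_below.add)

lemma poly_below_mult: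
  "poly_below m f \<Longrightarrow> poly_below n g \<Longrightarrow> poly_below (m + n) (\<lambda>x. f x * g x)"
proof (induction rule: poly_below.induct)
  case zero
  then show ?case by (simp add: poly_below_zero)
next
  case (const m c)
  then show ?case
    by (intro poly_below_mono[OF poly_below_cmult]) auto
next
  case (coordinate m f j)
  then show ?case
    using poly_below.coordinate[of "m + n" "\<lambda>x. f x * g x" j] by (simp add: mult.assoc)
next
  case (add m f f')
  then show ?case
    by (intro poly_below_cong[OF poly_below.add[OF add.IH[OF add.prems]]]) (simp add: algebra_simps)
qed

lemma poly_below_smooth: "poly_below n f \<Longrightarrow> smooth f"
  by (induction rule: poly_below.induct) (auto intro: smooth_const smooth_mult smooth_coordinate smooth_add)

lemma sderiv_coordinate_mult:
  assumes "smooth f"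
  shows "sderiv i (\<lambda>x. x $ j * f x) x = x $ j * sderiv i f x + ((if i = j then 1 else 0) - x $ i * x $ j) * f x"
  unfolding sderiv_mult[OF smooth_coordinate assms] sderiv_coordinate by (simp add: algebra_simps)

lemma poly_below_sderiv: "poly_below n f \<Longrightarrow> poly_below (Suc n) (sderiv i f)"
proof (induction rule: poly_below.induct)
  case zero
  then show ?case
    by (rule poly_below_cong[OF poly_below_zero]) (simp add: sderiv_const)
next
  case (const n c)
  then show ?case
    by (rule poly_below_cong[OF poly_below_zero]) (simp add: sderiv_const)
next
  case (coordinate n f j)
  have "poly_below (Suc (Suc n)) (\<lambda>x. x $ j * sderiv i f x + ((if i = j then 1 else 0) * f x - x $ i * (x $ j * f x)))"
    by (intro poly_below.add poly_below_diff poly_below.coordinate poly_below_cmult poly_below_Suc coordinate)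
  then show ?case
    by (rule poly_below_cong, unfold sderiv_coordinate_mult[OF poly_below_smooth[OF coordinate.hyps]])
      (simp add: algebra_simps)
next
  case (add n f g)
  then show ?case
    by (intro poly_below_cong[OF poly_below.add[OF add.IH]]) (simp add: sderiv_add poly_below_smooth)
qed

text \<open>
  A homogeneous polynomial \<open>f\<close> of degree \<open>r\<close> has \<open>D\<^sub>j f = \<partial>\<^sub>j f - r x\<^sub>j f\<close> by Euler's identity. Adding
  \<open>r x\<^sub>j f\<close> thus removes the part of degree \<open>r + 1\<close>; here the top degree is \<open>r = n - 1\<close>.
\<close>

lemma sderiv_leading_part:
  "poly_below n f \<Longrightarrow> poly_below n (\<lambda>x. sderiv j f x + (real n - 1) * (x $ j * f x))"
proof (induction rule: poly_below.induct)
  case zero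
  then show ?case
    by (rule poly_below_cong[OF poly_below_zero]) (simp add: sderiv_const)
next
  case (const n c)
  show ?case
  proof (cases n)
    case 0
    then show ?thesis
      by (intro poly_below_cong[OF poly_below_zero]) (simp add: sderiv_const)
  next
    case (Suc k)
    have "poly_below (Suc n) (\<lambda>x. real n * (x $ j * c))"
      unfolding Suc by (intro poly_below_cmult poly_below.coordinate poly_below.const)
    then show ?thesis
      by (rule poly_below_cong) (simp add: sderiv_const)
  qed
next
  case (coordinate n f k)
  have "poly_below (Suc n) (\<lambda>x. x $ k * (sderiv j f x + (real n - 1) * (x $ j * f x)) + (if j = k then 1 else 0) * f x)"
    by (intro poly_below.add poly_below.coordinate poly_below_cmult poly_below_Suc coordinate)
  then show ?case
    by (rule poly_below_cong, unfold sderiv_coordinate_mult[OF poly_below_smooth[OF coordinate.hyps]])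
      (simp add: algebra_simps)
next
  case (add n f g)
  then show ?case
    by (intro poly_below_cong[OF poly_below.add[OF add.IH]]) (auto simp: sderiv_add poly_below_smooth algebra_simps)
qed

text \<open>
  The argument is real because the top degree \<open>n - 1\<close> at level \<open>n\<close> of the filtration is \<open>- 1\<close> for
  \<open>n = 0\<close>.
\<close>

definition sphere_eigenvalue :: "real \<Rightarrow> real \<Rightarrow> real" where
  "sphere_eigenvalue d r = r * (r + d - 2)"

text \<open>
  The Leibniz rule \<open>\<Delta>(x\<^sub>j f) = x\<^sub>j \<Delta>f + 2\<nabla>x\<^sub>j \<sqdot> \<nabla>f + f \<Delta>x\<^sub>j\<close>, where \<open>\<nabla>x\<^sub>j \<sqdot> \<nabla>f = D\<^sub>j f\<close> and
  \<open>\<Delta>x\<^sub>j = - (d - 1) x\<^sub>j\<close> on the sphere.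
\<close>

lemma slaplace_coordinate_mult:
  fixes f :: "real ^ 'n \<Rightarrow> real"
  assumes f: "smooth f" and Df: "\<And>i. smooth (sderiv i f)" and x: "x \<in> sphere 0 1"
  shows "slaplace (\<lambda>x. x $ j * f x) x = x $ j * slaplace f x + 2 * sderiv j f x - (real CARD('n) - 1) * (x $ j * f x)"
proof -
  define \<delta> :: "'n \<Rightarrow> real" where "\<delta> i = (if i = j then 1 else 0)" for i
  have first: "sderiv i (\<lambda>x. x $ j * f x) = (\<lambda>x. x $ j * sderiv i f x + (\<delta> i * f x + (-1) * (x $ i * (x $ j * f x))))" for i
    using sderiv_coordinate_mult[OF f, of i j] by (auto simp: \<delta>_def algebra_simps)
  have second: "sderiv i (sderiv i (\<lambda>x. x $ j * f x)) x
      = x $ j * sderiv i (sderiv i f) x + 2 * (\<delta> i * sderiv i f x) - 2 * x $ j * (x $ i * sderiv i f x)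
        + 2 * x $ j * f x * (x $ i)\<^sup>2 - x $ j * f x * \<delta> i - x $ j * f x" for i
  proof -
    have "\<delta> i * x $ i = \<delta> i * x $ j" "\<delta> i * \<delta> i = \<delta> i"
      by (simp_all add: \<delta>_def)
    then show ?thesis
      unfolding first
      by (simp only: sderiv_add sderiv_mult sderiv_cmult sderiv_coordinate sderiv_const smooth_mult smooth_add
          smooth_coordinate smooth_const f Df) (simp add: \<delta>_def power2_eq_square algebra_simps)
  qed
  have "slaplace (\<lambda>x. x $ j * f x) x = x $ j * slaplace f x + 2 * (\<Sum>i\<in>UNIV. \<delta> i * sderiv i f x)
      - 2 * x $ j * (\<Sum>i\<in>UNIV. x $ i * sderiv i f x)
      + 2 * x $ j * f x * (\<Sum>i\<in>UNIV. (x $ i)\<^sup>2) - x $ j * f x * (\<Sum>i\<in>UNIV. \<delta> i) - real CARD('n) * (x $ j * f x)"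
    unfolding slaplace_def second by (simp add: sum.distrib sum_subtractf sum_distrib_left)
  also have "\<dots> = x $ j * slaplace f x + 2 * sderiv j f x - (real CARD('n) - 1) * (x $ j * f x)"
  proof -
    have "(\<Sum>i\<in>UNIV. \<delta> i * sderiv i f x) = (\<Sum>i\<in>UNIV. if i = j then sderiv i f x else 0)"
      by (intro sum.cong) (auto simp: \<delta>_def)
    then have "(\<Sum>i\<in>UNIV. \<delta> i * sderiv i f x) = sderiv j f x" "(\<Sum>i\<in>UNIV. \<delta> i) = 1"
      by (simp_all add: \<delta>_def)
    then show ?thesis
      unfolding sderiv_radial[OF f x] sum_squares_coordinates_sphere[OF x] by (simp add: algebra_simps)
  qed
  finally show ?thesis .
qed

text \<open>
  Induction on the degree: the step from \<open>f\<close> to \<open>x\<^sub>j f\<close> adds \<open>d - 1\<close> from \<open>\<Delta>x\<^sub>j\<close> and, by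
  \<open>sderiv_leading_part\<close>, twice the degree \<open>r\<close> of \<open>f\<close> from \<open>2 D\<^sub>j f\<close>. The sum \<open>2r + d - 1\<close> is the
  difference of the consecutive numbers \<open>r(r + d - 2)\<close>.
\<close>

lemma slaplace_triangular:
  fixes f :: "real ^ 'n \<Rightarrow> real"
  assumes "poly_below n f"
  shows "\<exists>w. poly_below (n - 1) w \<and>
    (\<forall>x\<in>sphere 0 1. - slaplace f x = sphere_eigenvalue (real CARD('n)) (real n - 1) * f x + w x)"
  using assms
proof (induction rule: poly_below.induct)
  case zero
  then show ?case
    by (intro exI[of _ "\<lambda>_. 0"]) (simp add: poly_below_zero slaplace_def sderiv_const[abs_def])
next
  case (const n c)
  have lap: "slaplace (\<lambda>_. c) x = 0" for x :: "real ^ 'n"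
    by (simp add: slaplace_def sderiv_const[abs_def])
  show ?case
  proof (cases n)
    case 0
    then show ?thesis
      by (intro exI[of _ "\<lambda>_. 0"]) (simp add: poly_below_zero lap sphere_eigenvalue_def)
  next
    case (Suc k)
    then show ?thesis
      by (intro exI[of _ "\<lambda>_. - (sphere_eigenvalue (real CARD('n)) (real (Suc n) - 1) * c)"])
        (simp add: lap poly_below.const)
  qed
next
  case (coordinate n f j)
  then obtain w where w: "poly_below (n - 1) w"
    "\<And>x. x \<in> sphere 0 1 \<Longrightarrow> - slaplace f x = sphere_eigenvalue (real CARD('n)) (real n - 1) * f x + w x"
    by blast
  define w' where "w' x = x $ j * w x - 2 * (sderiv j f x + (real n - 1) * (x $ j * f x))" for x
  have "poly_below n (\<lambda>x. x $ j * w x)"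
  proof (cases n)
    case 0
    then show ?thesis
      using w(1) by (intro poly_below_cong[OF poly_below_zero]) (simp add: poly_below_0)
  next
    case (Suc k)
    then show ?thesis
      using poly_below.coordinate[OF w(1), of j] by simp
  qed
  then have "poly_below n w'"
    unfolding w'_def by (intro poly_below_diff poly_below_cmult sderiv_leading_part coordinate)
  moreover have "- slaplace (\<lambda>x. x $ j * f x) x
      = sphere_eigenvalue (real CARD('n)) (real (Suc n) - 1) * (x $ j * f x) + w' x" if x: "x \<in> sphere 0 1" for x
  proof -
    have sm: "smooth f" "smooth (sderiv i f)" for i
      using poly_below_smooth[OF coordinate.hyps] poly_below_smooth[OF poly_below_sderiv[OF coordinate.hyps]] by blast+
    have "- slaplace (\<lambda>x. x $ j * f x) x
        = x $ j * (- slaplace f x) - 2 * sderiv j f x + (real CARD('n) - 1) * (x $ j * f x)"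
      unfolding slaplace_coordinate_mult[OF sm x] by simp
    also have "\<dots> = sphere_eigenvalue (real CARD('n)) (real (Suc n) - 1) * (x $ j * f x) + w' x"
      unfolding w(2)[OF x] w'_def by (simp add: sphere_eigenvalue_def algebra_simps)
    finally show ?thesis .
  qed
  ultimately show ?case
    by (intro exI[of _ w']) simp
next
  case (add n f g)
  then obtain v w where v: "poly_below (n - 1) v"
      "\<And>x. x \<in> sphere 0 1 \<Longrightarrow> - slaplace f x = sphere_eigenvalue (real CARD('n)) (real n - 1) * f x + v x"
    and w: "poly_below (n - 1) w"
      "\<And>x. x \<in> sphere 0 1 \<Longrightarrow> - slaplace g x = sphere_eigenvalue (real CARD('n)) (real n - 1) * g x + w x"
    by blast
  have sm: "smooth f" "smooth (sderiv i f)" "smooth g" "smooth (sderiv i g)" for i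
    using add.hyps[THEN poly_below_smooth] add.hyps[THEN poly_below_sderiv, THEN poly_below_smooth] by blast+
  have "sderiv i (\<lambda>x. f x + g x) = (\<lambda>x. sderiv i f x + sderiv i g x)" for i
    using sderiv_add[OF sm(1,3)] by blast
  then have "slaplace (\<lambda>x. f x + g x) x = slaplace f x + slaplace g x" for x
    by (simp add: slaplace_def sderiv_add[OF sm(2,4)] sum.distrib)
  then have "- slaplace (\<lambda>x. f x + g x) x
      = sphere_eigenvalue (real CARD('n)) (real n - 1) * (f x + g x) + (v x + w x)" if "x \<in> sphere 0 1" for x
    using v(2)[OF that] w(2)[OF that] by (simp add: algebra_simps)
  then show ?case
    by (intro exI[of _ "\<lambda>x. v x + w x"] conjI ballI poly_below.add v(1) w(1)) auto
qed

lemma sphere_eigenvalue_diff: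
  "sphere_eigenvalue d (real j) - sphere_eigenvalue d (real k) = (real j - real k) * (real j + real k + d - 2)"
  by (simp add: sphere_eigenvalue_def algebra_simps)

lemma sphere_eigenvalue_less:
  assumes "2 \<le> d" "j < k"
  shows "sphere_eigenvalue d (real j) < sphere_eigenvalue d (real k)"
proof -
  have "0 < (real k - real j) * (real k + real j + d - 2)"
    using assms by (intro mult_pos_pos) auto
  then show ?thesis
    using sphere_eigenvalue_diff[of d k j] by linarith
qed

definition spherical_eigenfunction :: "real \<Rightarrow> (real ^ 'n \<Rightarrow> real) \<Rightarrow> bool" where
  "spherical_eigenfunction \<mu> q \<longleftrightarrow>
     (\<exists>n. poly_below n q) \<and> (\<forall>x\<in>sphere 0 1. - slaplace q x = \<mu> * q x)"

lemma slaplace_linear_combination: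
  assumes "\<And>i. i \<in> I \<Longrightarrow> \<exists>n. poly_below n (q i)"
  shows "slaplace (\<lambda>x. \<Sum>i\<in>I. c i * q i x) x = (\<Sum>i\<in>I. c i * slaplace (q i) x)"
proof -
  have sm: "smooth (q i)" "smooth (sderiv l (q i))" if "i \<in> I" for i l
    using assms[OF that] poly_below_smooth poly_below_sderiv by metis+
  have sm_sum: "smooth (\<lambda>x. \<Sum>i\<in>J. c i * f i x)" if "\<And>i. i \<in> J \<Longrightarrow> smooth (f i)" for J and f :: "'a \<Rightarrow> real ^ 'b \<Rightarrow> real"
    using that
  proof (induction J rule: infinite_finite_induct)
    case (insert j J)
    have "smooth (\<lambda>x. c j * f j x + (\<Sum>i\<in>J. c i * f i x))"
      using insert by (intro smooth_add smooth_mult smooth_const) auto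
    then show ?case
      using insert by simp
  qed (simp_all add: smooth_const)
  have D: "sderiv l (\<lambda>x. \<Sum>i\<in>J. c i * f i x) x = (\<Sum>i\<in>J. c i * sderiv l (f i) x)"
    if "\<And>i. i \<in> J \<Longrightarrow> smooth (f i)" for J l x and f :: "'a \<Rightarrow> real ^ 'b \<Rightarrow> real"
    using that
  proof (induction J rule: infinite_finite_induct)
    case (insert j J)
    have "sderiv l (\<lambda>x. c j * f j x + (\<Sum>i\<in>J. c i * f i x)) x = sderiv l (\<lambda>x. c j * f j x) x + sderiv l (\<lambda>x. \<Sum>i\<in>J. c i * f i x) x"
      using insert.prems by (intro sderiv_add smooth_mult smooth_const sm_sum) auto
    then show ?case
      using insert by (simp add: sderiv_cmult)
  qed (simp_all add: sderiv_const)
  have "sderiv l (\<lambda>x. \<Sum>i\<in>I. c i * q i x) = (\<lambda>x. \<Sum>i\<in>I. c i * sderiv l (q i) x)" for l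
    by (intro ext D sm)
  then have "slaplace (\<lambda>x. \<Sum>i\<in>I. c i * q i x) x = (\<Sum>l\<in>UNIV. \<Sum>i\<in>I. c i * sderiv l (sderiv l (q i)) x)"
    unfolding slaplace_def by (intro sum.cong refl) (simp add: D sm)
  also have "\<dots> = (\<Sum>i\<in>I. c i * slaplace (q i) x)"
    unfolding slaplace_def sum_distrib_left by (rule sum.swap)
  finally show ?thesis .
qed

text \<open>
  By \<open>slaplace_triangular\<close>, \<open>(- \<Delta> - \<mu>\<^sub>n) p\<close> has lower degree, hence is a sum of eigenfunctions \<open>r\<^sub>j\<close>.
  Subtracting \<open>r\<^sub>j / (\<mu>\<^sub>j - \<mu>\<^sub>n)\<close> from \<open>p\<close> for all \<open>j\<close> leaves an eigenfunction for \<open>\<mu>\<^sub>n\<close>.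
\<close>

lemma eigenfunction_decomposition:
  fixes p :: "real ^ 'n \<Rightarrow> real"
  assumes d: "2 \<le> CARD('n)" and p: "poly_below n p"
  shows "\<exists>q. (\<forall>j<n. spherical_eigenfunction (sphere_eigenvalue (real CARD('n)) (real j)) (q j)) \<and>
    (\<forall>x\<in>sphere 0 1. p x = (\<Sum>j<n. q j x))"
  using p
proof (induction n arbitrary: p)
  case 0
  then show ?case
    by (simp add: poly_below_0)
next
  case (Suc n)
  let ?\<mu> = "\<lambda>j. sphere_eigenvalue (real CARD('n)) (real j)"
  obtain w where w: "poly_below n w" "\<And>x. x \<in> sphere 0 1 \<Longrightarrow> - slaplace p x = ?\<mu> n * p x + w x"
    using slaplace_triangular[OF Suc.prems] by auto
  obtain r where r: "\<And>j. j < n \<Longrightarrow> spherical_eigenfunction (?\<mu> j) (r j)"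
    and w_eq: "\<And>x. x \<in> sphere 0 1 \<Longrightarrow> w x = (\<Sum>j<n. r j x)"
    using Suc.IH[OF w(1)] by blast
  have gap: "?\<mu> j - ?\<mu> n \<noteq> 0" if "j < n" for j
    using sphere_eigenvalue_less[of "real CARD('n)" j n] d that by simp
  define c where "c j = 1 / (?\<mu> j - ?\<mu> n)" for j
  have r_poly: "\<exists>n. poly_below n (r j)" if "j < n" for j
    using r[OF that] by (simp add: spherical_eigenfunction_def)
  define s where "s x = (\<Sum>j<n. c j * r j x)" for x
  have "\<exists>N. \<forall>j<n. poly_below N (r j)"
  proof -
    obtain N where "\<And>j. j < n \<Longrightarrow> poly_below (N j) (r j)"
      using r_poly by metis
    then show ?thesis
      by (intro exI[of _ "\<Sum>j<n. N j"]) (meson finite_lessThan lessThan_iff member_le_sum poly_below_mono zero_le)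
  qed
  then obtain N where N: "\<And>j. j < n \<Longrightarrow> poly_below N (r j)"
    by blast
  have s_poly: "poly_below N s"
    unfolding s_def by (intro poly_below_sum poly_below_cmult N) simp
  define t where "t x = p x - s x" for x
  have t_poly: "poly_below (max (Suc n) N) t"
    unfolding t_def by (intro poly_below_diff poly_below_mono[OF Suc.prems] poly_below_mono[OF s_poly]) auto
  have lap_s: "slaplace s x = (\<Sum>j<n. c j * slaplace (r j) x)" for x
    unfolding s_def by (rule slaplace_linear_combination) (use r_poly in auto)
  have lap_t: "slaplace t x = slaplace p x - slaplace s x" for x
  proof -
    have "slaplace (\<lambda>x. \<Sum>b\<in>{True, False}. (if b then 1 else -1) * (if b then p else s) x) x
        = (\<Sum>b\<in>{True, False}. (if b then 1 else -1) * slaplace (if b then p else s) x)"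
      by (rule slaplace_linear_combination) (use Suc.prems s_poly in auto)
    then show ?thesis
      by (simp add: t_def[abs_def])
  qed
  have "- slaplace t x = ?\<mu> n * t x" if x: "x \<in> sphere 0 1" for x
  proof -
    have "- slaplace s x = (\<Sum>j<n. c j * (?\<mu> j * r j x))"
    proof -
      have "- slaplace s x = (\<Sum>j<n. c j * (- slaplace (r j) x))"
        by (simp add: lap_s sum_negf)
      also have "\<dots> = (\<Sum>j<n. c j * (?\<mu> j * r j x))"
        using r x unfolding spherical_eigenfunction_def by (intro sum.cong) auto
      finally show ?thesis .
    qed
    also have "\<dots> = (\<Sum>j<n. r j x + ?\<mu> n * (c j * r j x))"
    proof (rule sum.cong[OF refl])
      fix j assume "j \<in> {..<n}"
      then have "c j * (?\<mu> j - ?\<mu> n) = 1"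
        using gap by (simp add: c_def)
      moreover have "c j * (?\<mu> j * r j x) = c j * (?\<mu> j - ?\<mu> n) * r j x + ?\<mu> n * (c j * r j x)"
        by (simp add: algebra_simps)
      ultimately show "c j * (?\<mu> j * r j x) = r j x + ?\<mu> n * (c j * r j x)"
        by simp
    qed
    also have "\<dots> = w x + ?\<mu> n * s x"
      by (simp add: sum.distrib sum_distrib_left s_def w_eq[OF x])
    finally show ?thesis
      using w(2)[OF x] by (simp add: lap_t t_def algebra_simps)
  qed
  then have t: "spherical_eigenfunction (?\<mu> n) t"
    using t_poly unfolding spherical_eigenfunction_def by blast
  define q where "q j = (if j < n then (\<lambda>x. c j * r j x) else t)" for j
  have "spherical_eigenfunction (?\<mu> j) (\<lambda>x. c j * r j x)" if "j < n" for j
  proof -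
    have "slaplace (\<lambda>x. \<Sum>i\<in>{j}. c i * r i x) x = (\<Sum>i\<in>{j}. c i * slaplace (r i) x)" for x
      by (rule slaplace_linear_combination) (use r_poly that in auto)
    then have lap: "slaplace (\<lambda>x. c j * r j x) x = c j * slaplace (r j) x" for x
      by simp
    have "- slaplace (\<lambda>x. c j * r j x) x = ?\<mu> j * (c j * r j x)" if "x \<in> sphere 0 1" for x
    proof -
      have "- slaplace (\<lambda>x. c j * r j x) x = c j * (- slaplace (r j) x)"
        by (simp add: lap)
      also have "- slaplace (r j) x = ?\<mu> j * r j x"
        using r[OF \<open>j < n\<close>] that unfolding spherical_eigenfunction_def by blast
      finally show ?thesis
        by (simp add: mult.left_commute)
    qed
    then show ?thesis
      using r_poly[OF that] poly_below_cmult unfolding spherical_eigenfunction_def by blast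
  qed
  then have "\<forall>j<Suc n. spherical_eigenfunction (?\<mu> j) (q j)"
    using t by (auto simp: q_def less_Suc_eq)
  moreover have "p x = (\<Sum>j<Suc n. q j x)" for x
    by (simp add: q_def t_def s_def)
  ultimately show ?case
    by blast
qed

subsection \<open>Density in the square integrable functions\<close>

lemma poly_L2_closure:
  "L2_closure sphere_measure {p. \<exists>n. poly_below n p} = L2 (sphere_measure :: (real ^ 'n) measure)"
proof (rule uniformly_dense_imp_L2_dense)
  let ?V = "{p :: real ^ 'n \<Rightarrow> real. \<exists>n. poly_below n p}"
  have add: "(\<lambda>x. p x + q x) \<in> ?V" if "p \<in> ?V" "q \<in> ?V" for p q
  proof -
    obtain m n where mn: "poly_below m p" "poly_below n q"
      using \<open>p \<in> ?V\<close> \<open>q \<in> ?V\<close> by blast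
    then have "poly_below (max m n) (\<lambda>x. p x + q x)"
      by (intro poly_below.add poly_below_mono[OF mn(1)] poly_below_mono[OF mn(2)]) auto
    then show ?thesis by blast
  qed
  then show "(\<lambda>x. p x + q x) \<in> ?V" if "p \<in> ?V" "q \<in> ?V" for p q
    using that by blast
  show "finite_measure (sphere_measure :: (real ^ 'n) measure)"
    by (rule finite_measure_sphere_measure)
  show "sets (sphere_measure :: (real ^ 'n) measure) = sets (restrict_space borel (sphere 0 1))"
    by (rule sets_sphere_measure)
  show "?V \<subseteq> L2 sphere_measure"
    using poly_below_smooth smooth_L2 by blast
  show "(\<lambda>x. c * p x) \<in> ?V" if "p \<in> ?V" for p c
    using that poly_below_cmult by blast
  show "(\<lambda>_. 0) \<in> ?V"
    using poly_below_zero by blast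
  interpret function_ring_on ?V "sphere (0 :: real ^ 'n) 1"
  proof
    show "(\<lambda>x. p x * q x) \<in> ?V" if "p \<in> ?V" "q \<in> ?V" for p q
      using that poly_below_mult by blast
    show "(\<lambda>_. c) \<in> ?V" for c
      using poly_below.const by blast
    show "continuous_on (sphere 0 1) p" if "p \<in> ?V" for p
      using that poly_below_smooth smooth_continuous continuous_on_subset[of UNIV p "sphere 0 1"] by blast
    fix x y :: "real ^ 'n" assume "x \<noteq> y"
    then obtain j where "x $ j \<noteq> y $ j"
      by (auto simp: vec_eq_iff)
    moreover have "poly_below 2 (\<lambda>x :: real ^ 'n. x $ j * 1)"
      unfolding numeral_2_eq_2 by (intro poly_below.coordinate poly_below.const)
    ultimately show "\<exists>f\<in>?V. f x \<noteq> f y"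
      by (intro bexI[of _ "\<lambda>x. x $ j * 1"]) auto
  qed (use add in auto)
  show "\<exists>q\<in>?V. \<forall>x\<in>sphere 0 1. \<bar>f x - q x\<bar> \<le> e" if "continuous_on (sphere 0 1) f" "0 < e" for f e
    using Stone_Weierstrass_basic[OF that] by (meson less_imp_le)
qed simp

section \<open>Weak derivatives\<close>

lemma L2_orthogonal_polynomials:
  fixes h :: "real ^ 'n \<Rightarrow> real"
  assumes h: "h \<in> L2 sphere_measure"
    and orth: "\<And>n q. poly_below n q \<Longrightarrow> (\<integral>x. h x * q x \<partial>sphere_measure) = 0"
  shows "AE x in sphere_measure. h x = 0"
proof -
  let ?M = "sphere_measure :: (real ^ 'n) measure"
  have "(L2_norm ?M h)\<^sup>2 \<le> 0"
  proof (rule field_le_epsilon)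
    fix e :: real assume "0 < e"
    have pos: "0 < L2_norm ?M h + 1"
      using L2_norm_nonneg[of ?M h] by linarith
    have "h \<in> L2_closure ?M {p. \<exists>n. poly_below n p}"
      unfolding poly_L2_closure by (rule h)
    then obtain q where q: "q \<in> {p. \<exists>n. poly_below n p}" "L2_norm ?M (\<lambda>x. h x - q x) < e / (L2_norm ?M h + 1)"
      using L2_closureD[OF _ divide_pos_pos[OF \<open>0 < e\<close> pos]] by blast
    have qL2: "q \<in> L2 ?M"
      using q(1) poly_below_smooth smooth_L2 by blast
    have "(\<integral>x. h x * q x \<partial>?M) = 0"
      using q(1) orth by blast
    then have "(L2_norm ?M h)\<^sup>2 = (\<integral>x. h x * h x \<partial>?M) - (\<integral>x. h x * q x \<partial>?M)"
      unfolding L2_norm_square by (simp add: power2_eq_square)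
    also have "\<dots> = (\<integral>x. h x * (h x - q x) \<partial>?M)"
      by (subst Bochner_Integration.integral_diff[symmetric])
        (simp_all add: L2_integrable_mult h qL2 algebra_simps)
    also have "\<dots> \<le> L2_norm ?M h * L2_norm ?M (\<lambda>x. h x - q x)"
      using L2_Cauchy_Schwarz[OF h L2_diff[OF h qL2]] by linarith
    also have "\<dots> \<le> (L2_norm ?M h + 1) * L2_norm ?M (\<lambda>x. h x - q x)"
      by (intro mult_right_mono L2_norm_nonneg) simp
    also have "\<dots> \<le> (L2_norm ?M h + 1) * (e / (L2_norm ?M h + 1))"
      using q(2) pos by (intro mult_left_mono) auto
    also have "\<dots> = e"
      using pos by simp
    finally show "(L2_norm ?M h)\<^sup>2 \<le> 0 + e"
      by simp
  qed
  then have "(\<integral>x. (h x)\<^sup>2 \<partial>?M) = 0"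
    unfolding L2_norm_square[symmetric] by simp
  then show ?thesis
    using L2_AE_zero_iff[OF h] by simp
qed

lemma weak_tderivD:
  assumes "weak_tderiv i u g" "smooth (\<phi> :: real ^ 'n \<Rightarrow> real)"
  shows "(\<integral>x. u x * sderiv i \<phi> x \<partial>sphere_measure) =
    - (\<integral>x. g x * \<phi> x \<partial>sphere_measure) + (real CARD('n) - 1) * (\<integral>x. u x * \<phi> x * x $ i \<partial>sphere_measure)"
proof -
  obtain G where G: "C1_with_gradient \<phi> G"
    using assms(2) unfolding smooth_def by blast
  show ?thesis
    using assms(1) G unfolding weak_tderiv_def sderiv_eq[OF G] by blast
qed

lemma weak_tderiv_unique:
  fixes u :: "real ^ 'n \<Rightarrow> real"
  assumes "weak_tderiv i u g" "weak_tderiv i u h" "g \<in> L2 sphere_measure" "h \<in> L2 sphere_measure"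
  shows "AE x in sphere_measure. g x = h x"
proof -
  have "AE x in sphere_measure. g x - h x = 0"
  proof (rule L2_orthogonal_polynomials)
    fix n and q :: "real ^ 'n \<Rightarrow> real" assume "poly_below n q"
    then have q: "smooth q" by (rule poly_below_smooth)
    have "(\<integral>x. (g x - h x) * q x \<partial>sphere_measure) = (\<integral>x. g x * q x \<partial>sphere_measure) - (\<integral>x. h x * q x \<partial>sphere_measure)"
      by (subst Bochner_Integration.integral_diff[symmetric])
        (simp_all add: L2_integrable_mult assms smooth_L2 q algebra_simps)
    then show "(\<integral>x. (g x - h x) * q x \<partial>sphere_measure) = 0"
      using weak_tderivD[OF assms(1) q] weak_tderivD[OF assms(2) q] by linarith
  qed (intro L2_diff assms)
  then show ?thesis by simp
qed

lemma weak_tderiv_smooth: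
  fixes f :: "real ^ 'n \<Rightarrow> real"
  assumes f: "smooth f"
  shows "weak_tderiv i f (sderiv i f)"
  unfolding weak_tderiv_def
proof (intro allI impI)
  fix \<phi> :: "real ^ 'n \<Rightarrow> real" and G assume G: "C1_with_gradient \<phi> G"
  then have \<phi>: "smooth \<phi>" unfolding smooth_def by blast
  obtain H where H: "C1_with_gradient (\<lambda>x. f x * \<phi> x) H"
    using smooth_mult[OF f \<phi>] unfolding smooth_def by blast
  have "(\<integral>x. f x * sderiv i \<phi> x \<partial>sphere_measure) + (\<integral>x. sderiv i f x * \<phi> x \<partial>sphere_measure)
      = (\<integral>x. sderiv i (\<lambda>x. f x * \<phi> x) x \<partial>sphere_measure)"
    unfolding sderiv_mult[OF f \<phi>]
    by (subst Bochner_Integration.integral_add[symmetric])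
      (simp_all add: L2_integrable_mult smooth_L2 sderiv_L2 f \<phi> mult.commute)
  also have "\<dots> = (real CARD('n) - 1) * (\<integral>x. f x * \<phi> x * x $ i \<partial>sphere_measure)"
    unfolding sderiv_eq[OF H] by (rule divergence_sphere[OF H])
  finally show "(\<integral>x. f x * (tangential x (G x) $ i) \<partial>sphere_measure) =
      - (\<integral>x. sderiv i f x * \<phi> x \<partial>sphere_measure) + (real CARD('n) - 1) * (\<integral>x. f x * \<phi> x * x $ i \<partial>sphere_measure)"
    unfolding sderiv_eq[OF G] by linarith
qed

lemma weak_tderiv_add:
  fixes u v :: "real ^ 'n \<Rightarrow> real"
  assumes "weak_tderiv i u g" "weak_tderiv i v h"
    and L2: "u \<in> L2 sphere_measure" "v \<in> L2 sphere_measure" "g \<in> L2 sphere_measure" "h \<in> L2 sphere_measure"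
  shows "weak_tderiv i (\<lambda>x. u x + v x) (\<lambda>x. g x + h x)"
  unfolding weak_tderiv_def
proof (intro allI impI)
  fix \<phi> :: "real ^ 'n \<Rightarrow> real" and G assume G: "C1_with_gradient \<phi> G"
  then have \<phi>: "smooth \<phi>" unfolding smooth_def by blast
  have add: "(\<integral>x. (f x + f' x) * k x \<partial>sphere_measure) = (\<integral>x. f x * k x \<partial>sphere_measure) + (\<integral>x. f' x * k x \<partial>sphere_measure)"
    if "f \<in> L2 sphere_measure" "f' \<in> L2 sphere_measure" "k \<in> L2 sphere_measure" for f f' k :: "real ^ 'n \<Rightarrow> real"
    using that by (subst Bochner_Integration.integral_add[symmetric]) (simp_all add: L2_integrable_mult algebra_simps)
  have "(\<lambda>x. \<phi> x * x $ i) \<in> L2 sphere_measure"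
    by (intro smooth_L2 smooth_mult smooth_coordinate \<phi>)
  from add[OF L2(1,2) this]
  have "(\<integral>x. (u x + v x) * \<phi> x * x $ i \<partial>sphere_measure)
      = (\<integral>x. u x * \<phi> x * x $ i \<partial>sphere_measure) + (\<integral>x. v x * \<phi> x * x $ i \<partial>sphere_measure)"
    by (simp add: mult.assoc)
  then show "(\<integral>x. (u x + v x) * (tangential x (G x) $ i) \<partial>sphere_measure) =
      - (\<integral>x. (g x + h x) * \<phi> x \<partial>sphere_measure) + (real CARD('n) - 1) * (\<integral>x. (u x + v x) * \<phi> x * x $ i \<partial>sphere_measure)"
    unfolding sderiv_eq[OF G, symmetric]
    using weak_tderivD[OF assms(1) \<phi>] weak_tderivD[OF assms(2) \<phi>]
    by (simp add: add L2 smooth_L2 sderiv_L2 \<phi> distrib_left)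
qed

lemma H1_L2: "u \<in> H1 \<Longrightarrow> u \<in> L2 sphere_measure"
  by (simp add: H1_def)

lemma H1_tderiv:
  assumes "u \<in> H1"
  shows "tderiv i u \<in> L2 sphere_measure" "weak_tderiv i u (tderiv i u)"
proof -
  have "\<exists>g. g \<in> L2 sphere_measure \<and> weak_tderiv i u g"
    using assms by (auto simp: H1_def)
  from someI_ex[OF this] show "tderiv i u \<in> L2 sphere_measure" "weak_tderiv i u (tderiv i u)"
    by (simp_all add: tderiv_def)
qed

lemma H1_add_smooth:
  fixes u w :: "real ^ 'n \<Rightarrow> real"
  assumes u: "u \<in> H1" and w: "smooth w"
  shows "(\<lambda>x. u x + w x) \<in> H1"
    and "AE x in sphere_measure. tderiv i (\<lambda>x. u x + w x) x = tderiv i u x + sderiv i w x"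
proof -
  have weak: "weak_tderiv i (\<lambda>x. u x + w x) (\<lambda>x. tderiv i u x + sderiv i w x)" for i
    by (intro weak_tderiv_add H1_tderiv u weak_tderiv_smooth w smooth_L2 sderiv_L2 H1_L2)
  have L2: "(\<lambda>x. tderiv i u x + sderiv i w x) \<in> L2 sphere_measure" for i
    by (intro L2_add H1_tderiv u sderiv_L2 w)
  show H1: "(\<lambda>x. u x + w x) \<in> H1"
    unfolding H1_def using weak L2 by (blast intro: L2_add H1_L2[OF u] smooth_L2[OF w])
  show "AE x in sphere_measure. tderiv i (\<lambda>x. u x + w x) x = tderiv i u x + sderiv i w x"
    by (rule weak_tderiv_unique[OF H1_tderiv(2)[OF H1] weak H1_tderiv(1)[OF H1] L2])
qed

text \<open>
  The weak gradient is orthogonal to the position vector. This follows by testing \<open>D\<^sub>i u\<close> with \<open>\<phi> x\<^sub>i\<close>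
  and summing over \<open>i\<close>: the derivatives of \<open>x\<^sub>i\<close> contribute \<open>d - 1\<close>, which cancels the curvature term.
\<close>

lemma weak_tderiv_radial:
  fixes u \<phi> :: "real ^ 'n \<Rightarrow> real" and g :: "'n \<Rightarrow> real ^ 'n \<Rightarrow> real"
  assumes u: "u \<in> L2 sphere_measure" and g: "\<And>i. weak_tderiv i u (g i)" and \<phi>: "smooth \<phi>"
  shows "(\<Sum>i\<in>UNIV. \<integral>x. g i x * \<phi> x * x $ i \<partial>sphere_measure) = 0"
proof -
  let ?M = "sphere_measure :: (real ^ 'n) measure" and ?d = "real CARD('n)"
  have \<phi>x: "smooth (\<lambda>x. \<phi> x * x $ i)" for i
    by (intro smooth_mult \<phi> smooth_coordinate)
  have int1: "integrable ?M (\<lambda>x. u x * (\<phi> x * x $ i) * x $ i)" for i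
    using L2_integrable_mult[OF u smooth_L2[OF smooth_mult[OF \<phi>x smooth_coordinate]], of i i]
    by (simp add: mult.assoc)
  have int2: "integrable ?M (\<lambda>x. u x * sderiv i (\<lambda>x. \<phi> x * x $ i) x)" for i
    by (intro L2_integrable_mult u sderiv_L2 \<phi>x)
  have "(\<integral>x. g i x * \<phi> x * x $ i \<partial>?M)
      = (\<integral>x. (?d - 1) * (u x * (\<phi> x * x $ i) * x $ i) - u x * sderiv i (\<lambda>x. \<phi> x * x $ i) x \<partial>?M)" for i
    using weak_tderivD[OF g \<phi>x, of i i] int1[of i] int2[of i] by (simp add: mult.assoc)
  then have "(\<Sum>i\<in>UNIV. \<integral>x. g i x * \<phi> x * x $ i \<partial>?M)
      = (\<integral>x. (\<Sum>i\<in>UNIV. (?d - 1) * (u x * (\<phi> x * x $ i) * x $ i) - u x * sderiv i (\<lambda>x. \<phi> x * x $ i) x) \<partial>?M)"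
    using int1 int2 by (simp add: Bochner_Integration.integral_sum)
  also have "\<dots> = (\<integral>x. 0 \<partial>?M)"
  proof (rule Bochner_Integration.integral_cong[OF refl])
    fix x assume "x \<in> space ?M"
    then have x: "x \<in> sphere 0 1" by simp
    have "(\<Sum>i\<in>UNIV. (?d - 1) * (u x * (\<phi> x * x $ i) * x $ i) - u x * sderiv i (\<lambda>x. \<phi> x * x $ i) x)
        = (\<Sum>i\<in>UNIV. ((?d - 1) * (u x * \<phi> x)) * (x $ i)\<^sup>2 - (u x * \<phi> x) * (1 - (x $ i)\<^sup>2) - u x * (x $ i * sderiv i \<phi> x))"
      by (intro sum.cong refl) (simp add: sderiv_mult[OF \<phi> smooth_coordinate] sderiv_coordinate power2_eq_square algebra_simps)
    also have "\<dots> = (?d - 1) * (u x * \<phi> x) * (\<Sum>i\<in>UNIV. (x $ i)\<^sup>2) - (u x * \<phi> x) * (?d - (\<Sum>i\<in>UNIV. (x $ i)\<^sup>2))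
        - u x * (\<Sum>i\<in>UNIV. x $ i * sderiv i \<phi> x)"
      by (simp add: sum_subtractf flip: sum_distrib_left)
    also have "\<dots> = 0"
      unfolding sum_squares_coordinates_sphere[OF x] sderiv_radial[OF \<phi> x] by (simp add: algebra_simps)
    finally show "(\<Sum>i\<in>UNIV. (?d - 1) * (u x * (\<phi> x * x $ i) * x $ i) - u x * sderiv i (\<lambda>x. \<phi> x * x $ i) x) = 0" .
  qed
  finally show ?thesis by simp
qed

lemma H2_H1: "u \<in> H2 \<Longrightarrow> u \<in> H1" "u \<in> H2 \<Longrightarrow> tderiv i u \<in> H1"
  by (auto simp: H2_def)

lemma laplace_beltrami_L2: "u \<in> H2 \<Longrightarrow> laplace_beltrami u \<in> L2 sphere_measure"
  unfolding laplace_beltrami_def[abs_def] by (intro L2_sum H1_tderiv H2_H1)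

lemma grad_F_th_L2: "u \<in> H2 \<Longrightarrow> grad_F_th lam u \<in> L2 sphere_measure"
  unfolding grad_F_th_def[abs_def] by (intro L2_diff L2_uminus L2_cmult laplace_beltrami_L2 H1_L2 H2_H1)

text \<open>
  The curvature terms of the integrations by parts add up to zero by \<open>weak_tderiv_radial\<close>.
\<close>

lemma weak_laplacian_smooth:
  fixes u \<phi> :: "real ^ 'n \<Rightarrow> real" and g h :: "'n \<Rightarrow> real ^ 'n \<Rightarrow> real"
  assumes u: "u \<in> L2 sphere_measure" and g: "\<And>i. weak_tderiv i u (g i)"
    and h: "\<And>i. weak_tderiv i (g i) (h i)" "\<And>i. h i \<in> L2 sphere_measure" and \<phi>: "smooth \<phi>"
  shows "(\<integral>x. (\<Sum>i\<in>UNIV. h i x) * \<phi> x \<partial>sphere_measure) = - (\<Sum>i\<in>UNIV. \<integral>x. g i x * sderiv i \<phi> x \<partial>sphere_measure)"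
proof -
  let ?M = "sphere_measure :: (real ^ 'n) measure" and ?d = "real CARD('n)"
  have "(\<integral>x. (\<Sum>i\<in>UNIV. h i x) * \<phi> x \<partial>?M) = (\<Sum>i\<in>UNIV. \<integral>x. h i x * \<phi> x \<partial>?M)"
    unfolding sum_distrib_right
    by (intro Bochner_Integration.integral_sum L2_integrable_mult h(2) smooth_L2 \<phi>)
  also have "\<dots> = (\<Sum>i\<in>UNIV. (?d - 1) * (\<integral>x. g i x * \<phi> x * x $ i \<partial>?M) - (\<integral>x. g i x * sderiv i \<phi> x \<partial>?M))"
  proof (rule sum.cong[OF refl])
    fix i
    show "(\<integral>x. h i x * \<phi> x \<partial>?M)
        = (?d - 1) * (\<integral>x. g i x * \<phi> x * x $ i \<partial>?M) - (\<integral>x. g i x * sderiv i \<phi> x \<partial>?M)"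
      using weak_tderivD[OF h(1) \<phi>, of i] by linarith
  qed
  also have "\<dots> = (?d - 1) * (\<Sum>i\<in>UNIV. \<integral>x. g i x * \<phi> x * x $ i \<partial>?M) - (\<Sum>i\<in>UNIV. \<integral>x. g i x * sderiv i \<phi> x \<partial>?M)"
    by (simp add: sum_subtractf sum_distrib_left)
  finally show ?thesis
    unfolding weak_tderiv_radial[OF u g \<phi>] by simp
qed

text \<open>
  A second integration by parts, with the test functions \<open>D\<^sub>i q\<close>, moves all derivatives to \<open>q\<close>.
\<close>

lemma weak_laplacian_polynomial:
  fixes u q :: "real ^ 'n \<Rightarrow> real" and g h :: "'n \<Rightarrow> real ^ 'n \<Rightarrow> real"
  assumes u: "u \<in> L2 sphere_measure" and g: "\<And>i. weak_tderiv i u (g i)"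
    and h: "\<And>i. weak_tderiv i (g i) (h i)" "\<And>i. h i \<in> L2 sphere_measure" and q: "poly_below n q"
  shows "(\<integral>x. (\<Sum>i\<in>UNIV. h i x) * q x \<partial>sphere_measure) = (\<integral>x. u x * slaplace q x \<partial>sphere_measure)"
proof -
  let ?M = "sphere_measure :: (real ^ 'n) measure" and ?d = "real CARD('n)"
  have sm: "smooth q" "smooth (sderiv i q)" "smooth (sderiv i (sderiv i q))" for i
    using poly_below_smooth poly_below_sderiv q by metis+
  have int: "integrable ?M (\<lambda>x. u x * sderiv i q x * x $ i)" for i
    using L2_integrable_mult[OF u smooth_L2[OF smooth_mult[OF sm(2) smooth_coordinate]], of i i] by (simp add: mult.assoc)
  have "(\<Sum>i\<in>UNIV. \<integral>x. u x * sderiv i q x * x $ i \<partial>?M) = (\<integral>x. (\<Sum>i\<in>UNIV. u x * sderiv i q x * x $ i) \<partial>?M)"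
    using int by (simp add: Bochner_Integration.integral_sum)
  also have "\<dots> = (\<integral>x. 0 \<partial>?M)"
  proof (rule Bochner_Integration.integral_cong[OF refl])
    fix x assume "x \<in> space ?M"
    then have x: "x \<in> sphere 0 1" by simp
    have "(\<Sum>i\<in>UNIV. u x * sderiv i q x * x $ i) = u x * (\<Sum>i\<in>UNIV. x $ i * sderiv i q x)"
      by (simp add: sum_distrib_left mult.assoc mult.commute[of "_ $ _"])
    then show "(\<Sum>i\<in>UNIV. u x * sderiv i q x * x $ i) = 0"
      unfolding sderiv_radial[OF sm(1) x] by simp
  qed
  finally have zero: "(\<Sum>i\<in>UNIV. \<integral>x. u x * sderiv i q x * x $ i \<partial>?M) = 0"
    by simp
  have "(\<integral>x. u x * slaplace q x \<partial>?M) = (\<Sum>i\<in>UNIV. \<integral>x. u x * sderiv i (sderiv i q) x \<partial>?M)"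
    unfolding slaplace_def sum_distrib_left
    by (intro Bochner_Integration.integral_sum L2_integrable_mult u smooth_L2 sm)
  also have "\<dots> = (\<Sum>i\<in>UNIV. - (\<integral>x. g i x * sderiv i q x \<partial>?M) + (?d - 1) * (\<integral>x. u x * sderiv i q x * x $ i \<partial>?M))"
    by (intro sum.cong refl weak_tderivD g sm)
  also have "\<dots> = - (\<Sum>i\<in>UNIV. \<integral>x. g i x * sderiv i q x \<partial>?M)"
    by (simp only: sum.distrib sum_negf sum_distrib_left[symmetric] zero)
  finally show ?thesis
    unfolding weak_laplacian_smooth[OF u g h sm(1)] by simp
qed

text \<open>
  The derivatives of a polynomial are also its weak derivatives.
\<close>

lemma slaplace_symmetric:
  assumes p: "poly_below m p" and q: "poly_below n q"
  shows "(\<integral>x. slaplace p x * q x \<partial>sphere_measure) = (\<integral>x. p x * slaplace q x \<partial>sphere_measure)"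
  unfolding slaplace_def[of p]
proof (rule weak_laplacian_polynomial[OF _ _ _ _ q])
  have "smooth p" "smooth (sderiv i p)" "smooth (sderiv i (sderiv i p))" for i
    using poly_below_smooth poly_below_sderiv p by metis+
  then show "p \<in> L2 sphere_measure" "weak_tderiv i p (sderiv i p)"
    "weak_tderiv i (sderiv i p) (sderiv i (sderiv i p))" "sderiv i (sderiv i p) \<in> L2 sphere_measure" for i
    by (simp_all add: smooth_L2 weak_tderiv_smooth)
qed

lemma integral_laplace_beltrami_smooth:
  fixes u \<phi> :: "real ^ 'n \<Rightarrow> real"
  assumes u: "u \<in> H2" and \<phi>: "smooth \<phi>"
  shows "(\<integral>x. laplace_beltrami u x * \<phi> x \<partial>sphere_measure) = - (\<Sum>i\<in>UNIV. \<integral>x. tderiv i u x * sderiv i \<phi> x \<partial>sphere_measure)"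
  unfolding laplace_beltrami_def
  by (rule weak_laplacian_smooth[where h = "\<lambda>i. tderiv i (tderiv i u)", OF H1_L2[OF H2_H1(1)[OF u]]
      H1_tderiv(2)[OF H2_H1(1)[OF u]] H1_tderiv(2)[OF H2_H1(2)[OF u]] H1_tderiv(1)[OF H2_H1(2)[OF u]] \<phi>])

lemma integral_laplace_beltrami_polynomial:
  fixes u q :: "real ^ 'n \<Rightarrow> real"
  assumes u: "u \<in> H2" and q: "poly_below n q"
  shows "(\<integral>x. laplace_beltrami u x * q x \<partial>sphere_measure) = (\<integral>x. u x * slaplace q x \<partial>sphere_measure)"
  unfolding laplace_beltrami_def
  by (rule weak_laplacian_polynomial[where h = "\<lambda>i. tderiv i (tderiv i u)", OF H1_L2[OF H2_H1(1)[OF u]]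
      H1_tderiv(2)[OF H2_H1(1)[OF u]] H1_tderiv(2)[OF H2_H1(2)[OF u]] H1_tderiv(1)[OF H2_H1(2)[OF u]] q])

text \<open>
  The approximating sequence \<open>\<phi>\<^sub>n\<close> from the definition of the trace converges to \<open>u\<close> together with
  its gradients, so that \<open>\<integral> \<nabla>u \<sqdot> \<nabla>\<phi>\<^sub>n = - \<integral> \<phi>\<^sub>n \<Delta>u\<close> passes to the limit.
\<close>

lemma F_th_eq:
  fixes u :: "real ^ 'n \<Rightarrow> real"
  assumes u: "u \<in> H2" and trace: "is_trace k u T"
  shows "F_th lam u = 1 / 2 * (\<integral>x. u x * grad_F_th lam u x \<partial>sphere_measure)"
proof -
  let ?M = "sphere_measure :: (real ^ 'n) measure"
  have uL2: "u \<in> L2 ?M"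
    by (rule H1_L2[OF H2_H1(1)[OF u]])
  have gL2: "tderiv i u \<in> L2 ?M" for i
    by (intro H1_tderiv H2_H1 u)
  obtain \<phi> G where C1: "\<And>n. C1_with_gradient (\<phi> n) (G n)"
    and lim: "(\<lambda>n. L2_norm ?M (\<lambda>x. \<phi> n x - u x)) \<longlonglongrightarrow> 0"
    and lim': "(\<lambda>n. L2_norm ?M (\<lambda>x. norm (tangential x (G n x) - tgrad u x))) \<longlonglongrightarrow> 0"
    using trace unfolding is_trace_def by blast
  have \<phi>: "smooth (\<phi> n)" for n
    using C1 unfolding smooth_def by blast
  have grad: "tangential x (G n x) - tgrad u x = (\<chi> i. sderiv i (\<phi> n) x - tderiv i u x)" for n x
    by (simp add: vec_eq_iff tgrad_def sderiv_eq[OF C1])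
  have lim_i: "(\<lambda>n. L2_norm ?M (\<lambda>x. sderiv i (\<phi> n) x - tderiv i u x)) \<longlonglongrightarrow> 0" for i
  proof (rule tendsto_sandwich[OF _ _ tendsto_const lim'])
    show "\<forall>\<^sub>F n in sequentially. 0 \<le> L2_norm ?M (\<lambda>x. sderiv i (\<phi> n) x - tderiv i u x)"
      by (simp add: L2_norm_nonneg)
    have L2: "(\<lambda>x. sderiv j (\<phi> n) x - tderiv j u x) \<in> L2 ?M" for j n
      by (intro L2_diff sderiv_L2 \<phi> gL2)
    have "L2_norm ?M (\<lambda>x. sderiv i (\<phi> n) x - tderiv i u x) \<le> L2_norm ?M (\<lambda>x. norm (tangential x (G n x) - tgrad u x))" for n
      unfolding L2_norm_def
    proof (intro real_sqrt_le_mono integral_mono)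
      have sq: "(norm (tangential x (G n x) - tgrad u x))\<^sup>2 = (\<Sum>j\<in>UNIV. (sderiv j (\<phi> n) x - tderiv j u x)\<^sup>2)" for x
        unfolding grad by (simp add: norm_vec_def L2_set_def sum_nonneg)
      show "integrable ?M (\<lambda>x. (sderiv i (\<phi> n) x - tderiv i u x)\<^sup>2)"
        by (rule L2_integrable_square[OF L2])
      show "integrable ?M (\<lambda>x. (norm (tangential x (G n x) - tgrad u x))\<^sup>2)"
        unfolding sq by (intro Bochner_Integration.integrable_sum L2_integrable_square L2)
      show "(sderiv i (\<phi> n) x - tderiv i u x)\<^sup>2 \<le> (norm (tangential x (G n x) - tgrad u x))\<^sup>2" for x
        unfolding sq by (rule member_le_sum) auto
    qed
    then show "\<forall>\<^sub>F n in sequentially. L2_norm ?M (\<lambda>x. sderiv i (\<phi> n) x - tderiv i u x)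
        \<le> L2_norm ?M (\<lambda>x. norm (tangential x (G n x) - tgrad u x))"
      by simp
  qed
  have "(\<lambda>n. - (\<Sum>i\<in>UNIV. \<integral>x. sderiv i (\<phi> n) x * tderiv i u x \<partial>?M)) \<longlonglongrightarrow> - (\<Sum>i\<in>UNIV. \<integral>x. tderiv i u x * tderiv i u x \<partial>?M)"
    by (intro tendsto_minus tendsto_sum L2_integral_tendsto lim_i sderiv_L2 \<phi> gL2)
  moreover have "- (\<Sum>i\<in>UNIV. \<integral>x. sderiv i (\<phi> n) x * tderiv i u x \<partial>?M) = (\<integral>x. \<phi> n x * laplace_beltrami u x \<partial>?M)" for n
    using integral_laplace_beltrami_smooth[OF u \<phi>, of n] by (simp add: mult.commute)
  moreover have "(\<lambda>n. \<integral>x. \<phi> n x * laplace_beltrami u x \<partial>?M) \<longlonglongrightarrow> (\<integral>x. u x * laplace_beltrami u x \<partial>?M)"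
    by (intro L2_integral_tendsto lim smooth_L2 \<phi> uL2 laplace_beltrami_L2 u)
  ultimately have "(\<integral>x. u x * laplace_beltrami u x \<partial>?M) = - (\<Sum>i\<in>UNIV. \<integral>x. (tderiv i u x)\<^sup>2 \<partial>?M)"
    unfolding power2_eq_square using LIMSEQ_unique by auto
  moreover have "(\<integral>x. (norm (tgrad u x))\<^sup>2 - lam * (u x)\<^sup>2 \<partial>?M) = (\<Sum>i\<in>UNIV. \<integral>x. (tderiv i u x)\<^sup>2 \<partial>?M) - lam * (\<integral>x. (u x)\<^sup>2 \<partial>?M)"
  proof -
    have sq: "(norm (tgrad u x))\<^sup>2 = (\<Sum>i\<in>UNIV. (tderiv i u x)\<^sup>2)" for x
      by (simp add: tgrad_def norm_vec_def L2_set_def sum_nonneg)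
    show ?thesis
      unfolding sq using L2_integrable_square[OF gL2] L2_integrable_square[OF uL2]
      by (simp add: Bochner_Integration.integral_sum)
  qed
  moreover have "(\<integral>x. u x * grad_F_th lam u x \<partial>?M) = - (\<integral>x. u x * laplace_beltrami u x \<partial>?M) - lam * (\<integral>x. (u x)\<^sup>2 \<partial>?M)"
  proof -
    have "(\<integral>x. u x * grad_F_th lam u x \<partial>?M) = (\<integral>x. - (u x * laplace_beltrami u x) - lam * (u x)\<^sup>2 \<partial>?M)"
      by (simp add: grad_F_th_def power2_eq_square algebra_simps)
    also have "\<dots> = - (\<integral>x. u x * laplace_beltrami u x \<partial>?M) - lam * (\<integral>x. (u x)\<^sup>2 \<partial>?M)"
      using L2_integrable_mult[OF uL2 laplace_beltrami_L2[OF u]] L2_integrable_square[OF uL2] by simp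
    finally show ?thesis .
  qed
  ultimately show ?thesis
    by (simp add: F_th_def)
qed

section \<open>The spectral inequality\<close>

lemma orthogonal_eigenfunctions:
  fixes p q :: "real ^ 'n \<Rightarrow> real"
  assumes p: "spherical_eigenfunction \<mu> p" and q: "spherical_eigenfunction \<nu> q" and "\<mu> \<noteq> \<nu>"
  shows "(\<integral>x. p x * q x \<partial>sphere_measure) = 0"
proof -
  let ?M = "sphere_measure :: (real ^ 'n) measure"
  obtain m n where mn: "poly_below m p" "poly_below n q"
    using p q unfolding spherical_eigenfunction_def by blast
  have p_eq: "slaplace p x = - \<mu> * p x" and q_eq: "slaplace q x = - \<nu> * q x" if "x \<in> sphere 0 1" for x
    using p q that unfolding spherical_eigenfunction_def by force+
  have "- \<mu> * (\<integral>x. p x * q x \<partial>?M) = (\<integral>x. slaplace p x * q x \<partial>?M)"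
    unfolding integral_mult_right_zero[symmetric]
    by (intro Bochner_Integration.integral_cong refl) (simp add: p_eq)
  also have "\<dots> = (\<integral>x. p x * slaplace q x \<partial>?M)"
    by (rule slaplace_symmetric[OF mn])
  also have "\<dots> = - \<nu> * (\<integral>x. p x * q x \<partial>?M)"
    unfolding integral_mult_right_zero[symmetric]
    by (intro Bochner_Integration.integral_cong refl) (simp add: q_eq)
  finally show ?thesis
    using \<open>\<mu> \<noteq> \<nu>\<close> by simp
qed

lemma integral_orthogonal_sum:
  fixes q :: "nat \<Rightarrow> 'a \<Rightarrow> real"
  assumes L2: "\<And>j. j < n \<Longrightarrow> q j \<in> L2 M"
    and orth: "\<And>i j. i < n \<Longrightarrow> j < n \<Longrightarrow> i \<noteq> j \<Longrightarrow> (\<integral>x. q i x * q j x \<partial>M) = 0"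
  shows "(\<integral>x. (\<Sum>i<n. a i * q i x) * (\<Sum>j<n. b j * q j x) \<partial>M) = (\<Sum>j<n. a j * b j * (\<integral>x. (q j x)\<^sup>2 \<partial>M))"
proof -
  have "(\<integral>x. (\<Sum>i<n. a i * q i x) * (\<Sum>j<n. b j * q j x) \<partial>M) = (\<integral>x. (\<Sum>i<n. \<Sum>j<n. a i * b j * (q i x * q j x)) \<partial>M)"
    by (simp add: sum_product algebra_simps)
  also have "\<dots> = (\<Sum>i<n. \<Sum>j<n. a i * b j * (\<integral>x. q i x * q j x \<partial>M))"
  proof -
    have int: "integrable M (\<lambda>x. a i * b j * (q i x * q j x))" if "i < n" "j < n" for i j
      using L2_integrable_mult[OF L2[OF that(1)] L2[OF that(2)]] by simp
    have "(\<integral>x. (\<Sum>i<n. \<Sum>j<n. a i * b j * (q i x * q j x)) \<partial>M) = (\<Sum>i<n. \<integral>x. (\<Sum>j<n. a i * b j * (q i x * q j x)) \<partial>M)"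
      using int by (intro Bochner_Integration.integral_sum Bochner_Integration.integrable_sum) simp
    also have "\<dots> = (\<Sum>i<n. \<Sum>j<n. \<integral>x. a i * b j * (q i x * q j x) \<partial>M)"
      using int by (intro sum.cong refl Bochner_Integration.integral_sum) simp
    finally show ?thesis by simp
  qed
  also have "\<dots> = (\<Sum>i<n. \<Sum>j<n. if j = i then a i * b i * (\<integral>x. (q i x)\<^sup>2 \<partial>M) else 0)"
    using orth by (intro sum.cong refl) (auto simp: power2_eq_square)
  finally show ?thesis
    by simp
qed

text \<open>
  The shift by one half keeps the denominator away from zero for every integer.
\<close>

lemma half_shift_multiplier:
  fixes k :: int
  shows "0 \<le> real_of_int k / (2 * real_of_int k - 1)" "real_of_int k / (2 * real_of_int k - 1) \<le> 1"
proof -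
  have "k \<le> 0 \<or> 1 \<le> k" by linarith
  then have *: "(real_of_int k \<le> 0) \<or> (1 \<le> real_of_int k)" by simp
  then show "0 \<le> real_of_int k / (2 * real_of_int k - 1)"
    by (auto intro: divide_nonneg_nonneg divide_nonpos_nonpos)
  show "real_of_int k / (2 * real_of_int k - 1) \<le> 1"
    using *
  proof
    assume "real_of_int k \<le> 0"
    then have "2 * real_of_int k - 1 < 0" "2 * real_of_int k - 1 \<le> real_of_int k"
      by linarith+
    then show ?thesis by (simp add: neg_divide_le_eq)
  next
    assume "1 \<le> real_of_int k"
    then have "0 < 2 * real_of_int k - 1" "real_of_int k \<le> 2 * real_of_int k - 1"
      by linarith+
    then show ?thesis by (simp add: pos_divide_le_eq)
  qed
qed

text \<open>
  Put \<open>z = 2g - u\<close>, so that the claim is \<open>\<integral> gz \<ge> 0\<close>. On an eigenfunction \<open>q\<^sub>j\<close> with integer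
  \<open>\<mu>\<^sub>j = j(j + d - 2) - \<lambda>\<close>, symmetry gives \<open>\<integral> g q\<^sub>j = \<mu>\<^sub>j \<integral> u q\<^sub>j\<close> and \<open>\<integral> z q\<^sub>j = (2\<mu>\<^sub>j - 1) \<integral> u q\<^sub>j\<close>, thus
  \<open>\<integral> g q\<^sub>j = t\<^sub>j \<integral> z q\<^sub>j\<close> with \<open>t\<^sub>j = \<mu>\<^sub>j / (2\<mu>\<^sub>j - 1)\<close> in \<open>[0, 1]\<close>. So \<open>g\<close> arises from \<open>z\<close> by the bounded
  nonnegative multiplier \<open>T\<close> with eigenvalues \<open>t\<^sub>j\<close>. For a polynomial \<open>p\<close> near \<open>z\<close> this reads
  \<open>\<integral> gp = \<integral> z Tp\<close>, which is close to \<open>\<integral> p Tp \<ge> 0\<close>.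
\<close>

lemma spectral_inequality:
  fixes u :: "real ^ 'n \<Rightarrow> real"
  assumes d: "2 \<le> CARD('n)" and u: "u \<in> H2" and lam: "lam = real_of_int l"
  shows "(\<integral>x. u x * grad_F_th lam u x \<partial>sphere_measure) \<le> 2 * (L2_norm sphere_measure (grad_F_th lam u))\<^sup>2"
proof -
  let ?M = "sphere_measure :: (real ^ 'n) measure" and ?g = "grad_F_th lam u"
  define ev where "ev j = int j * (int j + int CARD('n) - 2)" for j
  define k where "k j = ev j - l" for j
  have ev: "sphere_eigenvalue (real CARD('n)) (real j) = real_of_int (ev j)" for j
    by (simp add: sphere_eigenvalue_def ev_def)
  define z where "z x = 2 * ?g x - u x" for x
  have uL2: "u \<in> L2 ?M" and gL2: "?g \<in> L2 ?M"
    using u by (auto intro: H1_L2 H2_H1 grad_F_th_L2)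
  have zL2: "z \<in> L2 ?M"
    unfolding z_def[abs_def] by (intro L2_diff L2_cmult gL2 uL2)
  define t where "t j = real_of_int (k j) / (2 * real_of_int (k j) - 1)" for j
  have t: "0 \<le> t j" "t j \<le> 1" for j
    unfolding t_def by (rule half_shift_multiplier)+
  have eigen: "(\<integral>x. ?g x * q x \<partial>?M) = t j * (\<integral>x. z x * q x \<partial>?M)"
    if q: "spherical_eigenfunction (sphere_eigenvalue (real CARD('n)) (real j)) q" for j q
  proof -
    obtain n where n: "poly_below n q"
      using q unfolding spherical_eigenfunction_def by blast
    have qL2: "q \<in> L2 ?M"
      by (rule smooth_L2[OF poly_below_smooth[OF n]])
    have "(\<integral>x. ?g x * q x \<partial>?M) = (\<integral>x. - (laplace_beltrami u x * q x) - lam * (u x * q x) \<partial>?M)"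
      by (simp add: grad_F_th_def algebra_simps)
    also have "\<dots> = - (\<integral>x. laplace_beltrami u x * q x \<partial>?M) - lam * (\<integral>x. u x * q x \<partial>?M)"
      using L2_integrable_mult[OF laplace_beltrami_L2[OF u] qL2] L2_integrable_mult[OF uL2 qL2] by simp
    also have "(\<integral>x. laplace_beltrami u x * q x \<partial>?M) = (\<integral>x. u x * slaplace q x \<partial>?M)"
      by (rule integral_laplace_beltrami_polynomial[OF u n])
    also have "\<dots> = (\<integral>x. - real_of_int (ev j) * (u x * q x) \<partial>?M)"
    proof (intro Bochner_Integration.integral_cong refl)
      fix x assume "x \<in> space ?M"
      then have "- slaplace q x = real_of_int (ev j) * q x"
        using q unfolding spherical_eigenfunction_def ev by simp
      then have "slaplace q x = - real_of_int (ev j) * q x"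
        by simp
      then show "u x * slaplace q x = - real_of_int (ev j) * (u x * q x)"
        by simp
    qed
    also have "\<dots> = - real_of_int (ev j) * (\<integral>x. u x * q x \<partial>?M)"
      by (rule integral_mult_right_zero)
    finally have gq: "(\<integral>x. ?g x * q x \<partial>?M) = real_of_int (k j) * (\<integral>x. u x * q x \<partial>?M)"
      by (simp add: k_def lam algebra_simps)
    have "(\<integral>x. z x * q x \<partial>?M) = (\<integral>x. 2 * (?g x * q x) - u x * q x \<partial>?M)"
      by (simp add: z_def algebra_simps)
    also have "\<dots> = 2 * (\<integral>x. ?g x * q x \<partial>?M) - (\<integral>x. u x * q x \<partial>?M)"
      using L2_integrable_mult[OF gL2 qL2] L2_integrable_mult[OF uL2 qL2] by simp
    finally have zq: "(\<integral>x. z x * q x \<partial>?M) = (2 * real_of_int (k j) - 1) * (\<integral>x. u x * q x \<partial>?M)"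
      unfolding gq by (simp add: algebra_simps)
    have "2 * k j - 1 \<noteq> 0"
      by presburger
    then have "2 * real_of_int (k j) - 1 \<noteq> 0"
      by linarith
    then show ?thesis
      unfolding gq zq t_def by simp
  qed
  have "0 \<le> (\<integral>x. ?g x * z x \<partial>?M)"
  proof (rule field_le_epsilon)
    fix e :: real assume "0 < e"
    define K where "K = L2_norm ?M z + 1 + L2_norm ?M ?g"
    have K: "0 < K"
      using L2_norm_nonneg[of ?M z] L2_norm_nonneg[of ?M ?g] by (simp add: K_def)
    \<comment> \<open>the total error below is at most \<open>\<epsilon>\<close> times \<open>K\<close>, once \<open>\<epsilon> \<le> 1\<close> bounds the norm of \<open>p\<close> by that of \<open>z\<close> plus 1\<close>
    define \<epsilon> where "\<epsilon> = min 1 (e / K)"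
    have \<epsilon>: "0 < \<epsilon>" "\<epsilon> \<le> 1" "\<epsilon> * K \<le> e"
      using K \<open>0 < e\<close> by (auto simp: \<epsilon>_def min_def field_simps)
    have "z \<in> L2_closure ?M {p. \<exists>n. poly_below n p}"
      unfolding poly_L2_closure by (rule zL2)
    then obtain p n where p: "poly_below n p" and near: "L2_norm ?M (\<lambda>x. z x - p x) < \<epsilon>"
      using L2_closureD[OF _ \<epsilon>(1)] by blast
    obtain q where q: "\<And>j. j < n \<Longrightarrow> spherical_eigenfunction (sphere_eigenvalue (real CARD('n)) (real j)) (q j)"
      and p_eq: "\<And>x. x \<in> sphere 0 1 \<Longrightarrow> p x = (\<Sum>j<n. q j x)"
      using eigenfunction_decomposition[OF d p] by blast
    have pL2: "p \<in> L2 ?M"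
      by (rule smooth_L2[OF poly_below_smooth[OF p]])
    have qL2: "q j \<in> L2 ?M" if "j < n" for j
      using q[OF that] unfolding spherical_eigenfunction_def by (blast intro: smooth_L2 poly_below_smooth)
    have orth: "(\<integral>x. q i x * q j x \<partial>?M) = 0" if "i < n" "j < n" "i \<noteq> j" for i j
    proof (rule orthogonal_eigenfunctions[OF q[OF that(1)] q[OF that(2)]])
      show "sphere_eigenvalue (real CARD('n)) (real i) \<noteq> sphere_eigenvalue (real CARD('n)) (real j)"
        using sphere_eigenvalue_less[of "real CARD('n)" i j] sphere_eigenvalue_less[of "real CARD('n)" j i] d \<open>i \<noteq> j\<close>
        by (cases i j rule: linorder_cases) auto
    qed
    note parseval = integral_orthogonal_sum[of n q ?M, OF qL2 orth]
    define T where "T x = (\<Sum>j<n. t j * q j x)" for x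
    have TL2: "T \<in> L2 ?M"
      unfolding T_def[abs_def] using qL2 by (intro L2_sum L2_cmult) auto
    have p_norm: "(L2_norm ?M p)\<^sup>2 = (\<Sum>j<n. (\<integral>x. (q j x)\<^sup>2 \<partial>?M))"
    proof -
      have "(L2_norm ?M p)\<^sup>2 = (\<integral>x. (\<Sum>j<n. 1 * q j x) * (\<Sum>j<n. 1 * q j x) \<partial>?M)"
        unfolding L2_norm_square by (intro Bochner_Integration.integral_cong refl) (simp add: p_eq power2_eq_square)
      also have "\<dots> = (\<Sum>j<n. 1 * 1 * (\<integral>x. (q j x)\<^sup>2 \<partial>?M))"
        by (rule parseval)
      finally show ?thesis by simp
    qed
    have "(L2_norm ?M T)\<^sup>2 = (\<integral>x. (\<Sum>j<n. t j * q j x) * (\<Sum>j<n. t j * q j x) \<partial>?M)"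
      unfolding L2_norm_square T_def by (simp add: power2_eq_square)
    also have "\<dots> = (\<Sum>j<n. t j * t j * (\<integral>x. (q j x)\<^sup>2 \<partial>?M))"
      by (rule parseval)
    also have "\<dots> \<le> (L2_norm ?M p)\<^sup>2"
      unfolding p_norm using t by (intro sum_mono mult_left_le_one_le) (auto simp: mult_le_one)
    finally have T_norm: "L2_norm ?M T \<le> L2_norm ?M p"
      using L2_norm_nonneg power2_le_imp_le by blast
    have "(\<integral>x. p x * T x \<partial>?M) = (\<integral>x. (\<Sum>j<n. 1 * q j x) * (\<Sum>j<n. t j * q j x) \<partial>?M)"
      unfolding T_def by (intro Bochner_Integration.integral_cong refl) (simp add: p_eq)
    also have "\<dots> = (\<Sum>j<n. 1 * t j * (\<integral>x. (q j x)\<^sup>2 \<partial>?M))"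
      by (rule parseval)
    finally have pT: "0 \<le> (\<integral>x. p x * T x \<partial>?M)"
      using t by (simp add: sum_nonneg)
    have "(\<integral>x. ?g x * p x \<partial>?M) = (\<integral>x. (\<Sum>j<n. ?g x * q j x) \<partial>?M)"
      by (intro Bochner_Integration.integral_cong refl) (simp add: p_eq sum_distrib_left)
    also have "\<dots> = (\<Sum>j<n. \<integral>x. ?g x * q j x \<partial>?M)"
      using qL2 by (intro Bochner_Integration.integral_sum L2_integrable_mult gL2) auto
    also have "\<dots> = (\<Sum>j<n. \<integral>x. z x * (t j * q j x) \<partial>?M)"
      using eigen[OF q] by (intro sum.cong refl) (simp add: mult.left_commute[of _ "t _"])
    also have "\<dots> = (\<integral>x. z x * T x \<partial>?M)"
      unfolding T_def sum_distrib_left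
      using qL2 by (intro Bochner_Integration.integral_sum[symmetric] L2_integrable_mult L2_cmult zL2) auto
    finally have gp: "(\<integral>x. ?g x * p x \<partial>?M) = (\<integral>x. z x * T x \<partial>?M)" .
    have zpL2: "(\<lambda>x. z x - p x) \<in> L2 ?M"
      by (intro L2_diff zL2 pL2)
    have 1: "\<bar>\<integral>x. (z x - p x) * T x \<partial>?M\<bar> \<le> \<epsilon> * (L2_norm ?M z + 1)"
    proof -
      have "L2_norm ?M p \<le> L2_norm ?M z + L2_norm ?M (\<lambda>x. p x - z x)"
        using L2_norm_triangle[OF zL2 L2_diff[OF pL2 zL2]] by simp
      then have "L2_norm ?M T \<le> L2_norm ?M z + 1"
        using T_norm near \<epsilon>(2) unfolding L2_norm_minus_commute[of ?M p] by linarith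
      then have "L2_norm ?M (\<lambda>x. z x - p x) * L2_norm ?M T \<le> \<epsilon> * (L2_norm ?M z + 1)"
        using near L2_norm_nonneg \<epsilon>(1) by (intro mult_mono) auto
      then show ?thesis
        using L2_Cauchy_Schwarz[OF zpL2 TL2] by linarith
    qed
    have 2: "\<bar>\<integral>x. ?g x * (z x - p x) \<partial>?M\<bar> \<le> \<epsilon> * L2_norm ?M ?g"
    proof -
      have "L2_norm ?M ?g * L2_norm ?M (\<lambda>x. z x - p x) \<le> L2_norm ?M ?g * \<epsilon>"
        using near by (intro mult_left_mono L2_norm_nonneg) simp
      then show ?thesis
        using L2_Cauchy_Schwarz[OF gL2 zpL2] by (simp add: mult.commute)
    qed
    have "(\<integral>x. (z x - p x) * T x \<partial>?M) = (\<integral>x. z x * T x \<partial>?M) - (\<integral>x. p x * T x \<partial>?M)"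
      by (subst Bochner_Integration.integral_diff[symmetric])
        (simp_all add: L2_integrable_mult zL2 pL2 TL2 algebra_simps)
    moreover have "(\<integral>x. ?g x * (z x - p x) \<partial>?M) = (\<integral>x. ?g x * z x \<partial>?M) - (\<integral>x. ?g x * p x \<partial>?M)"
      by (subst Bochner_Integration.integral_diff[symmetric])
        (simp_all add: L2_integrable_mult zL2 pL2 gL2 algebra_simps)
    moreover have "\<epsilon> * (L2_norm ?M z + 1) + \<epsilon> * L2_norm ?M ?g \<le> e"
      using \<epsilon>(3) by (simp add: K_def algebra_simps)
    ultimately show "0 \<le> (\<integral>x. ?g x * z x \<partial>?M) + e"
      using 1 2 pT gp by linarith
  qed
  also have "(\<integral>x. ?g x * z x \<partial>?M) = (\<integral>x. 2 * (?g x)\<^sup>2 - u x * ?g x \<partial>?M)"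
    by (simp add: z_def power2_eq_square algebra_simps)
  also have "\<dots> = 2 * (L2_norm ?M ?g)\<^sup>2 - (\<integral>x. u x * ?g x \<partial>?M)"
    unfolding L2_norm_square using L2_integrable_square[OF gL2] L2_integrable_mult[OF uL2 gL2] by simp
  finally show ?thesis
    by simp
qed

section \<open>The slope on the constraint set\<close>

text \<open>
  Cut off a nearby polynomial by a function of \<open>x\<^sub>k\<close> that is zero at 0 and tends to 1 elsewhere;
  the equator is a null set.
\<close>

lemma dense_vanishing_on_equator:
  fixes h :: "real ^ 'n \<Rightarrow> real"
  assumes h: "h \<in> L2 sphere_measure" and "0 < e"
  obtains w where "smooth w" "\<And>x. x $ k = 0 \<Longrightarrow> w x = 0" "L2_norm sphere_measure (\<lambda>x. h x - w x) < e"
proof -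
  let ?M = "sphere_measure :: (real ^ 'n) measure"
  let ?V = "{w :: real ^ 'n \<Rightarrow> real. smooth w \<and> (\<forall>x. x $ k = 0 \<longrightarrow> w x = 0)}"
  have V: "?V \<subseteq> L2 ?M"
    using smooth_L2 by blast
  have "h \<in> L2_closure ?M {p. \<exists>n. poly_below n p}"
    unfolding poly_L2_closure by (rule h)
  then obtain p n where p: "poly_below n p" and near: "L2_norm ?M (\<lambda>x. h x - p x) < e / 2"
    using L2_closureD[OF _ half_gt_zero[OF \<open>0 < e\<close>]] by blast
  have sp: "smooth p"
    by (rule poly_below_smooth[OF p])
  define c where "c n = real (Suc n)" for n
  \<comment> \<open>a cutoff that is 0 at 0 and tends to 1 elsewhere as \<open>n\<close> grows\<close>
  define \<eta> where "\<eta> n s = 1 - inverse (1 + (c n * s)\<^sup>2)" for n and s :: real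
  have pos: "1 + (c n * s)\<^sup>2 \<noteq> 0" "0 < 1 + (c n * s)\<^sup>2" for n s
    using zero_le_power2[of "c n * s"] by linarith+
  have \<eta>_bounds: "0 \<le> \<eta> n s" "\<eta> n s \<le> 1" for n s
    using pos(2)[of n s] by (auto simp: \<eta>_def inverse_le_1_iff)
  have "smooth (\<lambda>x. \<eta> n (x $ k))" for n
  proof -
    have deriv: "((\<eta> n) has_real_derivative (2 * (c n)\<^sup>2 * s * (inverse (1 + (c n * s)\<^sup>2))\<^sup>2)) (at s)" for s
      unfolding \<eta>_def using pos(1)[of n s]
      by (auto intro!: derivative_eq_intros simp: power2_eq_square algebra_simps)
    have cont: "continuous_on UNIV (\<lambda>s. 2 * (c n)\<^sup>2 * s * (inverse (1 + (c n * s)\<^sup>2))\<^sup>2)"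
      using pos(1) by (intro continuous_intros) auto
    show ?thesis
      unfolding smooth_def by (rule exI, rule C1_compose[OF C1_coordinate deriv cont])
  qed
  then have w: "(\<lambda>x. p x * \<eta> n (x $ k)) \<in> ?V" for n
    using sp by (auto simp: \<eta>_def intro: smooth_mult)
  have "p \<in> L2_closure ?M ?V"
  proof (rule L2_closure_dominated_limit[OF V, where f = "\<lambda>n x. p x * \<eta> n (x $ k)" and g = "\<lambda>x. \<bar>p x\<bar>"])
    show "(\<lambda>x. p x * \<eta> n (x $ k)) \<in> L2_closure ?M ?V" for n
    proof (rule L2_closureI)
      show "(\<lambda>x. p x * \<eta> n (x $ k)) \<in> L2 ?M"
        using w V by blast
      show "\<exists>q\<in>?V. L2_norm ?M (\<lambda>x. p x * \<eta> n (x $ k) - q x) < e" if "0 < e" for e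
        using w that by (intro bexI[of _ "\<lambda>x. p x * \<eta> n (x $ k)"]) (simp_all add: L2_norm_def)
    qed
    show "p \<in> borel_measurable ?M"
      by (rule L2_measurable[OF smooth_L2[OF sp]])
    show "(\<lambda>x. \<bar>p x\<bar>) \<in> L2 ?M"
      using smooth_L2[OF sp] by (auto simp: L2_def)
    show "AE x in ?M. (\<lambda>n. p x * \<eta> n (x $ k)) \<longlonglongrightarrow> p x"
      using AE_not_equator[of k]
    proof eventually_elim
      case (elim x)
      have "filterlim (\<lambda>n. c n) at_top sequentially"
        unfolding c_def using filterlim_real_sequentially filterlim_sequentially_Suc by blast
      then have "filterlim (\<lambda>n. (x $ k)\<^sup>2 * (c n)\<^sup>2) at_top sequentially"
        using elim by (intro filterlim_tendsto_pos_mult_at_top[OF tendsto_const] filterlim_pow_at_top) auto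
      then have "filterlim (\<lambda>n. 1 + (c n * x $ k)\<^sup>2) at_top sequentially"
        by (intro filterlim_tendsto_add_at_top[OF tendsto_const]) (simp add: power_mult_distrib mult.commute)
      then have "(\<lambda>n. inverse (1 + (c n * x $ k)\<^sup>2)) \<longlonglongrightarrow> 0"
        by (rule tendsto_inverse_0_at_top)
      then have "(\<lambda>n. p x * (1 - inverse (1 + (c n * x $ k)\<^sup>2))) \<longlonglongrightarrow> p x * (1 - 0)"
        by (intro tendsto_intros)
      then show ?case
        by (simp add: \<eta>_def)
    qed
    show "\<bar>p x * \<eta> n (x $ k)\<bar> \<le> \<bar>p x\<bar>" for n x
      using \<eta>_bounds[of n "x $ k"] by (simp add: abs_mult mult_left_le)
  qed
  then obtain w where w: "w \<in> ?V" "L2_norm ?M (\<lambda>x. p x - w x) < e / 2"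
    using L2_closureD[OF _ half_gt_zero[OF \<open>0 < e\<close>]] by blast
  have "L2_norm ?M (\<lambda>x. (h x - p x) + (p x - w x)) \<le> L2_norm ?M (\<lambda>x. h x - p x) + L2_norm ?M (\<lambda>x. p x - w x)"
    using w(1) V by (intro L2_norm_triangle L2_diff h smooth_L2 sp) auto
  then have "L2_norm ?M (\<lambda>x. h x - w x) < e"
    using near w(2) by simp
  then show thesis
    using w(1) that by blast
qed

text \<open>
  The approximating sequence of \<open>u\<close>, shifted by \<open>w\<close>, shows that \<open>u + w\<close> has the trace of \<open>u\<close>.
\<close>

lemma K_space_add:
  fixes u w :: "real ^ 'n \<Rightarrow> real"
  assumes u: "u \<in> K_space k" and w: "smooth w" "\<And>x. x $ k = 0 \<Longrightarrow> w x = 0"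
  shows "(\<lambda>x. u x + w x) \<in> K_space k"
proof -
  let ?M = "sphere_measure :: (real ^ 'n) measure" and ?v = "\<lambda>x. u x + w x"
  obtain T where uH1: "u \<in> H1" and T: "is_trace k u T" "AE x in equator_measure k. 0 \<le> T x"
    using u by (auto simp: K_space_def)
  obtain \<phi> G where C1: "\<And>n. C1_with_gradient (\<phi> n) (G n)"
    and lim: "(\<lambda>n. L2_norm ?M (\<lambda>x. \<phi> n x - u x)) \<longlonglongrightarrow> 0"
    and lim_grad: "(\<lambda>n. L2_norm ?M (\<lambda>x. norm (tangential x (G n x) - tgrad u x))) \<longlonglongrightarrow> 0"
    and lim_trace: "(\<lambda>n. L2_norm (equator_measure k) (\<lambda>x. \<phi> n x - T x)) \<longlonglongrightarrow> 0"
    and TL2: "T \<in> L2 (equator_measure k)"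
    using T(1) unfolding is_trace_def by blast
  obtain W where W: "C1_with_gradient w W" "\<And>i x. sderiv i w x = tangential x (W x) $ i"
    by (rule smooth_gradient[OF w(1)]) (rule that)
  note v = H1_add_smooth[OF uH1 w(1)]
  have "AE x in ?M. \<forall>i. tderiv i ?v x = tderiv i u x + sderiv i w x"
    using v(2) by (simp add: AE_all_countable AE_finite_all)
  then have AE: "AE x in ?M. norm (tangential x (G n x + W x) - tgrad ?v x) = norm (tangential x (G n x) - tgrad u x)" for n
  proof eventually_elim
    case (elim x)
    have "tangential x (G n x + W x) - tgrad ?v x = tangential x (G n x) - tgrad u x"
      using elim W(2) by (simp add: vec_eq_iff tgrad_def tangential_def inner_add_right algebra_simps)
    then show ?case by simp
  qed
  have meas: "(\<lambda>x. norm (tangential x (H x) - tgrad f x)) \<in> borel_measurable ?M"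
    if H: "C1_with_gradient \<psi> H" and f: "f \<in> H1" for \<psi> H and f :: "real ^ 'n \<Rightarrow> real"
  proof -
    have [measurable]: "(\<lambda>x. tangential x (H x) $ i) \<in> borel_measurable ?M" "tderiv i f \<in> borel_measurable ?M" for i
      using L2_measurable[OF continuous_L2_sphere[OF C1_continuous(4)[OF H]]] L2_measurable[OF H1_tderiv(1)[OF f]] by blast+
    show ?thesis
      unfolding norm_vec_def L2_set_def by (simp add: tgrad_def)
  qed
  have "is_trace k ?v T"
    unfolding is_trace_def
  proof (intro conjI TL2 exI[of _ "\<lambda>n x. \<phi> n x + w x"] exI[of _ "\<lambda>n x. G n x + W x"] allI)
    show "C1_with_gradient (\<lambda>x. \<phi> n x + w x) (\<lambda>x. G n x + W x)" for n
      by (rule C1_add[OF C1 W(1)])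
    show "(\<lambda>n. L2_norm ?M (\<lambda>x. \<phi> n x + w x - ?v x)) \<longlonglongrightarrow> 0"
      using lim by simp
    have "L2_norm ?M (\<lambda>x. norm (tangential x (G n x + W x) - tgrad ?v x)) = L2_norm ?M (\<lambda>x. norm (tangential x (G n x) - tgrad u x))" for n
      by (rule L2_norm_cong_AE[OF AE meas[OF C1_add[OF C1 W(1)] v(1)] meas[OF C1 uH1]])
    then show "(\<lambda>n. L2_norm ?M (\<lambda>x. norm (tangential x (G n x + W x) - tgrad ?v x))) \<longlonglongrightarrow> 0"
      using lim_grad by simp
    have "L2_norm (equator_measure k) (\<lambda>x. \<phi> n x + w x - T x) = L2_norm (equator_measure k) (\<lambda>x. \<phi> n x - T x)" for n
      unfolding L2_norm_def using w(2)
      by (intro arg_cong[where f = sqrt] Bochner_Integration.integral_cong refl)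
        (simp add: equator_measure_def space_restrict_space equator_def)
    then show "(\<lambda>n. L2_norm (equator_measure k) (\<lambda>x. \<phi> n x + w x - T x)) \<longlonglongrightarrow> 0"
      using lim_trace by simp
  qed
  then show ?thesis
    using v(1) T(2) unfolding K_space_def by blast
qed

text \<open>
  The quotient in direction \<open>w\<close> equals \<open>\<parallel>g\<parallel>\<close> for \<open>w = - g\<close>. An admissible \<open>w\<close> within \<open>\<parallel>g\<parallel> / 4\<close> of
  \<open>- g\<close> loses at most a factor \<open>(3/4) / (5/4) = 3/5\<close>.
\<close>

lemma grad_norm_K_ge:
  fixes u :: "real ^ 'n \<Rightarrow> real"
  assumes u: "u \<in> K_space k" "u \<in> H2"
  shows "0 \<le> grad_norm_K k lam u" "L2_norm sphere_measure (grad_F_th lam u) \<le> 2 * grad_norm_K k lam u"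
proof -
  let ?M = "sphere_measure :: (real ^ 'n) measure" and ?g = "grad_F_th lam u"
  define N where "N = L2_norm ?M ?g"
  define Q where "Q = {- (\<integral>x. (v x - u x) * ?g x \<partial>?M) / L2_norm ?M (\<lambda>x. v x - u x) | v.
      v \<in> K_space k \<and> L2_norm ?M (\<lambda>x. v x - u x) \<noteq> 0}"
  have slope: "grad_norm_K k lam u = Sup (insert 0 Q)"
    by (simp add: grad_norm_K_def Q_def)
  have uL2: "u \<in> L2 ?M" and gL2: "?g \<in> L2 ?M"
    using u(2) by (auto intro: H1_L2 H2_H1 grad_F_th_L2)
  have N0: "0 \<le> N"
    by (simp add: N_def L2_norm_nonneg)
  have "s \<le> N" if "s \<in> insert 0 Q" for s
  proof (cases "s = 0")
    case False
    then have "s \<in> Q"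
      using that by simp
    then obtain v where v: "v \<in> K_space k" "L2_norm ?M (\<lambda>x. v x - u x) \<noteq> 0"
      and s: "s = - (\<integral>x. (v x - u x) * ?g x \<partial>?M) / L2_norm ?M (\<lambda>x. v x - u x)"
      unfolding Q_def by blast
    have "(\<lambda>x. v x - u x) \<in> L2 ?M"
      using v(1) by (intro L2_diff uL2) (auto simp: K_space_def H1_L2)
    then have "- (\<integral>x. (v x - u x) * ?g x \<partial>?M) \<le> L2_norm ?M (\<lambda>x. v x - u x) * N"
      using L2_Cauchy_Schwarz[OF _ gL2, of "\<lambda>x. v x - u x"] by (simp add: N_def)
    moreover have "0 < L2_norm ?M (\<lambda>x. v x - u x)"
      using v(2) L2_norm_nonneg[of ?M "\<lambda>x. v x - u x"] by linarith
    ultimately show ?thesis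
      unfolding s by (subst pos_divide_le_eq) (simp_all add: mult.commute)
  qed (use N0 in simp)
  then have bdd: "bdd_above (insert 0 Q)"
    by (rule bdd_aboveI)
  show nonneg: "0 \<le> grad_norm_K k lam u"
    unfolding slope by (rule cSup_upper[OF _ bdd]) simp
  show "L2_norm ?M ?g \<le> 2 * grad_norm_K k lam u"
  proof (cases "N = 0")
    case True
    then show ?thesis
      using nonneg by (simp add: N_def)
  next
    case False
    then have N: "0 < N"
      using N0 by simp
    obtain w where w: "smooth w" "\<And>x. x $ k = 0 \<Longrightarrow> w x = 0" and near: "L2_norm ?M (\<lambda>x. - ?g x - w x) < N / 4"
      using dense_vanishing_on_equator[OF L2_uminus[OF gL2], of "N / 4" k] N by auto
    have wL2: "w \<in> L2 ?M"
      by (rule smooth_L2[OF w(1)])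
    have rL2: "(\<lambda>x. - ?g x - w x) \<in> L2 ?M"
      by (intro L2_diff L2_uminus gL2 wL2)
    have uminus: "L2_norm ?M (\<lambda>x. - f x) = L2_norm ?M f" for f
      by (simp add: L2_norm_def)
    have "N = L2_norm ?M (\<lambda>x. (- ?g x - w x) + w x)"
      by (simp add: N_def uminus)
    also have "\<dots> \<le> L2_norm ?M (\<lambda>x. - ?g x - w x) + L2_norm ?M w"
      by (rule L2_norm_triangle[OF rL2 wL2])
    finally have w_pos: "0 < L2_norm ?M w"
      using near N by linarith
    have "L2_norm ?M w = L2_norm ?M (\<lambda>x. - ?g x + - (- ?g x - w x))"
      by simp
    also have "\<dots> \<le> L2_norm ?M (\<lambda>x. - ?g x) + L2_norm ?M (\<lambda>x. - (- ?g x - w x))"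
      by (intro L2_norm_triangle L2_uminus gL2 rL2)
    also have "\<dots> = N + L2_norm ?M (\<lambda>x. - ?g x - w x)"
      unfolding uminus N_def ..
    finally have w_le: "L2_norm ?M w \<le> 5 / 4 * N"
      using near by linarith
    have "(\<integral>x. (- ?g x - w x) * ?g x \<partial>?M) = - (\<integral>x. (?g x)\<^sup>2 \<partial>?M) - (\<integral>x. w x * ?g x \<partial>?M)"
    proof -
      have "(\<integral>x. (- ?g x - w x) * ?g x \<partial>?M) = (\<integral>x. - (?g x)\<^sup>2 - w x * ?g x \<partial>?M)"
        by (simp add: power2_eq_square algebra_simps)
      then show ?thesis
        using L2_integrable_square[OF gL2] L2_integrable_mult[OF wL2 gL2] by simp
    qed
    moreover have "\<bar>\<integral>x. (- ?g x - w x) * ?g x \<partial>?M\<bar> \<le> N / 4 * N"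
      using L2_Cauchy_Schwarz[OF rL2 gL2] mult_right_mono[OF less_imp_le[OF near] N0] by (simp add: N_def)
    moreover have "N / 4 * N = N\<^sup>2 / 4" "N\<^sup>2 = (\<integral>x. (?g x)\<^sup>2 \<partial>?M)"
      by (simp_all add: power2_eq_square N_def L2_norm_square[unfolded power2_eq_square])
    ultimately have "3 / 4 * N\<^sup>2 \<le> - (\<integral>x. w x * ?g x \<partial>?M)"
      by linarith
    moreover have "N / 2 * L2_norm ?M w \<le> N / 2 * (5 / 4 * N)"
      using w_le N0 by (intro mult_left_mono) auto
    moreover have "N / 2 * (5 / 4 * N) \<le> 3 / 4 * N\<^sup>2"
      by (simp add: power2_eq_square)
    ultimately have "N / 2 * L2_norm ?M w \<le> - (\<integral>x. w x * ?g x \<partial>?M)"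
      by linarith
    then have "N / 2 \<le> - (\<integral>x. w x * ?g x \<partial>?M) / L2_norm ?M w"
      by (subst pos_le_divide_eq[OF w_pos])
    also have "\<dots> \<in> insert 0 Q"
      unfolding Q_def using K_space_add[OF u(1) w] w_pos
      by (intro insertI2 CollectI exI[of _ "\<lambda>x. u x + w x"]) simp
    then have "- (\<integral>x. w x * ?g x \<partial>?M) / L2_norm ?M w \<le> grad_norm_K k lam u"
      unfolding slope by (rule cSup_upper[OF _ bdd])
    finally show ?thesis
      by (simp add: N_def)
  qed
qed

lemma F_th_le_slope:
  fixes u :: "real ^ 'n \<Rightarrow> real"
  assumes "2 \<le> CARD('n)" "lam = real_of_int l" and u: "u \<in> K_space k" "u \<in> H2"
  shows "F_th lam u \<le> (2 * grad_norm_K k lam u)\<^sup>2"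
proof -
  obtain T where "is_trace k u T"
    using u(1) by (auto simp: K_space_def)
  from F_th_eq[OF u(2) this, of lam] spectral_inequality[OF assms(1) u(2) assms(2)]
  have "F_th lam u \<le> (L2_norm sphere_measure (grad_F_th lam u))\<^sup>2"
    by linarith
  also have "\<dots> \<le> (2 * grad_norm_K k lam u)\<^sup>2"
    by (intro power_mono grad_norm_K_ge u L2_norm_nonneg)
  finally show ?thesis .
qed

text \<open>
  For \<open>F \<le> 1\<close>, \<open>F\<^sup>1\<^sup>-\<^sup>\<gamma> \<le> F\<^sup>1\<^sup>/\<^sup>2\<close> because \<open>1 - \<gamma> \<ge> 1/2\<close>; for larger \<open>F\<close> the excess power
  \<open>F\<^sup>1\<^sup>/\<^sup>2\<^sup>-\<^sup>\<gamma>\<close> is bounded by the same power of \<open>E\<close>.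
\<close>

lemma f_gam_le:
  assumes "F \<le> s\<^sup>2" "0 \<le> s" "\<gamma> \<le> 1 / 2"
  shows "f_gam \<gamma> F \<le> s"
    and "1 \<le> E \<Longrightarrow> F \<le> E \<Longrightarrow> max 0 F powr (1 - \<gamma>) \<le> E powr (1 / 2 - \<gamma>) * s"
proof -
  have root: "F powr (1 / 2) \<le> s" if "0 \<le> F"
    using that assms(1,2) by (simp add: powr_half_sqrt real_le_lsqrt)
  have small: "F powr (1 - \<gamma>) \<le> s" if "0 \<le> F" "F \<le> 1"
    using powr_mono'[of "1 / 2" "1 - \<gamma>" F] that root assms(3) by simp
  show "f_gam \<gamma> F \<le> s"
    using root small assms(2) by (auto simp: f_gam_def)
  assume E: "1 \<le> E" "F \<le> E"
  have E_ge: "1 \<le> E powr (1 / 2 - \<gamma>)"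
    using E(1) assms(3) by (simp add: ge_one_powr_ge_zero)
  show "max 0 F powr (1 - \<gamma>) \<le> E powr (1 / 2 - \<gamma>) * s"
  proof (cases "1 \<le> F")
    case True
    have "F powr (1 - \<gamma>) = F powr (1 / 2 - \<gamma>) * F powr (1 / 2)"
      by (simp flip: powr_add)
    also have "\<dots> \<le> E powr (1 / 2 - \<gamma>) * s"
      using True E assms(3) root by (intro mult_mono powr_mono2) auto
    finally show ?thesis
      using True by simp
  next
    case False
    have "max 0 F powr (1 - \<gamma>) \<le> s"
      using False small assms(2) by (cases "0 \<le> F") (auto simp: max_def)
    also have "\<dots> \<le> E powr (1 / 2 - \<gamma>) * s"
      using E_ge assms(2) mult_right_mono[of 1 "E powr (1 / 2 - \<gamma>)" s] by simp
    finally show ?thesis .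
  qed
qed

theorem proposition4p5:
  fixes m d :: nat and lam \<gamma> :: real
  assumes "d = CARD('n::finite)" and "d \<ge> 2"
    and "lam = real (2 * m) * (real (2 * m) + real d - 2)"
    and "\<gamma> = 1 / real d"
  shows "\<exists>C \<delta>. C > 0 \<and> \<delta> > 0 \<and> (\<forall>k :: 'n.
           (\<forall>u \<in> K_space k \<inter> H2. dist2 u (S_space k lam) \<le> \<delta> \<longrightarrow>
              f_gam \<gamma> (F_th lam u) \<le> C * grad_norm_K k lam u) \<and>
           (\<forall>E \<ge> 1. \<forall>u \<in> H2 \<inter> K_space k.
              dist2 u (S_space k lam) \<le> \<delta> \<and> F_th lam u \<le> E \<longrightarrow>
              (max 0 (F_th lam u)) powr (1 - \<gamma>)
                \<le> C * E powr (1 / 2 - \<gamma>) * grad_norm_K k lam u))"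
proof -
  define l where "l = int (2 * m) * (int (2 * m) + int d - 2)"
  have lam: "lam = real_of_int l"
    by (simp add: assms(3) l_def)
  have card: "2 \<le> CARD('n)"
    using assms(1,2) by simp
  have \<gamma>: "\<gamma> \<le> 1 / 2"
    unfolding assms(4) using assms(2) by (intro divide_left_mono) auto
  have bound: "F_th lam u \<le> (2 * grad_norm_K k lam u)\<^sup>2" "0 \<le> 2 * grad_norm_K k lam u"
    if "u \<in> K_space k" "u \<in> H2" for k :: 'n and u
    using F_th_le_slope[OF card lam that] grad_norm_K_ge(1)[OF that] by auto
  show ?thesis
  proof (rule exI[of _ "2 :: real"], rule exI[of _ "1 :: real"], intro conjI allI ballI impI)
    fix k :: 'n and u assume "u \<in> K_space k \<inter> H2"
    then show "f_gam \<gamma> (F_th lam u) \<le> 2 * grad_norm_K k lam u"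
      by (intro f_gam_le bound \<gamma>) auto
  next
    fix k :: 'n and E :: real and u
    assume "1 \<le> E" "u \<in> H2 \<inter> K_space k" "dist2 u (S_space k lam) \<le> 1 \<and> F_th lam u \<le> E"
    then have "max 0 (F_th lam u) powr (1 - \<gamma>) \<le> E powr (1 / 2 - \<gamma>) * (2 * grad_norm_K k lam u)"
      by (intro f_gam_le bound \<gamma>) auto
    then show "max 0 (F_th lam u) powr (1 - \<gamma>) \<le> 2 * E powr (1 / 2 - \<gamma>) * grad_norm_K k lam u"
      by (simp add: mult_ac)
  qed simp_all
qed

end
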